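(* Let $k\ge1$ and let $2\le r_1<\dots<r_k$ and $s_1,\dots,s_k$ be integers with all $s_i\ge1$ and $s_k\ge2$. Let $$\overline r_1=s_k,\quad \overline r_2=s_k+s_{k-1},\quad\dots,\quad \overline r_k=s_k+s_{k-1}+\dots+s_1,$$ $$\overline s_1=r_k-r_{k-1},\quad \overline s_2=r_{k-1}-r_{k-2},\quad\dots,\quad \overline s_{k-1}=r_2-r_1,\quad \overline s_k=r_1.$$ Then the T-links $T((r_1,s_1),\dots,(r_k,s_k))$ and $T((\overline r_1,\overline s_1),\dots,(\overline r_k,\overline s_k))$ have the same link type.
   Context: For integers $2\le r_1\le\dots\le r_k$ and $s_i>0$, $i=1,\dots,k$, the T-link $T((r_1,s_1),\dots,(r_k,s_k))$ is the closure of the positive $r_k$-strand braid $(\sigma_1\cdots\sigma_{r_1-1})^{s_1}(\sigma_1\cdots\sigma_{r_2-1})^{s_2}\cdots(\sigma_1\cdots\sigma_{r_k-1})^{s_k}$, where the $\sigma_i$ are the standard braid generators. Link type means ambient isotopy class. *)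

theory Defs
  imports "HOL-Analysis.Analysis"
begin

text \<open>
  Links are subsets of Euclidean 3-space, without orientation. Two of them are ambient isotopic if a
  homeomorphism of the whole space that is isotopic to the identity (through homeomorphisms) takes
  one to the other.
\<close>

definition ambient_isotopic :: "(real ^ 3) set \<Rightarrow> (real ^ 3) set \<Rightarrow> bool" where
  "ambient_isotopic K L \<longleftrightarrow>
     (\<exists>f. homotopic_with_canon (\<lambda>h. \<exists>g. homeomorphism UNIV UNIV h g) UNIV UNIV id f \<and> f ` K = L)"

text \<open>
  A geometric braid on \<open>n\<close> strands is a motion of \<open>n\<close> points in the complex plane, starting and
  ending at the points \<open>1, \<dots>, n\<close>. In the generator with index \<open>i\<close>, where \<open>1 \<le> i < n\<close>, the points
  \<open>i\<close> and \<open>i + 1\<close> change places by a half turn about their midpoint and the others rest.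
  The half turn is clockwise: under the embedding \<open>page_point\<close> below this is a right-handed twist,
  so that the crossings of a positive braid are positive.
\<close>

definition generator_motion :: "nat \<Rightarrow> nat \<Rightarrow> real \<Rightarrow> complex set" where
  "generator_motion n i t =
     of_nat ` ({1..n} - {i, i + 1}) \<union>
     {of_nat i + 1 / 2 - cis (- pi * t) / 2, of_nat i + 1 / 2 + cis (- pi * t) / 2}"

text \<open>
  A positive braid word is the list of the indices of its generators. Its generators are performed
  from left to right, each in an equal part of the time interval \<open>{0..1}\<close>.
\<close>

definition braid_motion :: "nat \<Rightarrow> nat list \<Rightarrow> real \<Rightarrow> complex set" where
  "braid_motion n w t =
     (if w = [] then of_nat ` {1..n}
      else generator_motion n (w ! nat \<lfloor>real (length w) * t\<rfloor>) (frac (real (length w) * t)))"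

text \<open>
  The complex plane at time \<open>t\<close> is placed as the vertical plane through the third coordinate axis
  at angle \<open>2 * pi * t\<close>. All points of a braid motion have positive real part, so the closed braid
  winds around the axis and avoids it. The times \<open>0\<close> and \<open>1\<close> give the same points.
\<close>

definition page_point :: "real \<Rightarrow> complex \<Rightarrow> real ^ 3" where
  "page_point t z = vector [Re z * cos (2 * pi * t), Re z * sin (2 * pi * t), Im z]"

definition braid_closure :: "nat \<Rightarrow> nat list \<Rightarrow> (real ^ 3) set" where
  "braid_closure n w = (\<Union>t\<in>{0..<1}. page_point t ` braid_motion n w t)"

definition T_word :: "nat \<Rightarrow> (nat \<Rightarrow> nat) \<Rightarrow> (nat \<Rightarrow> nat) \<Rightarrow> nat list" where
  "T_word k r s = concat (map (\<lambda>i. concat (replicate (s i) [1..<r i])) [1..<k + 1])"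

text \<open>The parameters \<open>(r i, s i)\<close> are indexed by \<open>i \<in> {1..k}\<close>, with \<open>r k\<close> the largest of the \<open>r i\<close>.\<close>

definition T_link :: "nat \<Rightarrow> (nat \<Rightarrow> nat) \<Rightarrow> (nat \<Rightarrow> nat) \<Rightarrow> (real ^ 3) set" where
  "T_link k r s = braid_closure (r k) (T_word k r s)"

end

theory Submission
  imports Defs
begin

text \<open>
  The parameters \<open>(r i, s i)\<close> describe a Young diagram with \<open>s i\<close> rows of length \<open>r i\<close>, and the dual
  parameters describe the transposed diagram. A row of length \<open>d\<close> stands for the word \<open>[1..<d]\<close>, in
  which one strand passes above \<open>d - 1\<close> others. Both T-links are compared with the closed Lorenz braid of the
  diagram, which has one strand for each row and one for each column; the \<open>i\<close>-th row strand passes above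
  as many column strands as the \<open>i\<close>-th row has boxes. This braid is symmetric: a half turn of all pages
  exchanges row strands and column strands, and turns it into the Lorenz braid of the transposed
  diagram (\<open>lorenz_flip\<close>). On the other hand each row strand can be removed by a Markov
  destabilisation, and removing all of them leaves the T-link braid, whose strands correspond to the
  columns (\<open>lorenz_destabilise\<close>). Doing this to the Lorenz braids of the diagram and of its transpose
  gives the two T-links.

  The argument on words uses four moves on closed positive braids, and for each of them an ambient
  isotopy of 3-space has to be given: cyclic rotation of the word (a rotation about the axis), the half
  turn (a rotation of a disc in every page), the braid relations, and the removal of a strand that
  crosses the others in a single letter 1. The braid relations follow from a principle of isotopy
  extension (\<open>straight_isotopy\<close>): if the straight line homotopy between two motions of points in the
  pages has no collisions, then the closures are ambient isotopic, because the homotopy can be cut into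
  steps so small that cone-shaped bumps around the strands realise them. For destabilisation
  (\<open>braid_closure_destabilise\<close>) the loop around the axis is made a helix. It then meets every
  horizontal plane in at most one point, which may be moved freely in a disc around the axis, so that
  the turn around the axis can be undone.
\<close>

section \<open>Ambient isotopy\<close>

text \<open>By invariance of domain the inverse of a continuous bijection of 3-space is continuous.\<close>

lemma ambient_isotopicI:
  fixes H :: "real \<Rightarrow> real ^ 3 \<Rightarrow> real ^ 3"
  assumes cont: "continuous_on ({0..1} \<times> UNIV) (\<lambda>(s, x). H s x)"
    and bij: "\<And>s. s \<in> {0..1} \<Longrightarrow> bij (H s)"
    and id: "\<And>x. H 0 x = x"
  shows "ambient_isotopic K (H 1 ` K)"
proof -
  have "\<exists>g. homeomorphism UNIV UNIV (H s) g" if "s \<in> {0..1}" for s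
  proof -
    have "continuous_on UNIV ((\<lambda>(s, x). H s x) \<circ> Pair s)"
      by (intro continuous_on_compose continuous_intros continuous_on_subset [OF cont])
         (use that in auto)
    then have "continuous_on UNIV (H s)"
      by (simp add: o_def)
    moreover have "inj (H s)" "range (H s) = UNIV"
      using bij [of s] that by (auto simp: bij_def)
    ultimately show ?thesis
      using invariance_of_domain_homeomorphism [of UNIV "H s"] by (metis open_UNIV order_refl)
  qed
  then have "homotopic_with_canon (\<lambda>h. \<exists>g. homeomorphism UNIV UNIV h g) UNIV UNIV id (H 1)"
    unfolding homotopic_with_def
    using cont id
    by (intro exI [of _ "\<lambda>(s, x). H s x"])
       (auto simp: id_def prod_topology_subtopology simp flip: euclidean_product_topology)
  then show ?thesis
    unfolding ambient_isotopic_def by blast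
qed

lemma ambient_isotopicE:
  assumes "ambient_isotopic K L"
  obtains H :: "real \<Rightarrow> real ^ 3 \<Rightarrow> real ^ 3"
  where "continuous_on ({0..1} \<times> UNIV) (\<lambda>(s, x). H s x)"
    and "\<forall>s\<in>{0..1}. \<exists>g. homeomorphism UNIV UNIV (H s) g"
    and "\<forall>x. H 0 x = x" and "L = H 1 ` K"
proof -
  obtain f where f: "homotopic_with_canon (\<lambda>h. \<exists>g. homeomorphism UNIV UNIV h g) UNIV UNIV id f"
    and L: "f ` K = L"
    using assms unfolding ambient_isotopic_def by blast
  have "\<exists>h. continuous_on ({0..1::real} \<times> UNIV) h \<and> (\<forall>x. h (0, x) = id x) \<and> (\<forall>x. h (1, x) = f x) \<and>
      (\<forall>t\<in>{0..1}. \<exists>g. homeomorphism UNIV UNIV (\<lambda>x. h (t, x)) g)"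
    using f unfolding homotopic_with_def
    by (simp add: prod_topology_subtopology flip: euclidean_product_topology)
  then obtain h :: "real \<times> (real ^ 3) \<Rightarrow> real ^ 3" where h: "continuous_on ({0..1} \<times> UNIV) h" "\<forall>x. h (0, x) = id x" "\<forall>x. h (1, x) = f x"
    "\<forall>t\<in>{0..1}. \<exists>g. homeomorphism UNIV UNIV (\<lambda>x. h (t, x)) g"
    by blast
  show thesis
    by (rule that [of "\<lambda>s x. h (s, x)"]) (use h L in auto)
qed

lemma homeomorphism_UNIV_bij: "homeomorphism UNIV UNIV h g \<Longrightarrow> bij h"
  by (rule o_bij [of g]) (auto simp: homeomorphism_def)

lemma ambient_isotopic_refl: "ambient_isotopic K K"
  using ambient_isotopicI [of "\<lambda>s x. x" K] bij_id
  by (simp add: split_def continuous_on_snd id_def)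

lemma ambient_isotopic_trans:
  assumes "ambient_isotopic K L" "ambient_isotopic L M"
  shows "ambient_isotopic K M"
proof -
  obtain H :: "real \<Rightarrow> real ^ 3 \<Rightarrow> real ^ 3" where H: "continuous_on ({0..1} \<times> UNIV) (\<lambda>(s, x). H s x)"
    "\<forall>s\<in>{0..1}. \<exists>g. homeomorphism UNIV UNIV (H s) g" "\<forall>x. H 0 x = x" "L = H 1 ` K"
    by (rule ambient_isotopicE [OF assms(1)], rule that)
  obtain G :: "real \<Rightarrow> real ^ 3 \<Rightarrow> real ^ 3" where G: "continuous_on ({0..1} \<times> UNIV) (\<lambda>(s, x). G s x)"
    "\<forall>s\<in>{0..1}. \<exists>g. homeomorphism UNIV UNIV (G s) g" "\<forall>x. G 0 x = x" "M = G 1 ` L"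
    by (rule ambient_isotopicE [OF assms(2)], rule that)
  have "continuous_on ({0..1::real} \<times> UNIV) ((\<lambda>(s, x). G s x) \<circ> (\<lambda>p :: real \<times> (real ^ 3). (fst p, (\<lambda>(s, x). H s x) p)))"
    by (intro continuous_on_compose continuous_intros H continuous_on_subset [OF G(1)]) auto
  moreover have "bij (\<lambda>x. G s (H s x))" if "s \<in> {0..1}" for s
  proof -
    have "bij (H s)" "bij (G s)"
      using H(2) G(2) that homeomorphism_UNIV_bij by blast+
    then show ?thesis
      using bij_comp by (force simp: o_def)
  qed
  ultimately have "ambient_isotopic K ((\<lambda>x. G 1 (H 1 x)) ` K)"
    using H(3) G(3) by (intro ambient_isotopicI [of "\<lambda>s x. G s (H s x)"]) (auto simp: o_def split_def)
  then show ?thesis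
    by (simp add: H(4) G(4) image_image)
qed

text \<open>
  The inverse of the final map carries \<open>L\<close> back to \<open>K\<close>, and running the isotopy backwards after it
  joins it to the identity; this avoids showing that the inverses depend continuously on time.
\<close>

lemma ambient_isotopic_sym:
  assumes "ambient_isotopic K L"
  shows "ambient_isotopic L K"
proof -
  obtain H :: "real \<Rightarrow> real ^ 3 \<Rightarrow> real ^ 3" where H: "continuous_on ({0..1} \<times> UNIV) (\<lambda>(s, x). H s x)"
    "\<forall>s\<in>{0..1}. \<exists>g. homeomorphism UNIV UNIV (H s) g" "\<forall>x. H 0 x = x" "L = H 1 ` K"
    by (rule ambient_isotopicE [OF assms(1)], rule that)
  obtain g where g: "homeomorphism UNIV UNIV (H 1) g"
    using H(2) by force
  have "continuous_on ({0..1} \<times> UNIV) ((\<lambda>(s, x). H s x) \<circ> (\<lambda>p. (1 - fst p, g (snd p))))"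
    by (intro continuous_on_compose continuous_intros continuous_on_subset [OF H(1)]
        continuous_on_compose2 [OF homeomorphism_cont2 [OF g]]) auto
  moreover have "bij (\<lambda>x. H (1 - s) (g x))" if "s \<in> {0..1}" for s
  proof -
    have "\<exists>k. homeomorphism UNIV UNIV (H (1 - s)) k"
      using H(2) that by auto
    then have "bij (H (1 - s))" "bij g"
      using g homeomorphism_UNIV_bij homeomorphism_sym by blast+
    then show ?thesis
      using bij_comp by (force simp: o_def)
  qed
  moreover have "H 1 (g x) = x" "g (H 1 x) = x" for x
    using g by (auto simp: homeomorphism_def)
  ultimately have "ambient_isotopic L ((\<lambda>x. H (1 - 1) (g x)) ` L)"
    by (intro ambient_isotopicI [of "\<lambda>s x. H (1 - s) (g x)"]) (auto simp: o_def split_def)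
  then show ?thesis
    using \<open>\<And>x. g (H 1 x) = x\<close> by (simp add: H(3,4) image_image)
qed

section \<open>Isotopies that respect the pages\<close>

lemma page_point_nth [simp]:
  "page_point t z $ 1 = Re z * cos (2 * pi * t)"
  "page_point t z $ 2 = Re z * sin (2 * pi * t)"
  "page_point t z $ 3 = Im z"
  by (simp_all add: page_point_def)

lemma vec3_eq_iff: "x = y \<longleftrightarrow> x $ 1 = y $ 1 \<and> x $ 2 = y $ 2 \<and> x $ 3 = y $ 3" for x y :: "real ^ 3"
  by (simp add: vec_eq_iff forall_3)

lemma page_point_axis: "Re z = 0 \<Longrightarrow> page_point t z = page_point t' z"
  by (simp add: vec3_eq_iff)

lemma page_point_add_int:
  assumes "k \<in> \<int>"
  shows "page_point (t + k) z = page_point t z"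
proof -
  obtain n :: int where "k = of_int n"
    using assms by (auto simp: Ints_def)
  then show ?thesis
    using sin_int_2pin [of n] cos_int_2pin [of n]
    by (simp add: vec3_eq_iff distrib_left sin_add cos_add)
qed

lemma continuous_on_page_point [continuous_intros]:
  fixes f :: "'a::t2_space \<Rightarrow> real"
  assumes "continuous_on S f" "continuous_on S g"
  shows "continuous_on S (\<lambda>x. page_point (f x) (g x))"
proof -
  have "continuous_on S (\<lambda>x. page_point (f x) (g x) $ i)" for i
  proof -
    have "continuous_on S (\<lambda>x. page_point (f x) (g x) $ 1)"
      "continuous_on S (\<lambda>x. page_point (f x) (g x) $ 2)"
      "continuous_on S (\<lambda>x. page_point (f x) (g x) $ 3)"
      unfolding page_point_nth by (intro continuous_intros assms)+
    then show ?thesis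
      using exhaust_3 [of i] by auto
  qed
  then have "continuous_on S (\<lambda>x. \<chi> i. page_point (f x) (g x) $ i)"
    by (intro continuous_on_vec_lambda)
  then show ?thesis
    by simp
qed

lemma norm_page_point: "norm (page_point t z) = norm z"
proof -
  have "(norm (page_point t z))\<^sup>2
      = (Re z * cos (2 * pi * t))\<^sup>2 + (Re z * sin (2 * pi * t))\<^sup>2 + (Im z)\<^sup>2"
    unfolding power2_norm_eq_inner by (simp add: inner_vec_def sum_3 power2_eq_square)
  also have "\<dots> = (Re z)\<^sup>2 * ((cos (2 * pi * t))\<^sup>2 + (sin (2 * pi * t))\<^sup>2) + (Im z)\<^sup>2"
    by (simp only: power_mult_distrib distrib_left)
  also have "\<dots> = (norm z)\<^sup>2"
    by (simp add: cmod_power2)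
  finally show ?thesis
    by (simp add: power2_eq_iff_nonneg)
qed

lemma page_point_eqD:
  assumes eq: "page_point t z = page_point t' z'" and "Re z \<ge> 0" "Re z' \<ge> 0"
  shows "z = z'" and "Re z = 0 \<or> t - t' \<in> \<int>"
proof -
  let ?c = "cis (2 * pi * t)" and ?c' = "cis (2 * pi * t')"
  have *: "of_real (Re z) * ?c = of_real (Re z') * ?c'" and Im: "Im z = Im z'"
    using eq by (auto simp: vec3_eq_iff complex_eq_iff)
  have "norm (of_real (Re z) * ?c) = norm (of_real (Re z') * ?c')"
    using * by simp
  then have Re: "Re z = Re z'"
    using assms by (simp add: norm_mult)
  show "z = z'"
    using Re Im by (simp add: complex_eq_iff)
  show "Re z = 0 \<or> t - t' \<in> \<int>"
  proof (cases "Re z = 0")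
    case False
    then have "?c = ?c'"
      using * Re by simp
    then have "cis (2 * pi * t - 2 * pi * t') = 1"
      by (simp flip: cis_divide)
    then have "cos (2 * pi * t - 2 * pi * t') = 1"
      by (simp add: complex_eq_iff)
    then obtain k :: int where "2 * pi * t - 2 * pi * t' = of_int k * 2 * pi"
      unfolding cos_one_2pi_int by blast
    then have "pi * (t - t') = pi * of_int k"
      by (simp add: algebra_simps)
    then have "t - t' = of_int k"
      using pi_neq_zero mult_left_cancel by blast
    then show ?thesis
      by auto
  qed auto
qed

lemma page_point_surj:
  fixes x :: "real ^ 3"
  obtains t z where "t \<in> {a..<a + 1}" "Re z \<ge> 0" "x = page_point t z"
proof -
  define w where "w = Complex (x $ 1) (x $ 2)"
  define u where "u = Arg w / (2 * pi)"
  define z where "z = Complex (norm w) (x $ 3)"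
  have "x = page_point u z"
    using rcis_cmod_Arg [of w] by (auto simp: vec3_eq_iff u_def z_def w_def rcis_def complex_eq_iff)
  define t where "t = u - of_int \<lfloor>u - a\<rfloor>"
  have "t \<in> {a..<a + 1}"
    unfolding t_def atLeastLessThan_iff by linarith
  moreover have "x = page_point t z"
    using \<open>x = page_point u z\<close> page_point_add_int [of "- of_int \<lfloor>u - a\<rfloor>" u z] by (simp add: t_def)
  moreover have "Re z \<ge> 0"
    by (simp add: z_def)
  ultimately show thesis
    using that by blast
qed

text \<open>
  A proper continuous map \<open>Q\<close> is closed, so a subset of its image is closed as soon as its preimage is.
\<close>

lemma continuous_on_factor_proper:
  fixes Q :: "'a::heine_borel \<Rightarrow> 'b::real_normed_vector" and H :: "'b \<Rightarrow> 'c::topological_space"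
  assumes "closed X" "closed (Q ` X)" and Q: "continuous_on X Q"
    and proper: "\<And>B. bounded B \<Longrightarrow> bounded {x \<in> X. Q x \<in> B}"
    and G: "continuous_on X (\<lambda>x. H (Q x))"
  shows "continuous_on (Q ` X) H"
  unfolding continuous_on_closed_vimage [OF assms(2)]
proof (intro allI impI)
  fix C :: "'c set" assume "closed C"
  define S where "S = X \<inter> (\<lambda>x. H (Q x)) -` C"
  have "closed S"
    using G \<open>closed C\<close> \<open>closed X\<close> by (simp add: S_def continuous_on_closed_vimage Int_commute)
  have "closed (Q ` S)"
    unfolding closed_sequential_limits
  proof (intro allI impI, elim conjE)
    fix y l assume "\<forall>n. y n \<in> Q ` S" and lim: "y \<longlonglongrightarrow> l"
    then obtain x where x: "\<And>n. x n \<in> S" "\<And>n. y n = Q (x n)"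
      unfolding image_iff by metis
    have "bounded (range y)"
      using lim convergent_imp_bounded by blast
    then have "bounded {x \<in> X. Q x \<in> range y}"
      by (rule proper)
    moreover have "range x \<subseteq> {x \<in> X. Q x \<in> range y}"
      using x by (auto simp: S_def)
    ultimately have "bounded (range x)"
      using bounded_subset by blast
    then obtain a r where a: "strict_mono r" "(x \<circ> r) \<longlonglongrightarrow> a"
      using bounded_imp_convergent_subsequence by blast
    have "a \<in> S"
      using a x(1) \<open>closed S\<close> unfolding closed_sequential_limits by (metis comp_apply)
    then have "a \<in> X"
      by (simp add: S_def)
    have "((Q \<circ> (x \<circ> r)) \<longlonglongrightarrow> Q a)"
      using Q a(2) x(1) \<open>a \<in> X\<close> unfolding continuous_on_sequentially S_def by auto
    moreover have "(Q \<circ> (x \<circ> r)) = y \<circ> r"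
      using x(2) by auto
    ultimately have "l = Q a"
      using LIMSEQ_subseq_LIMSEQ [OF lim a(1)] LIMSEQ_unique by metis
    then show "l \<in> Q ` S"
      using \<open>a \<in> S\<close> by blast
  qed
  moreover have "Q ` S = H -` C \<inter> Q ` X"
    by (auto simp: S_def)
  ultimately show "closed (H -` C \<inter> Q ` X)"
    by simp
qed

text \<open>
  The half planes bounded by the axis form an open book. A family of homeomorphisms of the half
  plane that fixes the axis, together with a family of reparametrisations of the circle of pages,
  glues to an ambient isotopy.
\<close>

lemma page_isotopy:
  fixes \<phi> :: "real \<Rightarrow> real \<Rightarrow> real" and h :: "real \<Rightarrow> real \<Rightarrow> complex \<Rightarrow> complex"
  assumes cont_\<phi>: "continuous_on ({0..1} \<times> {0..1}) (\<lambda>(s, t). \<phi> s t)"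
    and mono_\<phi>: "\<And>s. s \<in> {0..1} \<Longrightarrow> strict_mono_on {0..1} (\<phi> s)"
    and turn_\<phi>: "\<And>s. s \<in> {0..1} \<Longrightarrow> \<phi> s 1 = \<phi> s 0 + 1"
    and cont_h: "continuous_on ({0..1} \<times> {0..1} \<times> {z. 0 \<le> Re z}) (\<lambda>(s, t, z). h s t z)"
    and bij_h: "\<And>s t. s \<in> {0..1} \<Longrightarrow> t \<in> {0..1} \<Longrightarrow> bij_betw (h s t) {z. 0 \<le> Re z} {z. 0 \<le> Re z}"
    and axis_h: "\<And>s t z. s \<in> {0..1} \<Longrightarrow> t \<in> {0..1} \<Longrightarrow> Re z = 0 \<Longrightarrow> h s t z = z"
    and turn_h: "\<And>s z. s \<in> {0..1} \<Longrightarrow> 0 \<le> Re z \<Longrightarrow> h s 1 z = h s 0 z"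
    and id_\<phi>: "\<And>t. t \<in> {0..1} \<Longrightarrow> \<phi> 0 t = t"
    and id_h: "\<And>t z. t \<in> {0..1} \<Longrightarrow> 0 \<le> Re z \<Longrightarrow> h 0 t z = z"
    and P: "\<And>t z. t \<in> {0..<1} \<Longrightarrow> z \<in> P t \<Longrightarrow> 0 \<le> Re z"
  shows "ambient_isotopic (\<Union>t\<in>{0..<1}. page_point t ` P t)
           (\<Union>t\<in>{0..<1}. page_point (\<phi> 1 t) ` h 1 t ` P t)"
proof -
  define RH where "RH = {z. 0 \<le> Re z}"
  (* Cylindrical coordinates of x, with the angle normalised to {0..<1} and, on the axis, arbitrary. *)
  define par where "par x = (SOME (t, z). t \<in> {0..<1} \<and> z \<in> RH \<and> x = page_point t z)" for x
  have par: "fst (par x) \<in> {0..<1} \<and> snd (par x) \<in> RH \<and> x = page_point (fst (par x)) (snd (par x))" for x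
  proof -
    obtain t z where "t \<in> {0..<0 + 1}" "Re z \<ge> 0" "x = page_point t z"
      using page_point_surj [where a = 0] by blast
    then have "case (t, z) of (t, z) \<Rightarrow> t \<in> {0..<1} \<and> z \<in> RH \<and> x = page_point t z"
      by (auto simp: RH_def)
    from someI [of "\<lambda>(t, z). t \<in> {0..<1} \<and> z \<in> RH \<and> x = page_point t z", OF this]
    show ?thesis
      by (auto simp: par_def split_def)
  qed
  define H where "H s x = page_point (\<phi> s (fst (par x))) (h s (fst (par x)) (snd (par x)))" for s x
  have hRH: "h s t z \<in> RH" if "s \<in> {0..1}" "t \<in> {0..1}" "z \<in> RH" for s t z
    using bij_betwE [OF bij_h [OF that(1,2)]] that(3) by (auto simp: RH_def)
  have H: "H s (page_point t z) = page_point (\<phi> s t) (h s t z)"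
    if s: "s \<in> {0..1}" and t: "t \<in> {0..1}" and z: "z \<in> RH" for s t z
  proof -
    define t' where "t' = fst (par (page_point t z))"
    define z' where "z' = snd (par (page_point t z))"
    have t': "t' \<in> {0..<1}" and z': "z' \<in> RH" and eq: "page_point t z = page_point t' z'"
      using par [of "page_point t z"] by (auto simp: t'_def z'_def)
    have "z = z'" and or: "Re z = 0 \<or> t - t' \<in> \<int>"
      using page_point_eqD [OF eq] z z' by (auto simp: RH_def)
    have Hz: "H s (page_point t z) = page_point (\<phi> s t') (h s t' z)"
      using \<open>z = z'\<close> by (simp add: H_def t'_def z'_def)
    show ?thesis
    proof (cases "Re z = 0")
      case True
      then show ?thesis
        using Hz axis_h s t t' page_point_axis [of z "\<phi> s t" "\<phi> s t'"] by simp
    next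
      case False
      then obtain k :: int where k: "t - t' = of_int k"
        using or by (auto simp: Ints_def)
      have "k = 0 \<or> k = 1"
        using k t t' by auto
      then show ?thesis
      proof
        assume "k = 0"
        then show ?thesis
          using k Hz by simp
      next
        assume "k = 1"
        then have "t = 1" "t' = 0"
          using k t t' by auto
        then show ?thesis
          using Hz z s turn_h turn_\<phi> page_point_add_int [of 1 "\<phi> s 0" "h s 0 z"]
          by (simp add: RH_def)
      qed
    qed
  qed
  have cont_H: "continuous_on ({0..1} \<times> UNIV) (\<lambda>(s, x). H s x)"
  proof -
    define X where "X = {0..1::real} \<times> {0..1::real} \<times> RH"
    define Q where "Q = (\<lambda>(s :: real, t, z). (s, page_point t z))"
    have "closed RH"
      unfolding RH_def using closed_halfspace_Re_ge [of 0] by simp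
    then have "closed X"
      by (auto simp: X_def intro!: closed_Times)
    have QX: "Q ` X = {0..1} \<times> UNIV"
    proof (intro equalityI subsetI)
      fix p :: "real \<times> (real ^ 3)" assume "p \<in> {0..1} \<times> UNIV"
      then obtain s x where p: "p = (s, x)" "s \<in> {0..1}" by auto
      then have "p = Q (s, fst (par x), snd (par x))" "(s, fst (par x), snd (par x)) \<in> X"
        using par [of x] by (auto simp: Q_def X_def split_def mem_Times_iff)
      then show "p \<in> Q ` X"
        by blast
    qed (auto simp: Q_def X_def)
    have "continuous_on (Q ` X) (\<lambda>(s, x). H s x)"
    proof (rule continuous_on_factor_proper)
      show "closed (Q ` X)"
        unfolding QX by (auto intro!: closed_Times)
      show "continuous_on X Q"
        unfolding Q_def split_def by (intro continuous_intros)
      have "continuous_on X (\<lambda>p. page_point (\<phi> (fst p) (fst (snd p))) (h (fst p) (fst (snd p)) (snd (snd p))))"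
      proof (intro continuous_intros)
        have "continuous_on X ((\<lambda>(s, t). \<phi> s t) \<circ> (\<lambda>p. (fst p, fst (snd p))))"
          by (intro continuous_on_compose continuous_intros continuous_on_subset [OF cont_\<phi>])
             (auto simp: X_def)
        then show "continuous_on X (\<lambda>p. \<phi> (fst p) (fst (snd p)))"
          by (simp add: o_def)
        show "continuous_on X (\<lambda>p. h (fst p) (fst (snd p)) (snd (snd p)))"
          using cont_h by (simp add: X_def RH_def split_def)
      qed
      then show "continuous_on X (\<lambda>p. case Q p of (s, x) \<Rightarrow> H s x)"
        by (rule continuous_on_eq) (auto simp: X_def Q_def H)
      fix B :: "(real \<times> (real ^ 3)) set" assume "bounded B"
      then obtain b where b: "\<And>p. p \<in> B \<Longrightarrow> norm p \<le> b"
        by (auto simp: bounded_iff)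
      have "{p \<in> X. Q p \<in> B} \<subseteq> {0..1} \<times> {0..1} \<times> cball 0 b"
      proof
        fix p assume "p \<in> {p \<in> X. Q p \<in> B}"
        then obtain s t z where p: "p = (s, t, z)" "p \<in> X" "(s, page_point t z) \<in> B"
          by (cases p) (auto simp: Q_def)
        have "norm z \<le> norm (s, page_point t z)"
          using norm_snd_le [of "page_point t z" s] by (simp add: norm_page_point)
        then show "p \<in> {0..1} \<times> {0..1} \<times> cball 0 b"
          using p b [OF p(3)] by (auto simp: X_def)
      qed
      then show "bounded {p \<in> X. Q p \<in> B}"
        by (rule bounded_subset [rotated]) (intro bounded_Times bounded_closed_interval bounded_cball)
    qed fact
    then show ?thesis
      by (simp add: QX)
  qed
  have bij_H: "bij (H s)" if s: "s \<in> {0..1}" for s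
    unfolding bij_def
  proof
    show "inj (H s)"
    proof (rule injI)
      fix x y assume eq: "H s x = H s y"
      obtain t z where t: "t \<in> {0..<1}" and z: "z \<in> RH" and x: "x = page_point t z"
        using par by blast
      obtain t' z' where t': "t' \<in> {0..<1}" and z': "z' \<in> RH" and y: "y = page_point t' z'"
        using par by blast
      define w where "w = h s t z"
      have eq: "page_point (\<phi> s t) w = page_point (\<phi> s t') (h s t' z')"
        using eq H s t t' z z' by (simp add: x y w_def)
      have w: "h s t z = w" "h s t' z' = w" "w \<in> RH" and or: "Re w = 0 \<or> \<phi> s t - \<phi> s t' \<in> \<int>"
        using page_point_eqD [OF eq] hRH s t t' z z' by (auto simp: RH_def w_def)
      have inj: "inj_on (h s t) RH" "inj_on (h s t') RH"
        using bij_h [OF s] t t' by (auto simp: bij_betw_def RH_def)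
      show "x = y"
      proof (cases "Re w = 0")
        case True
        then have "h s t w = w" "h s t' w = w"
          using axis_h s t t' by auto
        then have "z = w" "z' = w"
          using inj w z z' by (metis inj_onD)+
        then show ?thesis
          using True by (auto simp: x y intro: page_point_axis)
      next
        case False
        then obtain k :: int where k: "\<phi> s t - \<phi> s t' = of_int k"
          using or by (auto simp: Ints_def)
        have bd: "\<phi> s 0 \<le> \<phi> s u \<and> \<phi> s u < \<phi> s 0 + 1" if "u \<in> {0..<1}" for u
          using strict_mono_onD [OF mono_\<phi> [OF s], of 0 u] strict_mono_onD [OF mono_\<phi> [OF s], of u 1]
            turn_\<phi> [OF s] that by (cases "u = 0") auto
        have "\<bar>of_int k :: real\<bar> < 1"
          using bd [OF t] bd [OF t'] unfolding k [symmetric] by linarith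
        then have "k = 0"
          by linarith
        then have "t = t'"
          using k strict_mono_on_eqD [OF mono_\<phi> [OF s], of t t'] t t' by auto
        then show ?thesis
          using inj w z z' by (auto simp: x y dest: inj_onD)
      qed
    qed
    show "range (H s) = UNIV"
    proof (intro equalityI subsetI)
      fix y :: "real ^ 3"
      obtain u w where u: "u \<in> {\<phi> s 0..<\<phi> s 0 + 1}" and w: "Re w \<ge> 0" and y: "y = page_point u w"
        using page_point_surj by blast
      have "continuous_on {0..1} ((\<lambda>(s, t). \<phi> s t) \<circ> Pair s)"
        by (intro continuous_on_compose continuous_intros continuous_on_subset [OF cont_\<phi>])
           (use s in auto)
      then have "continuous_on {0..1} (\<phi> s)"
        by (simp add: o_def)
      then obtain t where t: "0 \<le> t" "t \<le> 1" "\<phi> s t = u"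
        using IVT' [of "\<phi> s" 0 u 1] u turn_\<phi> [OF s] by auto
      have "h s t ` RH = RH"
        using bij_h [OF s, of t] t by (auto simp: bij_betw_def RH_def)
      then obtain z where "z \<in> RH" "h s t z = w"
        using w by (metis (mono_tags) RH_def imageE mem_Collect_eq)
      then have "y = H s (page_point t z)"
        using H [of s t z] s t y by auto
      then show "y \<in> range (H s)"
        by blast
    qed auto
  qed
  have id_H: "H 0 x = x" for x
    using par [of x] id_\<phi> id_h by (auto simp: H_def RH_def)
  have "H 1 ` (\<Union>t\<in>{0..<1}. page_point t ` P t) = (\<Union>t\<in>{0..<1}. page_point (\<phi> 1 t) ` h 1 t ` P t)"
    unfolding image_UN image_image using H P by (intro SUP_cong refl image_cong) (auto simp: RH_def)
  then show ?thesis
    using ambient_isotopicI [OF cont_H bij_H id_H] by metis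
qed

section \<open>Closing up a loop of point sets\<close>

text \<open>
  As in a closed braid, but the angle of the page is \<open>t / m\<close>, so that in a word of length \<open>m\<close> every
  generator takes one unit of time.
\<close>

definition loop_closure :: "real \<Rightarrow> (real \<Rightarrow> complex set) \<Rightarrow> (real ^ 3) set" where
  "loop_closure m P = (\<Union>t\<in>{0..<m}. page_point (t / m) ` P t)"

lemma loop_closure_cong:
  "(\<And>t. 0 \<le> t \<Longrightarrow> t < m \<Longrightarrow> P t = Q t) \<Longrightarrow> loop_closure m P = loop_closure m Q"
  by (simp add: loop_closure_def)

lemma loop_closure_scale:
  assumes "m > 0"
  shows "loop_closure m P = (\<Union>t\<in>{0..<1}. page_point t ` P (m * t))"
proof -
  have "{0..<m} = (\<lambda>t. m * t) ` {0..<1}"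
    using assms by (auto simp: image_iff intro!: bexI [of _ "_ / m"])
  then show ?thesis
    using assms by (simp add: loop_closure_def image_image)
qed

lemma loop_page_isotopy:
  fixes h :: "real \<Rightarrow> real \<Rightarrow> complex \<Rightarrow> complex"
  assumes m: "m > 0"
    and cont_h: "continuous_on ({0..1} \<times> {0..m} \<times> {z. 0 \<le> Re z}) (\<lambda>(s, t, z). h s t z)"
    and bij_h: "\<And>s t. s \<in> {0..1} \<Longrightarrow> t \<in> {0..m} \<Longrightarrow> bij_betw (h s t) {z. 0 \<le> Re z} {z. 0 \<le> Re z}"
    and axis_h: "\<And>s t z. s \<in> {0..1} \<Longrightarrow> t \<in> {0..m} \<Longrightarrow> Re z = 0 \<Longrightarrow> h s t z = z"
    and turn_h: "\<And>s z. s \<in> {0..1} \<Longrightarrow> 0 \<le> Re z \<Longrightarrow> h s m z = h s 0 z"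
    and id_h: "\<And>t z. t \<in> {0..m} \<Longrightarrow> 0 \<le> Re z \<Longrightarrow> h 0 t z = z"
    and P: "\<And>t z. t \<in> {0..<m} \<Longrightarrow> z \<in> P t \<Longrightarrow> 0 \<le> Re z"
  shows "ambient_isotopic (loop_closure m P) (loop_closure m (\<lambda>t. h 1 t ` P t))"
  unfolding loop_closure_scale [OF m]
proof (rule page_isotopy [where \<phi> = "\<lambda>s t. t" and h = "\<lambda>s t. h s (m * t)"])
  have *: "m * t \<in> {0..m}" if "t \<in> {0..1}" for t
    using that m by (auto simp: mult_left_le)
  have "continuous_on ({0..1} \<times> {0..1} \<times> {z. 0 \<le> Re z})
      ((\<lambda>(s, t, z). h s t z) \<circ> (\<lambda>(s, t, z). (s, m * t, z)))"
    unfolding split_def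
    by (rule continuous_on_compose, intro continuous_intros,
        rule continuous_on_subset [OF cont_h [unfolded split_def]])
       (use * in auto)
  then show "continuous_on ({0..1} \<times> {0..1} \<times> {z. 0 \<le> Re z}) (\<lambda>(s, t, z). h s (m * t) z)"
    by (simp add: o_def split_def)
  show "bij_betw (h s (m * t)) {z. 0 \<le> Re z} {z. 0 \<le> Re z}" if "s \<in> {0..1}" "t \<in> {0..1}" for s t
    using bij_h * that by blast
  show "h s (m * t) z = z" if "s \<in> {0..1}" "t \<in> {0..1}" "Re z = 0" for s t z
    using axis_h * that by blast
  show "h 0 (m * t) z = z" if "t \<in> {0..1}" "0 \<le> Re z" for t z
    using id_h * that by blast
  show "0 \<le> Re z" if "t \<in> {0..<1}" "z \<in> P (m * t)" for t z
    using P [of "m * t" z] that m by auto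
qed (use turn_h in \<open>auto simp: strict_mono_on_def split_def intro!: continuous_intros\<close>)

text \<open>The pages are turned around the axis, at time \<open>s\<close> by the fraction \<open>s\<close> of the required angle.\<close>

lemma loop_reparametrise:
  fixes \<psi> :: "real \<Rightarrow> real"
  assumes m: "m > 0" "m' > 0"
    and cont: "continuous_on {0..m} \<psi>" and mono: "strict_mono_on {0..m} \<psi>"
    and ends: "\<psi> 0 = 0" "\<psi> m = m'"
    and PQ: "\<And>t. 0 \<le> t \<Longrightarrow> t < m \<Longrightarrow> P t = Q (\<psi> t)"
    and P: "\<And>t z. t \<in> {0..<m} \<Longrightarrow> z \<in> P t \<Longrightarrow> 0 \<le> Re z"
  shows "ambient_isotopic (loop_closure m P) (loop_closure m' Q)"
proof -
  define \<theta> where "\<theta> t = \<psi> (m * t) / m'" for t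
  have *: "m * t \<in> {0..m}" if "t \<in> {0..1}" for t
    using that m by (auto simp: mult_left_le)
  have cont_\<theta>: "continuous_on {0..1} \<theta>"
    unfolding \<theta>_def by (intro continuous_intros continuous_on_compose2 [OF cont]) (use * m in auto)
  have mono_\<theta>: "\<theta> t < \<theta> u" if "0 \<le> t" "t < u" "u \<le> 1" for t u
    using strict_mono_onD [OF mono, of "m * t" "m * u"] * [of t] * [of u] that m
    by (simp add: \<theta>_def divide_strict_right_mono)
  have \<theta>01: "\<theta> 0 = 0" "\<theta> 1 = 1"
    using ends m by (auto simp: \<theta>_def)
  define \<phi> where "\<phi> s t = (1 - s) * t + s * \<theta> t" for s t
  have "ambient_isotopic (\<Union>t\<in>{0..<1}. page_point t ` P (m * t))
      (\<Union>t\<in>{0..<1}. page_point (\<phi> 1 t) ` (\<lambda>z. z) ` P (m * t))"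
  proof (rule page_isotopy [where h = "\<lambda>s t z. z" and \<phi> = \<phi>])
    show "continuous_on ({0..1} \<times> {0..1}) (\<lambda>(s, t). \<phi> s t)"
      unfolding \<phi>_def split_def
      by (intro continuous_intros continuous_on_compose2 [OF cont_\<theta>]) auto
    show "strict_mono_on {0..1} (\<phi> s)" if "s \<in> {0..1}" for s
    proof (rule strict_mono_onI)
      fix t u :: real assume "t \<in> {0..1}" "u \<in> {0..1}" "t < u"
      then have "\<theta> t < \<theta> u"
        using mono_\<theta> by auto
      show "\<phi> s t < \<phi> s u"
      proof (cases "s = 0")
        case False
        then have "s * \<theta> t < s * \<theta> u"
          using that \<open>\<theta> t < \<theta> u\<close> by auto
        moreover have "(1 - s) * t \<le> (1 - s) * u"
          using that \<open>t < u\<close> by (intro mult_left_mono) auto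
        ultimately show ?thesis
          by (simp add: \<phi>_def)
      qed (use \<open>t < u\<close> in \<open>simp add: \<phi>_def\<close>)
    qed
    show "0 \<le> Re z" if "t \<in> {0..<1}" "z \<in> P (m * t)" for t z
      using P [of "m * t" z] that m by auto
  qed (auto simp: \<phi>_def \<theta>01 split_def intro!: continuous_intros bij_betw_imageI)
  also have "(\<Union>t\<in>{0..<1}. page_point (\<phi> 1 t) ` (\<lambda>z. z) ` P (m * t))
      = (\<Union>t\<in>{0..<1}. page_point (\<theta> t) ` Q (m' * \<theta> t))"
    using PQ m by (intro SUP_cong refl) (auto simp: \<phi>_def \<theta>_def)
  also have "\<dots> = (\<Union>u\<in>\<theta> ` {0..<1}. page_point u ` Q (m' * u))"
    by simp
  also have "\<theta> ` {0..<1} = {0..<1}"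
  proof (intro equalityI subsetI)
    fix u :: real assume "u \<in> \<theta> ` {0..<1}"
    then obtain t where t: "0 \<le> t" "t < 1" "u = \<theta> t" by auto
    have "0 \<le> u"
      using mono_\<theta> [of 0 t] \<theta>01 t by (cases "t = 0") auto
    then show "u \<in> {0..<1}"
      using mono_\<theta> [of t 1] \<theta>01 t by auto
  next
    fix u :: real assume u: "u \<in> {0..<1}"
    then obtain t where "0 \<le> t" "t \<le> 1" "\<theta> t = u"
      using IVT' [of \<theta> 0 u 1] \<theta>01 cont_\<theta> by auto
    then show "u \<in> \<theta> ` {0..<1}"
      using u \<theta>01 by (intro image_eqI [of _ _ t]) (auto simp: less_le)
  qed
  finally show ?thesis
    using m by (simp add: loop_closure_scale)
qed

section \<open>Moving strands within the pages\<close>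

text \<open>The value \<open>w\<close> is taken where the contraction \<open>\<lambda>z. w - g z\<close> has its fixed point.\<close>

lemma bij_add_contraction:
  fixes g :: "complex \<Rightarrow> complex"
  assumes g: "\<And>z w. norm (g z - g w) \<le> c * norm (z - w)" and c: "0 \<le> c" "c < 1"
  shows "bij (\<lambda>z. z + g z)"
  unfolding bij_def
proof
  show "inj (\<lambda>z. z + g z)"
  proof (rule injI)
    fix z w assume "z + g z = w + g w"
    then have "g w - g z = z - w"
      by (simp add: algebra_simps)
    then have "norm (z - w) \<le> c * norm (z - w)"
      using g [of w z] by (simp add: norm_minus_commute)
    then have "(1 - c) * norm (z - w) \<le> 0"
      by (simp add: algebra_simps)
    then show "z = w"
      using c by (simp add: mult_le_0_iff)
  qed
  show "range (\<lambda>z. z + g z) = UNIV"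
  proof (intro equalityI subsetI)
    fix w :: complex
    have "\<exists>!z. w - g z = z"
      by (rule banach_fix_type [OF c]) (use g in \<open>auto simp: dist_norm norm_minus_commute\<close>)
    then obtain z where "w - g z = z" by blast
    then have "w = z + g z"
      by (metis diff_add_cancel)
    then show "w \<in> range (\<lambda>z. z + g z)"
      by blast
  qed auto
qed

lemma bij_betw_half_plane:
  fixes h :: "complex \<Rightarrow> complex"
  assumes "bij h" and id: "\<And>z. Re z \<le> 0 \<Longrightarrow> h z = z"
  shows "bij_betw h {z. 0 \<le> Re z} {z. 0 \<le> Re z}"
  unfolding bij_betw_def
proof
  have inj: "inj h" and surj: "range h = UNIV"
    using assms by (auto simp: bij_def)
  show "inj_on h {z. 0 \<le> Re z}"
    using inj by (rule inj_on_subset) auto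
  show "h ` {z. 0 \<le> Re z} = {z. 0 \<le> Re z}"
  proof (intro equalityI subsetI)
    fix w assume "w \<in> h ` {z. 0 \<le> Re z}"
    then obtain z where z: "w = h z" "0 \<le> Re z" by auto
    show "w \<in> {z. 0 \<le> Re z}"
    proof (rule ccontr)
      assume "w \<notin> {z. 0 \<le> Re z}"
      then have "Re w < 0" by auto
      then have "h w = h z"
        using id z by auto
      then have "w = z"
        using inj by (simp only: inj_eq)
      then show False
        using z \<open>Re w < 0\<close> by simp
    qed
  next
    fix w assume w: "w \<in> {z. 0 \<le> Re z}"
    obtain z where z: "w = h z"
      using surj by (metis rangeE UNIV_I)
    then have "0 \<le> Re z"
      using id [of z] w by (cases "Re z \<le> 0") auto
    then show "w \<in> h ` {z. 0 \<le> Re z}"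
      using z by blast
  qed
qed

text \<open>
  Strands \<open>p a\<close> are displaced to nearby strands \<open>q a\<close> by cone-shaped bumps centred at them. The
  radius \<open>\<rho>\<close> of the bumps keeps the other strands, the rest \<open>F\<close> of the link and the axis fixed.
\<close>

lemma small_push:
  fixes p q :: "'a \<Rightarrow> real \<Rightarrow> complex"
  assumes m: "m > 0" and win: "0 \<le> t\<^sub>0" "t\<^sub>0 \<le> t\<^sub>1" "t\<^sub>1 \<le> m" and A: "finite A" and \<rho>: "\<rho> > 0"
    and cont: "\<And>a. a \<in> A \<Longrightarrow> continuous_on {t\<^sub>0..t\<^sub>1} (p a)" "\<And>a. a \<in> A \<Longrightarrow> continuous_on {t\<^sub>0..t\<^sub>1} (q a)"
    and ends: "\<And>a. a \<in> A \<Longrightarrow> q a t\<^sub>0 = p a t\<^sub>0" "\<And>a. a \<in> A \<Longrightarrow> q a t\<^sub>1 = p a t\<^sub>1"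
    and Re: "\<And>a t. a \<in> A \<Longrightarrow> t \<in> {t\<^sub>0..t\<^sub>1} \<Longrightarrow> \<rho> \<le> Re (p a t)"
    and small: "\<And>a t. a \<in> A \<Longrightarrow> t \<in> {t\<^sub>0..t\<^sub>1} \<Longrightarrow> norm (q a t - p a t) \<le> \<rho> / (2 * (real (card A) + 1))"
    and sep: "\<And>a b t. a \<in> A \<Longrightarrow> b \<in> A \<Longrightarrow> a \<noteq> b \<Longrightarrow> t \<in> {t\<^sub>0..t\<^sub>1} \<Longrightarrow> \<rho> \<le> norm (p a t - p b t)"
    and sepF: "\<And>a f t. a \<in> A \<Longrightarrow> t \<in> {t\<^sub>0..t\<^sub>1} \<Longrightarrow> f \<in> F t \<Longrightarrow> \<rho> \<le> norm (f - p a t)"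
    and F: "\<And>t f. t \<in> {0..<m} \<Longrightarrow> f \<in> F t \<Longrightarrow> 0 \<le> Re f"
  shows "ambient_isotopic
    (loop_closure m (\<lambda>t. F t \<union> (if t \<in> {t\<^sub>0..t\<^sub>1} then (\<lambda>a. p a t) ` A else {})))
    (loop_closure m (\<lambda>t. F t \<union> (if t \<in> {t\<^sub>0..t\<^sub>1} then (\<lambda>a. q a t) ` A else {})))"
proof -
  (* Outside the window nothing moves, because p and q agree at its ends. *)
  define c where "c t = max t\<^sub>0 (min t\<^sub>1 t)" for t
  have c: "c t \<in> {t\<^sub>0..t\<^sub>1}" "t \<in> {t\<^sub>0..t\<^sub>1} \<Longrightarrow> c t = t" "t \<notin> {t\<^sub>0..t\<^sub>1} \<Longrightarrow> c t = t\<^sub>0 \<or> c t = t\<^sub>1" for t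
    using win by (auto simp: c_def)
  define \<beta> where "\<beta> a t z = max 0 (1 - norm (z - p a t) / \<rho>)" for a t z
  define g where "g t z = (\<Sum>a\<in>A. \<beta> a (c t) z *\<^sub>R (q a (c t) - p a (c t)))" for t z
  define h where "h s t z = z + s *\<^sub>R g t z" for s t z
  have \<beta>_0: "\<beta> a t z = 0" if "\<rho> \<le> norm (z - p a t)" for a t z
    using that \<rho> by (simp add: \<beta>_def)
  have \<beta>_Lip: "\<bar>\<beta> a t z - \<beta> a t w\<bar> \<le> norm (z - w) / \<rho>" for a t z w
  proof -
    have "\<bar>\<beta> a t z - \<beta> a t w\<bar> \<le> \<bar>norm (z - p a t) / \<rho> - norm (w - p a t) / \<rho>\<bar>"
      unfolding \<beta>_def by linarith
    also have "\<dots> = \<bar>norm (z - p a t) - norm (w - p a t)\<bar> / \<rho>"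
      using \<rho> by (simp add: diff_divide_distrib [symmetric] abs_divide)
    also have "\<dots> \<le> norm (z - w) / \<rho>"
      using \<rho> norm_triangle_ineq3 [of "z - p a t" "w - p a t"] by (simp add: divide_right_mono)
    finally show ?thesis .
  qed
  have g_Lip: "norm (g t z - g t w) \<le> 1 / 2 * norm (z - w)" for t z w
  proof -
    have "g t z - g t w = (\<Sum>a\<in>A. (\<beta> a (c t) z - \<beta> a (c t) w) *\<^sub>R (q a (c t) - p a (c t)))"
      by (simp add: g_def scaleR_left_diff_distrib flip: sum_subtractf)
    also have "norm \<dots> \<le> (\<Sum>a\<in>A. norm (z - w) / (2 * (real (card A) + 1)))"
    proof (rule sum_norm_le)
      fix a assume a: "a \<in> A"
      have "\<bar>\<beta> a (c t) z - \<beta> a (c t) w\<bar> * norm (q a (c t) - p a (c t))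
          \<le> (norm (z - w) / \<rho>) * (\<rho> / (2 * (real (card A) + 1)))"
        using \<beta>_Lip small [OF a c(1)] \<rho> by (intro mult_mono) auto
      then show "norm ((\<beta> a (c t) z - \<beta> a (c t) w) *\<^sub>R (q a (c t) - p a (c t)))
          \<le> norm (z - w) / (2 * (real (card A) + 1))"
        using \<rho> by simp
    qed
    also have "\<dots> = real (card A) / (real (card A) + 1) * (1 / 2 * norm (z - w))"
      by (simp add: field_simps)
    also have "\<dots> \<le> 1 / 2 * norm (z - w)"
      by (rule mult_left_le_one_le) (auto simp: field_simps)
    finally show ?thesis .
  qed
  have h_Lip: "norm (s *\<^sub>R g t z - s *\<^sub>R g t w) \<le> 1 / 2 * norm (z - w)" if "s \<in> {0..1}" for s t z w
  proof -
    have "norm (s *\<^sub>R g t z - s *\<^sub>R g t w) = \<bar>s\<bar> * norm (g t z - g t w)"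
      by (simp flip: scaleR_right_diff_distrib)
    also have "\<dots> \<le> norm (g t z - g t w)"
      using that by (intro mult_left_le_one_le) auto
    finally show ?thesis
      using g_Lip [of t z w] by linarith
  qed
  have g_left: "g t z = 0" if "Re z \<le> 0" for t z
  proof -
    have "\<beta> a (c t) z = 0" if "a \<in> A" for a
    proof (rule \<beta>_0)
      have "\<rho> \<le> Re (p a (c t) - z)"
        using Re [OF that c(1), of t] \<open>Re z \<le> 0\<close> by simp
      also have "\<dots> \<le> norm (p a (c t) - z)"
        by (rule complex_Re_le_cmod)
      finally show "\<rho> \<le> norm (z - p a (c t))"
        by (simp add: norm_minus_commute)
    qed
    then show ?thesis
      by (simp add: g_def)
  qed
  have g_out: "g t z = 0" if "t \<notin> {t\<^sub>0..t\<^sub>1}" for t z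
  proof -
    have "q a (c t) - p a (c t) = 0" if "a \<in> A" for a
      using c(3) [OF \<open>t \<notin> _\<close>] ends that by auto
    then show ?thesis
      by (simp add: g_def)
  qed
  have g_end: "g 0 z = 0" "g m z = 0" for z
  proof -
    have "c 0 = t\<^sub>0" "c m = t\<^sub>1"
      using win by (auto simp: c_def)
    then show "g 0 z = 0" "g m z = 0"
      using ends by (auto simp: g_def)
  qed
  have h_p: "h 1 t (p a t) = q a t" if "a \<in> A" "t \<in> {t\<^sub>0..t\<^sub>1}" for a t
  proof -
    have "g t (p a t) = (\<Sum>b\<in>A. if b = a then q a t - p a t else 0)"
      unfolding g_def c(2) [OF that(2)]
    proof (rule sum.cong [OF refl])
      fix b assume "b \<in> A"
      then show "\<beta> b t (p a t) *\<^sub>R (q b t - p b t) = (if b = a then q a t - p a t else 0)"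
        using \<beta>_0 [of "p a t" b t] sep [of a b t] that \<rho> by (auto simp: \<beta>_def)
    qed
    then show ?thesis
      using that A by (simp add: h_def)
  qed
  have h_F: "h 1 t f = f" if "t \<in> {t\<^sub>0..t\<^sub>1}" "f \<in> F t" for t f
    using \<beta>_0 sepF that by (auto simp: h_def g_def c(2) intro!: sum.neutral)
  have "ambient_isotopic
    (loop_closure m (\<lambda>t. F t \<union> (if t \<in> {t\<^sub>0..t\<^sub>1} then (\<lambda>a. p a t) ` A else {})))
    (loop_closure m (\<lambda>t. h 1 t ` (F t \<union> (if t \<in> {t\<^sub>0..t\<^sub>1} then (\<lambda>a. p a t) ` A else {}))))"
  proof (rule loop_page_isotopy [OF m])
    have cont_c: "continuous_on X c" for X
      unfolding c_def by (intro continuous_intros)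
    show "continuous_on ({0..1} \<times> {0..m} \<times> {z. 0 \<le> Re z}) (\<lambda>(s, t, z). h s t z)"
      unfolding h_def g_def \<beta>_def split_def
      by (intro continuous_intros continuous_on_compose2 [OF cont(1)] continuous_on_compose2 [OF cont(2)]
          continuous_on_compose2 [OF cont_c])
         (use \<rho> c(1) in auto)
    show "bij_betw (h s t) {z. 0 \<le> Re z} {z. 0 \<le> Re z}" if "s \<in> {0..1}" for s t
      using bij_add_contraction [OF h_Lip [OF that]] g_left
      by (intro bij_betw_half_plane) (auto simp: h_def [abs_def])
    show "0 \<le> Re z" if "t \<in> {0..<m}" "z \<in> F t \<union> (if t \<in> {t\<^sub>0..t\<^sub>1} then (\<lambda>a. p a t) ` A else {})" for t z
      using that F Re \<rho> by (force split: if_splits)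
  qed (auto simp: h_def g_left g_end)
  also have "loop_closure m (\<lambda>t. h 1 t ` (F t \<union> (if t \<in> {t\<^sub>0..t\<^sub>1} then (\<lambda>a. p a t) ` A else {})))
    = loop_closure m (\<lambda>t. F t \<union> (if t \<in> {t\<^sub>0..t\<^sub>1} then (\<lambda>a. q a t) ` A else {}))"
  proof (rule loop_closure_cong)
    fix t :: real assume "0 \<le> t" "t < m"
    show "h 1 t ` (F t \<union> (if t \<in> {t\<^sub>0..t\<^sub>1} then (\<lambda>a. p a t) ` A else {}))
      = F t \<union> (if t \<in> {t\<^sub>0..t\<^sub>1} then (\<lambda>a. q a t) ` A else {})"
    proof (cases "t \<in> {t\<^sub>0..t\<^sub>1}")
      case True
      then have "h 1 t ` F t = F t" "h 1 t ` (\<lambda>a. p a t) ` A = (\<lambda>a. q a t) ` A"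
        using h_F h_p by (auto simp: image_image cong: image_cong)
      then show ?thesis
        using True by (simp add: image_Un)
    next
      case False
      then show ?thesis
        unfolding if_not_P [OF False] by (simp add: h_def g_out [OF False])
    qed
  qed
  finally show ?thesis .
qed

text \<open>
  By compactness the strands stay a uniform distance apart during the homotopy, and equal steps of it
  that are short compared to this distance are small pushes.
\<close>

lemma straight_isotopy:
  fixes p q :: "'a \<Rightarrow> real \<Rightarrow> complex"
  assumes m: "m > 0" and win: "0 \<le> t\<^sub>0" "t\<^sub>0 \<le> t\<^sub>1" "t\<^sub>1 \<le> m" and A: "finite A" and \<rho>\<^sub>0: "\<rho>\<^sub>0 > 0"
    and cont: "\<And>a. a \<in> A \<Longrightarrow> continuous_on {t\<^sub>0..t\<^sub>1} (p a)" "\<And>a. a \<in> A \<Longrightarrow> continuous_on {t\<^sub>0..t\<^sub>1} (q a)"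
    and ends: "\<And>a. a \<in> A \<Longrightarrow> q a t\<^sub>0 = p a t\<^sub>0" "\<And>a. a \<in> A \<Longrightarrow> q a t\<^sub>1 = p a t\<^sub>1"
    and Re: "\<And>a t. a \<in> A \<Longrightarrow> t \<in> {t\<^sub>0..t\<^sub>1} \<Longrightarrow> 1 \<le> Re (p a t)" "\<And>a t. a \<in> A \<Longrightarrow> t \<in> {t\<^sub>0..t\<^sub>1} \<Longrightarrow> 1 \<le> Re (q a t)"
    and sep: "\<And>a b s t. a \<in> A \<Longrightarrow> b \<in> A \<Longrightarrow> a \<noteq> b \<Longrightarrow> s \<in> {0..1} \<Longrightarrow> t \<in> {t\<^sub>0..t\<^sub>1} \<Longrightarrow>
        (1 - s) *\<^sub>R p a t + s *\<^sub>R q a t \<noteq> (1 - s) *\<^sub>R p b t + s *\<^sub>R q b t"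
    and sepF: "\<And>a f s t. a \<in> A \<Longrightarrow> s \<in> {0..1} \<Longrightarrow> t \<in> {t\<^sub>0..t\<^sub>1} \<Longrightarrow> f \<in> F t \<Longrightarrow>
        \<rho>\<^sub>0 \<le> norm (f - ((1 - s) *\<^sub>R p a t + s *\<^sub>R q a t))"
    and F: "\<And>t f. t \<in> {0..<m} \<Longrightarrow> f \<in> F t \<Longrightarrow> 0 \<le> Re f"
  shows "ambient_isotopic
    (loop_closure m (\<lambda>t. F t \<union> (if t \<in> {t\<^sub>0..t\<^sub>1} then (\<lambda>a. p a t) ` A else {})))
    (loop_closure m (\<lambda>t. F t \<union> (if t \<in> {t\<^sub>0..t\<^sub>1} then (\<lambda>a. q a t) ` A else {})))"
proof -
  define r where "r s a t = (1 - s) *\<^sub>R p a t + s *\<^sub>R q a t" for s a t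
  have cont_r: "continuous_on ({0..1} \<times> {t\<^sub>0..t\<^sub>1}) (\<lambda>(s, t). r s a t)" if "a \<in> A" for a
    unfolding r_def split_def
    by (intro continuous_intros continuous_on_compose2 [OF cont(1) [OF that]]
        continuous_on_compose2 [OF cont(2) [OF that]]) auto
  have ne: "({0..1::real} \<times> {t\<^sub>0..t\<^sub>1}) \<noteq> {}"
    using win by auto
  have cpt: "compact ({0..1::real} \<times> {t\<^sub>0..t\<^sub>1})"
    by (intro compact_Times compact_Icc)
  define B where "B = {(a, b). a \<in> A \<and> b \<in> A \<and> a \<noteq> b}"
  have "finite B"
    by (rule finite_subset [of _ "A \<times> A"]) (use A in \<open>auto simp: B_def\<close>)
  have "\<exists>\<delta>>0. \<forall>s\<in>{0..1}. \<forall>t\<in>{t\<^sub>0..t\<^sub>1}. \<delta> \<le> norm (r s (fst x) t - r s (snd x) t)" if "x \<in> B" for x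
  proof -
    obtain a b where x: "x = (a, b)"
      by (cases x)
    have ab: "a \<in> A" "b \<in> A" "a \<noteq> b"
      using that by (auto simp: B_def x)
    have "continuous_on ({0..1} \<times> {t\<^sub>0..t\<^sub>1}) (\<lambda>x. norm ((\<lambda>(s, t). r s a t) x - (\<lambda>(s, t). r s b t) x))"
      by (intro continuous_intros cont_r ab)
    from continuous_attains_inf [OF cpt ne this]
    obtain s t where st: "s \<in> {0..1}" "t \<in> {t\<^sub>0..t\<^sub>1}"
      and min: "\<forall>s'\<in>{0..1}. \<forall>t'\<in>{t\<^sub>0..t\<^sub>1}. norm (r s a t - r s b t) \<le> norm (r s' a t' - r s' b t')"
      by auto
    moreover have "norm (r s a t - r s b t) > 0"
      using sep [OF ab st] by (simp add: r_def)
    ultimately show ?thesis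
      using x by (intro exI [of _ "norm (r s a t - r s b t)"]) auto
  qed
  then obtain \<delta> where \<delta>: "\<And>x. x \<in> B \<Longrightarrow> \<delta> x > 0"
    "\<And>x s t. x \<in> B \<Longrightarrow> s \<in> {0..1} \<Longrightarrow> t \<in> {t\<^sub>0..t\<^sub>1} \<Longrightarrow> \<delta> x \<le> norm (r s (fst x) t - r s (snd x) t)"
    by metis
  define \<rho> where "\<rho> = Min (insert 1 (insert \<rho>\<^sub>0 (\<delta> ` B)))"
  have fin: "finite (insert 1 (insert \<rho>\<^sub>0 (\<delta> ` B)))"
    using \<open>finite B\<close> by simp
  have "\<rho> \<in> insert 1 (insert \<rho>\<^sub>0 (\<delta> ` B))"
    unfolding \<rho>_def by (rule Min_in [OF fin]) auto
  then have "\<rho> > 0"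
    using \<rho>\<^sub>0 \<delta>(1) by auto
  moreover have "\<rho> \<le> x" if "x \<in> insert 1 (insert \<rho>\<^sub>0 (\<delta> ` B))" for x
    unfolding \<rho>_def by (rule Min_le [OF fin that])
  ultimately have \<rho>: "\<rho> > 0" "\<rho> \<le> 1" "\<rho> \<le> \<rho>\<^sub>0" "\<And>x. x \<in> B \<Longrightarrow> \<rho> \<le> \<delta> x"
    by blast+
  have "\<exists>M. \<forall>t\<in>{t\<^sub>0..t\<^sub>1}. norm (q a t - p a t) \<le> M" if "a \<in> A" for a
  proof -
    have "compact ((\<lambda>t. q a t - p a t) ` {t\<^sub>0..t\<^sub>1})"
      by (intro compact_continuous_image continuous_intros cont that compact_Icc)
    then show ?thesis
      by (auto dest!: compact_imp_bounded simp: bounded_iff)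
  qed
  then obtain M where M: "\<And>a t. a \<in> A \<Longrightarrow> t \<in> {t\<^sub>0..t\<^sub>1} \<Longrightarrow> norm (q a t - p a t) \<le> M a"
    by metis
  define b where "b = Max (insert 0 (M ` A))"
  have "x \<le> b" if "x \<in> insert 0 (M ` A)" for x
    unfolding b_def using A that by (intro Max_ge) auto
  then have b: "b \<ge> 0" "\<And>a t. a \<in> A \<Longrightarrow> t \<in> {t\<^sub>0..t\<^sub>1} \<Longrightarrow> norm (q a t - p a t) \<le> b"
    using M by (blast intro: order_trans)+
  define \<epsilon> where "\<epsilon> = \<rho> / (2 * (real (card A) + 1))"
  have "\<epsilon> > 0"
    using \<rho> by (auto simp: \<epsilon>_def intro!: divide_pos_pos)
  obtain N :: nat where "b / \<epsilon> < real N"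
    using reals_Archimedean2 by blast
  then have N: "b < real N * \<epsilon>" "real N > 0"
    using \<open>\<epsilon> > 0\<close> b(1) by (cases "N = 0"; simp add: pos_divide_less_eq)+
  define L where "L s = loop_closure m (\<lambda>t. F t \<union> (if t \<in> {t\<^sub>0..t\<^sub>1} then (\<lambda>a. r s a t) ` A else {}))" for s
  have step: "ambient_isotopic (L s) (L s')" if s: "s \<in> {0..1}" "s' \<in> {0..1}" "\<bar>s' - s\<bar> \<le> 1 / real N" for s s'
    unfolding L_def
  proof (rule small_push [OF m win A \<rho>(1)])
    have diff: "r s' a t - r s a t = (s' - s) *\<^sub>R (q a t - p a t)" for a t
      by (simp add: r_def algebra_simps)
    show "norm (r s' a t - r s a t) \<le> \<rho> / (2 * (real (card A) + 1))" if "a \<in> A" "t \<in> {t\<^sub>0..t\<^sub>1}" for a t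
    proof -
      have "norm (r s' a t - r s a t) \<le> 1 / real N * b"
        unfolding diff norm_scaleR using s b that by (intro mult_mono) auto
      also have "\<dots> \<le> \<epsilon>"
        using N by (simp add: field_simps)
      finally show ?thesis
        by (simp add: \<epsilon>_def)
    qed
    have "continuous_on {t\<^sub>0..t\<^sub>1} (r u a)" if "a \<in> A" for u a
      unfolding r_def using that by (intro continuous_intros cont)
    then show "continuous_on {t\<^sub>0..t\<^sub>1} (r s a)" "continuous_on {t\<^sub>0..t\<^sub>1} (r s' a)" if "a \<in> A" for a
      using that by auto
    show "r s' a t\<^sub>0 = r s a t\<^sub>0" "r s' a t\<^sub>1 = r s a t\<^sub>1" if "a \<in> A" for a
      using ends that diff [of a t\<^sub>0] diff [of a t\<^sub>1] by auto
    show "\<rho> \<le> Re (r s a t)" if "a \<in> A" "t \<in> {t\<^sub>0..t\<^sub>1}" for a t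
    proof -
      have "(1 - s) * 1 + s * 1 \<le> (1 - s) * Re (p a t) + s * Re (q a t)"
        using s Re that by (intro add_mono mult_left_mono) auto
      then show ?thesis
        using \<rho>(2) by (simp add: r_def)
    qed
    show "\<rho> \<le> norm (r s a t - r s b t)" if "a \<in> A" "b \<in> A" "a \<noteq> b" "t \<in> {t\<^sub>0..t\<^sub>1}" for a b t
      using \<delta>(2) [of "(a, b)" s t] \<rho>(4) [of "(a, b)"] s that by (auto simp: B_def)
    show "\<rho> \<le> norm (f - r s a t)" if "a \<in> A" "t \<in> {t\<^sub>0..t\<^sub>1}" "f \<in> F t" for a f t
      using sepF [OF that(1) s(1) that(2,3)] \<rho>(3) by (simp add: r_def)
  qed (use F in auto)
  have "ambient_isotopic (L 0) (L (real k / real N))" if "k \<le> N" for k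
    using that
  proof (induction k)
    case 0
    then show ?case
      by (simp add: ambient_isotopic_refl)
  next
    case (Suc k)
    have "ambient_isotopic (L (real k / real N)) (L (real (Suc k) / real N))"
      by (rule step) (use Suc N in \<open>auto simp: field_simps\<close>)
    then show ?case
      using Suc ambient_isotopic_trans by simp
  qed
  from this [of N] have "ambient_isotopic (L 0) (L 1)"
    using N by simp
  moreover have "r 0 = p" "r 1 = q"
    by (simp_all add: r_def fun_eq_iff)
  ultimately show ?thesis
    unfolding L_def by metis
qed

section \<open>Closed braid words\<close>

definition word_motion :: "nat \<Rightarrow> nat list \<Rightarrow> real \<Rightarrow> complex set" where
  "word_motion n w t =
     (if t < real (length w) then generator_motion n (w ! nat \<lfloor>t\<rfloor>) (frac t) else of_nat ` {1..n})"

lemma braid_closure_eq_loop_closure: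
  assumes "w \<noteq> []"
  shows "braid_closure n w = loop_closure (real (length w)) (word_motion n w)"
proof -
  have "real (length w) * t < real (length w)" if "t < 1" for t
    using assms that by simp
  then show ?thesis
    using assms by (simp add: braid_closure_def loop_closure_scale braid_motion_def word_motion_def)
qed

lemma braid_closure_Nil: "m > 0 \<Longrightarrow> braid_closure n [] = loop_closure m (\<lambda>t. of_nat ` {1..n})"
  by (simp add: braid_closure_def loop_closure_scale braid_motion_def)

lemma word_motion_append:
  assumes "0 \<le> t"
  shows "word_motion n (u @ v) t =
    (if t < real (length u) then word_motion n u t else word_motion n v (t - real (length u)))"
proof (cases "t < real (length u)")
  case True
  then have "nat \<lfloor>t\<rfloor> < length u"
    using assms by linarith
  then show ?thesis
    using True by (simp add: word_motion_def nth_append)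
next
  case False
  have fl: "\<lfloor>t - real (length u)\<rfloor> = \<lfloor>t\<rfloor> - int (length u)"
    by linarith
  then have "nat \<lfloor>t\<rfloor> = length u + nat \<lfloor>t - real (length u)\<rfloor>"
    using False by linarith
  moreover have "frac (t - real (length u)) = frac t"
    using fl by (simp add: frac_def)
  ultimately show ?thesis
    using False by (auto simp: word_motion_def)
qed

lemma word_motion_Cons:
  assumes "0 \<le> t"
  shows "word_motion n (i # w) t = (if t < 1 then generator_motion n i t else word_motion n w (t - 1))"
proof (cases "t < 1")
  case True
  then have "\<lfloor>t\<rfloor> = 0" "frac t = t"
    using assms by (simp_all add: floor_eq_iff frac_eq)
  then show ?thesis
    using True by (simp add: word_motion_def)
next
  case False
  then show ?thesis
    using word_motion_append [OF assms, of n "[i]" w] by simp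
qed

text \<open>
  The path of one of the two points in a clockwise half turn, preceded and followed by rest: from 0 to 1
  through the upper half plane, during the unit interval. The generator with index \<open>i\<close> adds it to the strand at \<open>i\<close> and
  subtracts it from the strand at \<open>i + 1\<close>.
\<close>

definition swing :: "real \<Rightarrow> complex" where
  "swing t = (1 - cis (- pi * max 0 (min 1 t))) / 2"

lemma swing_rest [simp]: "t \<le> 0 \<Longrightarrow> swing t = 0" "1 \<le> t \<Longrightarrow> swing t = 1"
  by (auto simp: swing_def complex_eq_iff)

lemma swing_Re: "0 \<le> Re (swing t)" "Re (swing t) \<le> 1"
  using cos_le_one [of "pi * max 0 (min 1 t)"] cos_ge_minus_one [of "pi * max 0 (min 1 t)"]
  by (auto simp: swing_def)

lemma swing_Im: "0 \<le> Im (swing t)"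
proof -
  have "pi * max 0 (min 1 t) \<le> pi * 1"
    by (intro mult_left_mono) auto
  then show ?thesis
    by (auto simp: swing_def intro!: sin_ge_zero mult_nonneg_nonneg)
qed

lemma norm_swing_minus_half: "norm (swing t - 1 / 2) = 1 / 2"
proof -
  have "swing t - 1 / 2 = - (cis (- pi * max 0 (min 1 t)) / 2)"
    by (simp add: swing_def field_simps)
  then show ?thesis
    by (simp only: norm_minus_cancel norm_divide norm_cis) simp
qed

lemma swing_neq_half: "2 * swing t \<noteq> 1"
proof
  assume "2 * swing t = 1"
  then have "swing t = 1 / 2"
    by (simp add: field_simps)
  then show False
    using norm_swing_minus_half [of t] unfolding \<open>swing t = 1 / 2\<close> by simp
qed

lemma continuous_on_swing [continuous_intros]:
  fixes f :: "'a::t2_space \<Rightarrow> real"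
  assumes "continuous_on S f"
  shows "continuous_on S (\<lambda>x. swing (f x))"
  unfolding swing_def by (intro continuous_intros assms) auto

lemma generator_motion_swing:
  assumes "0 \<le> t" "t \<le> 1"
  shows "generator_motion n i t =
    of_nat ` ({1..n} - {i, i + 1}) \<union> {of_nat i + swing t, of_nat i + 1 - swing t}"
proof -
  have *: "of_nat i + 1 / 2 - cis (- pi * t) / 2 = of_nat i + swing t"
    "of_nat i + 1 / 2 + cis (- pi * t) / 2 = of_nat i + 1 - swing t"
    using assms by (auto simp: swing_def field_simps)
  show ?thesis
    unfolding generator_motion_def * by (rule refl)
qed

lemma word_motion_cases:
  assumes "z \<in> word_motion n w t" "set w \<subseteq> {1..<n}" "0 \<le> t"
  obtains k where "k \<in> {1..n}" "z = of_nat k"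
    | i x where "1 \<le> i" "i < n" "z = of_nat i + swing x \<or> z = of_nat i + 1 - swing x"
proof (cases "t < real (length w)")
  case True
  then have "nat \<lfloor>t\<rfloor> < length w"
    using assms(3) by linarith
  then have "w ! nat \<lfloor>t\<rfloor> \<in> {1..<n}"
    using assms(2) nth_mem by blast
  moreover have "z \<in> generator_motion n (w ! nat \<lfloor>t\<rfloor>) (frac t)"
    using assms(1) True by (simp add: word_motion_def)
  ultimately show thesis
    using that generator_motion_swing [of "frac t" n "w ! nat \<lfloor>t\<rfloor>"] frac_lt_1 [of t]
    by (auto simp: less_imp_le)
next
  case False
  then show thesis
    using assms(1) that by (auto simp: word_motion_def)
qed

lemma word_motion_Re:
  assumes "z \<in> word_motion n w t" "set w \<subseteq> {1..<n}" "0 \<le> t"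
  shows "1 \<le> Re z"
  using assms
proof (cases rule: word_motion_cases)
  case (2 i x)
  then show ?thesis
    using swing_Re [of x] by auto
qed auto

lemma word_motion_0:
  assumes "set w \<subseteq> {1..<n}"
  shows "word_motion n w 0 = of_nat ` {1..n}"
proof (cases w)
  case (Cons i v)
  then have "{1..n} = insert i (insert (i + 1) ({1..n} - {i, i + 1}))"
    using assms by auto
  then have "(of_nat ` {1..n} :: complex set) = of_nat ` insert i (insert (i + 1) ({1..n} - {i, i + 1}))"
    by (rule arg_cong)
  also have "\<dots> = generator_motion n i 0"
    by (auto simp: generator_motion_swing)
  finally show ?thesis
    using Cons by (simp add: word_motion_Cons)
qed (simp add: word_motion_def)

section \<open>Cyclic rotation and half turn of a closed braid word\<close>

text \<open>Turning the space about the axis changes the time at which the word starts.\<close>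

lemma braid_closure_rotate:
  assumes "set (u @ v) \<subseteq> {1..<n}"
  shows "ambient_isotopic (braid_closure n (u @ v)) (braid_closure n (v @ u))"
proof (cases "u @ v = []")
  case True
  then show ?thesis
    by (simp add: ambient_isotopic_refl)
next
  case False
  define m where "m = real (length (u @ v))"
  have m: "m > 0" "m = real (length u) + real (length v)"
    using False by (cases u; cases v; simp add: m_def)+
  define P where "P = word_motion n (u @ v)"
  define Q where "Q = word_motion n (v @ u)"
  have "ambient_isotopic (\<Union>t\<in>{0..<1}. page_point t ` P (m * t))
      (\<Union>t\<in>{0..<1}. page_point (t - 1 * (real (length u) / m)) ` (\<lambda>z. z) ` P (m * t))"
  proof (rule page_isotopy [where h = "\<lambda>s t z. z" and \<phi> = "\<lambda>s t. t - s * (real (length u) / m)"])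
    show "0 \<le> Re z" if "t \<in> {0..<1}" "z \<in> P (m * t)" for t z
      using word_motion_Re [of z n "u @ v" "m * t"] that assms m by (auto simp: P_def)
  qed (use m in \<open>auto simp: split_def strict_mono_on_def intro!: continuous_intros bij_betw_imageI\<close>)
  also have "(\<Union>t\<in>{0..<1}. page_point (t - 1 * (real (length u) / m)) ` (\<lambda>z. z) ` P (m * t))
      = (\<Union>t\<in>{0..<m}. page_point ((t - real (length u)) / m) ` P t)"
  proof -
    have "{0..<m} = (\<lambda>t. m * t) ` {0..<1}"
      using m by (auto simp: image_iff intro!: bexI [of _ "_ / m"])
    then show ?thesis
      using m by (simp add: image_image diff_divide_distrib)
  qed
  also have "\<dots> = loop_closure m Q"
    unfolding loop_closure_def
  proof (intro equalityI UN_least)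
    fix t assume t: "t \<in> {0..<m}"
    define t' where "t' = (if t < real (length u) then t + real (length v) else t - real (length u))"
    have "P t = Q t'"
      using t m by (auto simp: P_def Q_def t'_def word_motion_append)
    moreover have "page_point (t' / m) = page_point ((t - real (length u)) / m)"
    proof (cases "t < real (length u)")
      case True
      then have "t' / m = (t - real (length u)) / m + 1"
        using m by (simp add: t'_def field_simps)
      then show ?thesis
        using page_point_add_int [of 1 "(t - real (length u)) / m"] by (intro ext) simp
    qed (simp add: t'_def)
    moreover have "t' \<in> {0..<m}"
      using t m by (auto simp: t'_def)
    then have "page_point (t' / m) ` Q t' \<subseteq> (\<Union>t\<in>{0..<m}. page_point (t / m) ` Q t)"
      by blast
    ultimately show "page_point ((t - real (length u)) / m) ` P t \<subseteq> (\<Union>t\<in>{0..<m}. page_point (t / m) ` Q t)"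
      by simp
  next
    fix t assume t: "t \<in> {0..<m}"
    define t' where "t' = (if t < real (length v) then t + real (length u) else t - real (length v))"
    have "P t' = Q t"
      using t m by (auto simp: P_def Q_def t'_def word_motion_append)
    moreover have "page_point (t / m) = page_point ((t' - real (length u)) / m)"
    proof (cases "t < real (length v)")
      case False
      then have "t / m = (t' - real (length u)) / m + 1"
        using m by (simp add: t'_def field_simps)
      then show ?thesis
        using page_point_add_int [of 1 "(t' - real (length u)) / m"] by (intro ext) simp
    qed (simp add: t'_def)
    moreover have "t' \<in> {0..<m}"
      using t m by (auto simp: t'_def)
    then have "page_point ((t' - real (length u)) / m) ` P t'
        \<subseteq> (\<Union>t\<in>{0..<m}. page_point ((t - real (length u)) / m) ` P t)"
      by blast
    ultimately show "page_point (t / m) ` Q t \<subseteq> (\<Union>t\<in>{0..<m}. page_point ((t - real (length u)) / m) ` P t)"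
      by simp
  qed
  finally have "ambient_isotopic (loop_closure m P) (loop_closure m Q)"
    using m by (simp add: loop_closure_scale)
  moreover have "braid_closure n (u @ v) = loop_closure m P"
    by (simp only: braid_closure_eq_loop_closure [OF False] P_def m_def)
  moreover have "braid_closure n (v @ u) = loop_closure m Q"
    using False m by (subst braid_closure_eq_loop_closure) (auto simp: Q_def add.commute)
  ultimately show ?thesis
    by simp
qed

lemma generator_motion_flip:
  assumes i: "1 \<le> i" "i < n" and t: "0 \<le> t" "t \<le> 1"
  shows "generator_motion n (n - i) t = (\<lambda>z. of_nat (n + 1) - z) ` generator_motion n i t"
proof -
  have "{1..n} - {n - i, n - i + 1} = (\<lambda>k. n + 1 - k) ` ({1..n} - {i, i + 1})" (is "?L = ?R")
  proof (intro equalityI subsetI)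
    fix k assume "k \<in> ?L"
    then have "k = n + 1 - (n + 1 - k)" "n + 1 - k \<in> {1..n} - {i, i + 1}"
      using i by auto
    then show "k \<in> ?R"
      by blast
  qed (use i in auto)
  then have "of_nat ` ({1..n} - {n - i, n - i + 1})
      = (\<lambda>k. of_nat (n + 1 - k) :: complex) ` ({1..n} - {i, i + 1})"
    by (simp add: image_image)
  also have "\<dots> = (\<lambda>k. of_nat (n + 1) - of_nat k) ` ({1..n} - {i, i + 1})"
    by (intro image_cong refl) (auto simp: of_nat_diff)
  finally show ?thesis
    using i t by (auto simp: generator_motion_swing of_nat_diff image_Un image_image algebra_simps)
qed

lemma word_motion_flip:
  assumes "set w \<subseteq> {1..<n}" "0 \<le> t" "t < real (length w)"
  shows "word_motion n (map (\<lambda>i. n - i) w) t = (\<lambda>z. of_nat (n + 1) - z) ` word_motion n w t"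
proof -
  have *: "nat \<lfloor>t\<rfloor> < length w"
    using assms by linarith
  then have "w ! nat \<lfloor>t\<rfloor> \<in> {1..<n}"
    using assms nth_mem by blast
  then show ?thesis
    using assms * generator_motion_flip [of "w ! nat \<lfloor>t\<rfloor>" n "frac t"] frac_lt_1 [of t]
    by (simp add: word_motion_def less_imp_le)
qed

text \<open>
  All points of the braid lie in the disc of diameter \<open>{1..n}\<close>, so turning this disc by \<open>\<pi>\<close>
  simultaneously in all pages, with the rotation dying out before the axis, exchanges the strands
  from left to right. A rotation of the page keeps its orientation, so positive generators stay
  positive.
\<close>

lemma braid_closure_flip:
  assumes w: "set w \<subseteq> {1..<n}"
  shows "ambient_isotopic (braid_closure n w) (braid_closure n (map (\<lambda>i. n - i) w))"
proof (cases "w = []")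
  case True
  then show ?thesis
    by (simp add: ambient_isotopic_refl)
next
  case False
  define m where "m = real (length w)"
  have m: "m > 0"
    using False by (simp add: m_def)
  have n: "n \<ge> 2"
    using False w by (cases w) auto
  define c :: complex where "c = of_real ((real n + 1) / 2)"
  define \<eta> where "\<eta> r = max 0 (min 1 (real n - 2 * r))" for r
  define h where "h s t z = c + (z - c) * cis (- pi * s * \<eta> (norm (z - c)))" for s t :: real and z
  have "ambient_isotopic (loop_closure m (word_motion n w))
      (loop_closure m (\<lambda>t. h 1 t ` word_motion n w t))"
  proof (rule loop_page_isotopy [OF m])
    show "continuous_on ({0..1} \<times> {0..m} \<times> {z. 0 \<le> Re z}) (\<lambda>(s, t, z). h s t z)"
      unfolding h_def \<eta>_def split_def by (intro continuous_intros)
    have left: "h s t z = z" if "Re z \<le> 0" for s t z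
    proof -
      have "(real n + 1) / 2 \<le> Re (c - z)"
        using that by (simp only: c_def minus_complex.sel Re_complex_of_real)
      also have "\<dots> \<le> norm (c - z)"
        by (rule complex_Re_le_cmod)
      finally have "\<eta> (norm (z - c)) = 0"
        by (simp add: \<eta>_def norm_minus_commute)
      then show ?thesis
        by (simp add: h_def)
    qed
    show "bij_betw (h s t) {z. 0 \<le> Re z} {z. 0 \<le> Re z}" for s t
    proof (rule bij_betw_half_plane [OF _ left])
      have nh: "norm (h s t z - c) = norm (z - c)" for s t z
        by (simp add: h_def norm_mult)
      have "h s' t (h s t z) = z" if "s' = - s" for s s' t z
      proof -
        have "h s' t (h s t z) = c + (h s t z - c) * cis (- pi * s' * \<eta> (norm (z - c)))"
          by (subst h_def) (simp add: nh)
        also have "\<dots> = c + (z - c) * (cis (- pi * s * \<eta> (norm (z - c))) * cis (- pi * s' * \<eta> (norm (z - c))))"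
          by (simp add: h_def)
        also have "\<dots> = z"
          unfolding cis_mult by (simp add: that)
        finally show ?thesis .
      qed
      from this [of "- s" s] this [of s "- s"] show "bij (h s t)"
        by (intro o_bij [of "h (- s) t"]) (auto simp: fun_eq_iff)
    qed
    show "0 \<le> Re z" if "t \<in> {0..<m}" "z \<in> word_motion n w t" for t z
      using word_motion_Re [OF that(2) w] that by auto
    show "h s t z = z" if "Re z = 0" for s t z
      using left that by simp
  qed (auto simp: h_def)
  also have "loop_closure m (\<lambda>t. h 1 t ` word_motion n w t)
      = loop_closure m (word_motion n (map (\<lambda>i. n - i) w))"
  proof (rule loop_closure_cong)
    fix t assume t: "0 \<le> t" "t < m"
    have "h 1 t z = of_nat (n + 1) - z" if "z \<in> word_motion n w t" for z
    proof -
      have "norm (z - c) \<le> (real n - 1) / 2"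
        using that w t(1)
      proof (cases rule: word_motion_cases)
        case (1 k)
        then have "z - c = of_real (real k - (real n + 1) / 2)"
          by (simp add: c_def)
        moreover have "\<bar>real k - (real n + 1) / 2\<bar> \<le> (real n - 1) / 2"
          using 1 by (auto simp: abs_le_iff field_simps)
        ultimately show ?thesis
          by (simp only: norm_of_real)
      next
        case (2 i x)
        have "of_nat i + swing x - c = of_real (real i - real n / 2) + (swing x - 1 / 2)"
          "of_nat i + 1 - swing x - c = of_real (real i - real n / 2) - (swing x - 1 / 2)"
          by (auto simp: c_def field_simps)
        then have "z - c = of_real (real i - real n / 2) + (swing x - 1 / 2) \<or>
            z - c = of_real (real i - real n / 2) - (swing x - 1 / 2)"
          using 2 by metis
        then have "norm (z - c) \<le> norm (of_real (real i - real n / 2) :: complex) + norm (swing x - 1 / 2)"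
          using norm_triangle_ineq norm_triangle_ineq4 by metis
        then show ?thesis
          unfolding norm_swing_minus_half norm_of_real using 2 by auto
      qed
      then have "\<eta> (norm (z - c)) = 1"
        by (simp add: \<eta>_def)
      then have "h 1 t z = c - (z - c)"
        by (simp add: h_def cis_cnj [symmetric] del: cis_cnj)
      also have "\<dots> = of_nat (n + 1) - z"
        by (simp add: c_def field_simps)
      finally show ?thesis .
    qed
    then show "h 1 t ` word_motion n w t = word_motion n (map (\<lambda>i. n - i) w) t"
      using word_motion_flip [OF w] t by (simp add: m_def cong: image_cong)
  qed
  finally show ?thesis
    using False by (simp add: braid_closure_eq_loop_closure m_def)
qed

section \<open>Braid relations\<close>

text \<open>
  A closed braid whose beginning, of duration \<open>l\<close>, is performed by the strands \<open>p a\<close> next to the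
  resting points of \<open>K\<close>, and whose remaining part is the word \<open>v\<close>.
\<close>

definition window_closure ::
    "nat \<Rightarrow> nat list \<Rightarrow> real \<Rightarrow> nat set \<Rightarrow> nat set \<Rightarrow> (nat \<Rightarrow> real \<Rightarrow> complex) \<Rightarrow> (real ^ 3) set" where
  "window_closure n v l K A p = loop_closure (l + real (length v))
     (\<lambda>t. (if t \<le> l then of_nat ` K else word_motion n v (t - l)) \<union>
          (if t \<in> {0..l} then (\<lambda>a. p a t) ` A else {}))"

lemma braid_closure_window:
  assumes "u \<noteq> []" and v: "set v \<subseteq> {1..<n}"
    and p: "\<And>t. 0 \<le> t \<Longrightarrow> t < real (length u) \<Longrightarrow> word_motion n u t = of_nat ` K \<union> (\<lambda>a. p a t) ` A"
    and p_end: "of_nat ` {1..n} = of_nat ` K \<union> (\<lambda>a. p a (real (length u))) ` A"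
  shows "braid_closure n (u @ v) = window_closure n v (real (length u)) K A p"
proof -
  have "u @ v \<noteq> []"
    using assms by simp
  then show ?thesis
    unfolding braid_closure_eq_loop_closure [OF \<open>u @ v \<noteq> []\<close>] window_closure_def length_append of_nat_add
    using word_motion_0 [OF v] p p_end
    by (intro loop_closure_cong) (auto simp: word_motion_append less_le)
qed

lemma window_isotopy:
  fixes p q :: "nat \<Rightarrow> real \<Rightarrow> complex"
  assumes l: "l > 0" and v: "set v \<subseteq> {1..<n}" and A: "finite A"
    and cont: "\<And>a. a \<in> A \<Longrightarrow> continuous_on {0..l} (p a)" "\<And>a. a \<in> A \<Longrightarrow> continuous_on {0..l} (q a)"
    and ends: "\<And>a. a \<in> A \<Longrightarrow> q a 0 = p a 0" "\<And>a. a \<in> A \<Longrightarrow> q a l = p a l"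
    and Re: "\<And>a t. a \<in> A \<Longrightarrow> t \<in> {0..l} \<Longrightarrow> 1 \<le> Re (p a t)" "\<And>a t. a \<in> A \<Longrightarrow> t \<in> {0..l} \<Longrightarrow> 1 \<le> Re (q a t)"
    and sep: "\<And>a b s t. a \<in> A \<Longrightarrow> b \<in> A \<Longrightarrow> a < b \<Longrightarrow> s \<in> {0..1} \<Longrightarrow> t \<in> {0..l} \<Longrightarrow>
        (1 - s) *\<^sub>R (p a t - p b t) + s *\<^sub>R (q a t - q b t) \<noteq> 0"
    and sepK: "\<And>a k t. a \<in> A \<Longrightarrow> t \<in> {0..l} \<Longrightarrow> k \<in> K \<Longrightarrow>
        real k + 1 \<le> Re (p a t) \<and> real k + 1 \<le> Re (q a t) \<or>
        Re (p a t) + 1 \<le> real k \<and> Re (q a t) + 1 \<le> real k"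
  shows "ambient_isotopic (window_closure n v l K A p) (window_closure n v l K A q)"
  unfolding window_closure_def
proof (rule straight_isotopy [where \<rho>\<^sub>0 = 1])
  show "(1 - s) *\<^sub>R p a t + s *\<^sub>R q a t \<noteq> (1 - s) *\<^sub>R p b t + s *\<^sub>R q b t"
    if ab: "a \<in> A" "b \<in> A" "a \<noteq> b" and st: "s \<in> {0..1}" "t \<in> {0..l}" for a b s t
  proof -
    have "(1 - s) *\<^sub>R (p a t - p b t) + s *\<^sub>R (q a t - q b t) \<noteq> 0" if "a < b"
      using sep ab st that by blast
    moreover have "(1 - s) *\<^sub>R (p b t - p a t) + s *\<^sub>R (q b t - q a t) \<noteq> 0" if "b < a"
      using sep ab st that by blast
    ultimately show ?thesis
      using \<open>a \<noteq> b\<close> by (cases "a < b") (auto simp: algebra_simps)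
  qed
  show "1 \<le> norm (f - ((1 - s) *\<^sub>R p a t + s *\<^sub>R q a t))"
    if a: "a \<in> A" and st: "s \<in> {0..1}" "t \<in> {0..l}" and f: "f \<in> (if t \<le> l then of_nat ` K else word_motion n v (t - l))"
    for a f s t
  proof -
    obtain k where k: "k \<in> K" "f = of_nat k"
      using f st by auto
    define x where "x = (1 - s) * (Re (p a t) - real k) + s * (Re (q a t) - real k)"
    have conv: "(1 - s) * 1 + s * 1 \<le> (1 - s) * y + s * z" if "1 \<le> y" "1 \<le> z" for y z
      using st that by (intro add_mono mult_left_mono) auto
    have "1 \<le> \<bar>x\<bar>"
      using sepK [OF a st(2) k(1)]
        conv [of "Re (p a t) - real k" "Re (q a t) - real k"]
        conv [of "real k - Re (p a t)" "real k - Re (q a t)"]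
      by (auto simp: x_def algebra_simps)
    also have "x = - Re (f - ((1 - s) *\<^sub>R p a t + s *\<^sub>R q a t))"
      by (simp add: x_def k algebra_simps)
    finally show ?thesis
      using abs_Re_le_cmod order_trans by (metis abs_minus_cancel)
  qed
  show "0 \<le> Re f" if "t \<in> {0..<l + real (length v)}" "f \<in> (if t \<le> l then of_nat ` K else word_motion n v (t - l))"
    for t f
    using that word_motion_Re [OF _ v, of f "t - l"] by (force split: if_splits)
qed (use assms in auto)

text \<open>
  For the difference of two strands: if both motions keep them in the same left-to-right order, or both
  keep the first above the second, then they do not collide in the straight line homotopy.
\<close>

lemma segment_nonzero:
  fixes d e :: complex
  assumes "s \<in> {0..1}" "d \<noteq> 0"
    and "0 \<le> Im d \<and> 0 < Im e \<or> 0 < Re d \<and> 0 < Re e \<or> Re d < 0 \<and> Re e < 0"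
  shows "(1 - s) *\<^sub>R d + s *\<^sub>R e \<noteq> 0"
proof
  assume eq: "(1 - s) *\<^sub>R d + s *\<^sub>R e = 0"
  then have Re: "(1 - s) * Re d + s * Re e = 0" and Im: "(1 - s) * Im d + s * Im e = 0"
    by (auto simp: complex_eq_iff)
  have "s \<noteq> 0"
    using eq assms(2) by auto
  then have s: "0 < s" "0 \<le> 1 - s"
    using assms(1) by auto
  have "0 < (1 - s) * x + s * y" if "0 \<le> x" "0 < y" for x y
    using s that by (intro add_nonneg_pos mult_nonneg_nonneg mult_pos_pos)
  from this [of "Im d" "Im e"] this [of "Re d" "Re e"] this [of "- Re d" "- Re e"]
  show False
    using assms(3) Re Im by auto
qed

text \<open>
  Both sides of the braid relation let strand 0 pass above strands 1 and 2, and strand 1 above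
  strand 2. They are compared with a motion in which strands 0 and 2 exchange places on a wide
  detour above and below strand 1, so that all differences lie in the upper half plane.
\<close>

definition wide_exchange :: "nat \<Rightarrow> nat \<Rightarrow> real \<Rightarrow> complex" where
  "wide_exchange i a t =
     (if a = 0 then Complex (real i + 2 * t / 3) (t * (3 - t))
      else if a = 1 then Complex (real i + 1) 0
      else Complex (real i + 2 - 2 * t / 3) (- t * (3 - t)))"

text \<open>
  A strand with a smaller index is never below one with a larger index, except that neighbours may be so
  in the first letter while they are still in their initial order from left to right, and in the last
  letter when they are already in their final order. In these cases the order from left to right keeps
  the homotopy to \<open>wide_exchange\<close> free of collisions.
\<close>

lemma triple_word_isotopy:
  fixes p :: "nat \<Rightarrow> real \<Rightarrow> complex"
  assumes u: "length u = 3" and v: "set v \<subseteq> {1..<n}" and i: "1 \<le> i" "i + 2 \<le> n"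
    and cont: "\<And>a. continuous_on {0..3} (p a)"
    and p: "\<And>t. 0 \<le> t \<Longrightarrow> t < 3 \<Longrightarrow> word_motion n u t = of_nat ` ({1..n} - {i, i + 1, i + 2}) \<union> {p 0 t, p 1 t, p 2 t}"
    and ends: "p 0 0 = of_nat i" "p 1 0 = of_nat (i + 1)" "p 2 0 = of_nat (i + 2)"
      "p 0 3 = of_nat (i + 2)" "p 1 3 = of_nat (i + 1)" "p 2 3 = of_nat i"
    and Re: "\<And>a t. t \<in> {0..3} \<Longrightarrow> a \<le> 2 \<Longrightarrow> real i \<le> Re (p a t) \<and> Re (p a t) \<le> real i + 2"
    and neq: "\<And>a b t. t \<in> {0..3} \<Longrightarrow> a < b \<Longrightarrow> b \<le> 2 \<Longrightarrow> p a t \<noteq> p b t"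
    and above: "\<And>a b t. t \<in> {0<..<3} \<Longrightarrow> a < b \<Longrightarrow> b \<le> 2 \<Longrightarrow> Im (p b t) \<le> Im (p a t) \<or>
        b = a + 1 \<and> t \<le> 1 \<and> Re (p a t) < Re (p b t) \<or> b = a + 1 \<and> 2 \<le> t \<and> Re (p b t) < Re (p a t)"
  shows "ambient_isotopic (braid_closure n (u @ v))
    (window_closure n v 3 ({1..n} - {i, i + 1, i + 2}) {0, 1, 2} (wide_exchange i))"
proof -
  have split: "{1..n} = ({1..n} - {i, i + 1, i + 2}) \<union> {i, i + 1, i + 2}"
    using i by auto
  have "(of_nat ` {1..n} :: complex set) = of_nat ` ({1..n} - {i, i + 1, i + 2}) \<union> (\<lambda>a. p a 3) ` {0, 1, 2}"
    by (subst split, subst image_Un) (simp only: image_insert image_empty ends insert_commute)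
  then have "braid_closure n (u @ v)
      = window_closure n v (real (length u)) ({1..n} - {i, i + 1, i + 2}) {0, 1, 2} p"
    using u p by (intro braid_closure_window [OF _ v]) auto
  then have "braid_closure n (u @ v) = window_closure n v 3 ({1..n} - {i, i + 1, i + 2}) {0, 1, 2} p"
    by (simp only: u of_nat_numeral)
  moreover have "ambient_isotopic (window_closure n v 3 ({1..n} - {i, i + 1, i + 2}) {0, 1, 2} p)
    (window_closure n v 3 ({1..n} - {i, i + 1, i + 2}) {0, 1, 2} (wide_exchange i))"
  proof (rule window_isotopy [OF _ v])
    show "continuous_on {0..3} (wide_exchange i a)" if "a \<in> {0, 1, 2}" for a
      using that unfolding wide_exchange_def [abs_def] Complex_eq
      by (auto intro!: continuous_intros)
    show "wide_exchange i a 0 = p a 0" "wide_exchange i a 3 = p a 3" if "a \<in> {0, 1, 2}" for a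
      using that ends by (auto simp: wide_exchange_def complex_eq_iff)
    have W: "real i \<le> Re (wide_exchange i a t) \<and> Re (wide_exchange i a t) \<le> real i + 2" if "t \<in> {0..3}" for a t
      using that by (auto simp: wide_exchange_def)
    show "1 \<le> Re (p a t)" "1 \<le> Re (wide_exchange i a t)" if "a \<in> {0, 1, 2}" "t \<in> {0..3}" for a t
      using that Re [of t a] W [of t a] i by auto
    show "real k + 1 \<le> Re (p a t) \<and> real k + 1 \<le> Re (wide_exchange i a t) \<or>
        Re (p a t) + 1 \<le> real k \<and> Re (wide_exchange i a t) + 1 \<le> real k"
      if "a \<in> {0, 1, 2}" "t \<in> {0..3}" "k \<in> {1..n} - {i, i + 1, i + 2}" for a t k
    proof -
      have "k + 1 \<le> i \<or> i + 3 \<le> k"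
        using that(3) by auto
      then have "real k + 1 \<le> real i \<or> real i + 3 \<le> real k"
        by linarith
      then show ?thesis
        using Re [of t a] W [of t a] that by auto
    qed
    show "(1 - s) *\<^sub>R (p a t - p b t) + s *\<^sub>R (wide_exchange i a t - wide_exchange i b t) \<noteq> 0"
      if ab: "a \<in> {0, 1, 2}" "b \<in> {0, 1, 2}" "a < b" and st: "s \<in> {0..1}" "t \<in> {0..3}" for a b s t
    proof -
      consider "t = 0" | "t = 3" | "t \<in> {0<..<3}"
        using st by force
      then show ?thesis
      proof cases
        case 3
        have pos: "0 < t * (3 - t)"
          using 3 by simp
        have Im: "0 < Im (wide_exchange i a t - wide_exchange i b t)"
          using ab 3 pos by (auto simp: wide_exchange_def)
        have "Re (wide_exchange i a t - wide_exchange i b t) < 0" if "b = a + 1" "t \<le> 1"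
          using ab 3 that by (auto simp: wide_exchange_def)
        moreover have "0 < Re (wide_exchange i a t - wide_exchange i b t)" if "b = a + 1" "2 \<le> t"
          using ab 3 that by (auto simp: wide_exchange_def)
        ultimately show ?thesis
          using Im above [OF 3, of a b] ab neq [OF st(2), of a b]
          by (intro segment_nonzero [OF st(1)]) (auto simp: numeral_2_eq_2)
      qed (use ab st ends in \<open>intro segment_nonzero [OF st(1)]; auto simp: wide_exchange_def complex_eq_iff\<close>)+
    qed
  qed (use cont in auto)
  ultimately show ?thesis
    by simp
qed

text \<open>
  The strands \<open>p\<close> and \<open>q\<close> trace the two sides of the relation: each letter performed in slot \<open>k\<close> adds
  \<open>swing (t - k)\<close> to the strand on its left and subtracts it from the strand on its right.
\<close>

lemma braid_closure_braid_relation_front: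
  assumes v: "set v \<subseteq> {1..<n}" and i: "1 \<le> i" "i + 2 \<le> n"
  shows "ambient_isotopic (braid_closure n ([i, i + 1, i] @ v)) (braid_closure n ([i + 1, i, i + 1] @ v))"
proof -
  define R :: "complex set" where "R = of_nat ` ({1..n} - {i, i + 1, i + 2})"
  have gen: "generator_motion n i x = insert (of_nat i + 2) R \<union> {of_nat i + swing x, of_nat i + 1 - swing x}"
    and gen': "generator_motion n (Suc i) x = insert (of_nat i) R \<union> {of_nat i + 1 + swing x, of_nat i + 2 - swing x}"
    if "0 \<le> x" "x \<le> 1" for x
  proof -
    have "{1..n} - {i, i + 1} = insert (i + 2) ({1..n} - {i, i + 1, i + 2})"
      "{1..n} - {Suc i, Suc i + 1} = insert i ({1..n} - {i, i + 1, i + 2})"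
      using i by auto
    then have "of_nat ` ({1..n} - {i, i + 1}) = insert (of_nat (i + 2)) R"
      "of_nat ` ({1..n} - {Suc i, Suc i + 1}) = insert (of_nat i) R"
      unfolding R_def by (metis image_insert)+
    then show "generator_motion n i x = insert (of_nat i + 2) R \<union> {of_nat i + swing x, of_nat i + 1 - swing x}"
      "generator_motion n (Suc i) x = insert (of_nat i) R \<union> {of_nat i + 1 + swing x, of_nat i + 2 - swing x}"
      unfolding generator_motion_swing [OF that] by (simp_all only:) (simp_all add: add_ac)
  qed
  have slot: "t \<in> {0..1} \<or> t \<in> {1..2} \<or> t \<in> {2..3}" if "t \<in> {0..3}" for t :: real
    using that by auto
  define p where "p a t = (if a = 0 then of_nat i + swing t + swing (t - 1)
      else if a = 1 then of_nat i + 1 - swing t + swing (t - 2)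
      else of_nat i + 2 - swing (t - 1) - swing (t - 2))" for a :: nat and t
  define q where "q a t = (if a = 0 then of_nat i + swing (t - 1) + swing (t - 2)
      else if a = 1 then of_nat i + 1 + swing t - swing (t - 2)
      else of_nat i + 2 - swing t - swing (t - 1))" for a :: nat and t
  have "ambient_isotopic (braid_closure n ([i, i + 1, i] @ v))
    (window_closure n v 3 ({1..n} - {i, i + 1, i + 2}) {0, 1, 2} (wide_exchange i))"
  proof (rule triple_word_isotopy [OF _ v i, where p = p])
    show "word_motion n [i, i + 1, i] t = of_nat ` ({1..n} - {i, i + 1, i + 2}) \<union> {p 0 t, p 1 t, p 2 t}"
      if "0 \<le> t" "t < 3" for t
      using that unfolding R_def [symmetric]
      by (cases "t < 1"; cases "t < 2"; simp add: word_motion_Cons gen gen' p_def)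
         (simp_all add: insert_commute add_ac)
    show "continuous_on {0..3} (p a)" for a
      unfolding p_def [abs_def] by (cases "a = 0"; cases "a = 1") (auto intro!: continuous_intros)
    show "real i \<le> Re (p a t) \<and> Re (p a t) \<le> real i + 2" if "t \<in> {0..3}" "a \<le> 2" for a t
      using slot [OF that(1)] swing_Re [of t] swing_Re [of "t - 1"] swing_Re [of "t - 2"]
      by (auto simp: p_def)
    show "p a t \<noteq> p b t" if "t \<in> {0..3}" "a < b" "b \<le> 2" for a b t
    proof -
      have "a = 0 \<and> b = 1 \<or> a = 0 \<and> b = 2 \<or> a = 1 \<and> b = 2"
        using that by auto
      moreover have half: "Re (swing x) = 1 / 2 \<longrightarrow> Im (swing x) \<noteq> 0" for x
        using swing_neq_half [of x] by (auto simp: complex_eq_iff)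
      ultimately have "Re (p a t) \<noteq> Re (p b t) \<or> Im (p a t) \<noteq> Im (p b t)"
        using slot [OF that(1)] swing_Re [of t] swing_Re [of "t - 1"] swing_Re [of "t - 2"]
          half [of t] half [of "t - 1"] half [of "t - 2"]
        by (elim disjE conjE) (simp_all add: p_def)
      then show ?thesis
        by auto
    qed
    show "Im (p b t) \<le> Im (p a t) \<or>
        b = a + 1 \<and> t \<le> 1 \<and> Re (p a t) < Re (p b t) \<or> b = a + 1 \<and> 2 \<le> t \<and> Re (p b t) < Re (p a t)"
      if "t \<in> {0<..<3}" "a < b" "b \<le> 2" for a b t
    proof -
      have "a = 0 \<and> b = 1 \<or> a = 0 \<and> b = 2 \<or> a = 1 \<and> b = 2"
        using that by auto
      then show ?thesis
        using slot [of t] that(1) swing_Re [of t] swing_Re [of "t - 1"] swing_Re [of "t - 2"]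
          swing_Im [of t] swing_Im [of "t - 1"] swing_Im [of "t - 2"]
        by (auto simp: p_def)
    qed
  qed (auto simp: p_def)
  moreover have "ambient_isotopic (braid_closure n ([i + 1, i, i + 1] @ v))
    (window_closure n v 3 ({1..n} - {i, i + 1, i + 2}) {0, 1, 2} (wide_exchange i))"
  proof (rule triple_word_isotopy [OF _ v i, where p = q])
    show "word_motion n [i + 1, i, i + 1] t = of_nat ` ({1..n} - {i, i + 1, i + 2}) \<union> {q 0 t, q 1 t, q 2 t}"
      if "0 \<le> t" "t < 3" for t
      using that unfolding R_def [symmetric]
      by (cases "t < 1"; cases "t < 2"; simp add: word_motion_Cons gen gen' q_def)
         (simp_all add: insert_commute add_ac)
    show "continuous_on {0..3} (q a)" for a
      unfolding q_def [abs_def] by (cases "a = 0"; cases "a = 1") (auto intro!: continuous_intros)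
    show "real i \<le> Re (q a t) \<and> Re (q a t) \<le> real i + 2" if "t \<in> {0..3}" "a \<le> 2" for a t
      using slot [OF that(1)] swing_Re [of t] swing_Re [of "t - 1"] swing_Re [of "t - 2"]
      by (auto simp: q_def)
    show "q a t \<noteq> q b t" if "t \<in> {0..3}" "a < b" "b \<le> 2" for a b t
    proof -
      have "a = 0 \<and> b = 1 \<or> a = 0 \<and> b = 2 \<or> a = 1 \<and> b = 2"
        using that by auto
      moreover have half: "Re (swing x) = 1 / 2 \<longrightarrow> Im (swing x) \<noteq> 0" for x
        using swing_neq_half [of x] by (auto simp: complex_eq_iff)
      ultimately have "Re (q a t) \<noteq> Re (q b t) \<or> Im (q a t) \<noteq> Im (q b t)"
        using slot [OF that(1)] swing_Re [of t] swing_Re [of "t - 1"] swing_Re [of "t - 2"]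
          half [of t] half [of "t - 1"] half [of "t - 2"]
        by (elim disjE conjE) (simp_all add: q_def)
      then show ?thesis
        by auto
    qed
    show "Im (q b t) \<le> Im (q a t) \<or>
        b = a + 1 \<and> t \<le> 1 \<and> Re (q a t) < Re (q b t) \<or> b = a + 1 \<and> 2 \<le> t \<and> Re (q b t) < Re (q a t)"
      if "t \<in> {0<..<3}" "a < b" "b \<le> 2" for a b t
    proof -
      have "a = 0 \<and> b = 1 \<or> a = 0 \<and> b = 2 \<or> a = 1 \<and> b = 2"
        using that by auto
      then show ?thesis
        using slot [of t] that(1) swing_Re [of t] swing_Re [of "t - 1"] swing_Re [of "t - 2"]
          swing_Im [of t] swing_Im [of "t - 1"] swing_Im [of "t - 2"]
        by (auto simp: q_def)
    qed
  qed (auto simp: q_def)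
  ultimately show ?thesis
    using ambient_isotopic_sym ambient_isotopic_trans by blast
qed

text \<open>
  The functions \<open>f\<close> and \<open>g\<close> give the progress of the two exchanges. If they are performed one after the
  other, each of them rests at 0 or 1 for half of the time; the intermediate motion performs them
  simultaneously.
\<close>

definition pair_exchange ::
    "nat \<Rightarrow> nat \<Rightarrow> (real \<Rightarrow> complex) \<Rightarrow> (real \<Rightarrow> complex) \<Rightarrow> nat \<Rightarrow> real \<Rightarrow> complex" where
  "pair_exchange i j f g a t =
     (if a = 0 then of_nat i + f t else if a = 1 then of_nat i + 1 - f t
      else if a = 2 then of_nat j + g t else of_nat j + 1 - g t)"

lemma pair_exchange_isotopy:
  fixes f g :: "real \<Rightarrow> complex"
  defines "h \<equiv> \<lambda>t. Complex (t / 2) (t * (2 - t))"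
  assumes v: "set v \<subseteq> {1..<n}" and ij: "1 \<le> i" "i + 2 \<le> j" "j < n"
    and cont: "continuous_on {0..2} f" "continuous_on {0..2} g"
    and ends: "f 0 = 0" "f 2 = 1" "g 0 = 0" "g 2 = 1"
    and Re: "\<And>t. 0 \<le> Re (f t) \<and> Re (f t) \<le> 1 \<and> 0 \<le> Re (g t) \<and> Re (g t) \<le> 1"
    and Im: "\<And>t. 0 \<le> Im (f t) \<and> 0 \<le> Im (g t)"
    and neq: "\<And>t. 2 * f t \<noteq> 1 \<and> 2 * g t \<noteq> 1"
  shows "ambient_isotopic
    (window_closure n v 2 ({1..n} - {i, i + 1, j, j + 1}) {0, 1, 2, 3} (pair_exchange i j f g))
    (window_closure n v 2 ({1..n} - {i, i + 1, j, j + 1}) {0, 1, 2, 3} (pair_exchange i j h h))"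
proof (rule window_isotopy [OF _ v])
  have h: "Re (h t) = t / 2" "Im (h t) = t * (2 - t)" for t
    by (simp_all add: h_def)
  show "continuous_on {0..2} (pair_exchange i j f g a)" for a
    unfolding pair_exchange_def [abs_def]
    by (cases "a = 0"; cases "a = 1"; cases "a = 2") (auto intro!: continuous_intros cont)
  show "continuous_on {0..2} (pair_exchange i j h h a)" for a
    unfolding pair_exchange_def [abs_def] h_def Complex_eq
    by (cases "a = 0"; cases "a = 1"; cases "a = 2") (auto intro!: continuous_intros)
  show "pair_exchange i j h h a 0 = pair_exchange i j f g a 0"
    "pair_exchange i j h h a 2 = pair_exchange i j f g a 2" for a
    by (auto simp: pair_exchange_def ends h complex_eq_iff)
  have bd: "a \<le> 1 \<and> real i \<le> Re (pair_exchange i j f g a t) \<and> Re (pair_exchange i j f g a t) \<le> real i + 1 \<and>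
      real i \<le> Re (pair_exchange i j h h a t) \<and> Re (pair_exchange i j h h a t) \<le> real i + 1 \<or>
      \<not> a \<le> 1 \<and> real j \<le> Re (pair_exchange i j f g a t) \<and> Re (pair_exchange i j f g a t) \<le> real j + 1 \<and>
      real j \<le> Re (pair_exchange i j h h a t) \<and> Re (pair_exchange i j h h a t) \<le> real j + 1"
    if "t \<in> {0..2}" for a t
    using Re [of t] that by (auto simp: pair_exchange_def h)
  have real_ij: "1 \<le> real i" "real i + 2 \<le> real j"
    using ij by linarith+
  show "1 \<le> Re (pair_exchange i j f g a t)" "1 \<le> Re (pair_exchange i j h h a t)" if "t \<in> {0..2}" for a t
    using bd [OF that, of a] real_ij by auto
  show "real k + 1 \<le> Re (pair_exchange i j f g a t) \<and> real k + 1 \<le> Re (pair_exchange i j h h a t) \<or>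
      Re (pair_exchange i j f g a t) + 1 \<le> real k \<and> Re (pair_exchange i j h h a t) + 1 \<le> real k"
    if "t \<in> {0..2}" "k \<in> {1..n} - {i, i + 1, j, j + 1}" for a k t
  proof -
    have "k + 1 \<le> i \<or> i + 2 \<le> k" "k + 1 \<le> j \<or> j + 2 \<le> k"
      using that(2) by auto
    then have "real k + 1 \<le> real i \<or> real i + 2 \<le> real k" "real k + 1 \<le> real j \<or> real j + 2 \<le> real k"
      by linarith+
    then show ?thesis
      using bd [OF that(1), of a] real_ij by linarith
  qed
  show "(1 - s) *\<^sub>R (pair_exchange i j f g a t - pair_exchange i j f g b t)
      + s *\<^sub>R (pair_exchange i j h h a t - pair_exchange i j h h b t) \<noteq> 0"
    if ab: "a \<in> {0, 1, 2, 3}" "b \<in> {0, 1, 2, 3}" "a < b" and st: "s \<in> {0..1}" "t \<in> {0..2}" for a b s t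
  proof -
    consider "a = 0" "b = 1" | "a = 2" "b = 3" | "a \<le> 1" "\<not> b \<le> 1"
      using ab by force
    then show ?thesis
    proof cases
      case 3
      then have "Re (pair_exchange i j f g a t - pair_exchange i j f g b t) < 0"
        "Re (pair_exchange i j h h a t - pair_exchange i j h h b t) < 0"
        using bd [OF st(2), of a] bd [OF st(2), of b] real_ij by auto
      then show ?thesis
        by (intro segment_nonzero [OF st(1)]) auto
    next
      case 1
      have "pair_exchange i j f g a t - pair_exchange i j f g b t = 2 * f t - 1"
        "pair_exchange i j h h a t - pair_exchange i j h h b t = 2 * h t - 1"
        using 1 by (auto simp: pair_exchange_def)
      moreover have "(1 - s) *\<^sub>R (2 * f t - 1) + s *\<^sub>R (2 * h t - 1) \<noteq> 0"
        using neq [of t] Im [of t] st(2) ends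
        by (intro segment_nonzero [OF st(1)]; cases "t = 0"; cases "t = 2") (auto simp: h)
      ultimately show ?thesis
        by simp
    next
      case 2
      have "pair_exchange i j f g a t - pair_exchange i j f g b t = 2 * g t - 1"
        "pair_exchange i j h h a t - pair_exchange i j h h b t = 2 * h t - 1"
        using 2 by (auto simp: pair_exchange_def)
      moreover have "(1 - s) *\<^sub>R (2 * g t - 1) + s *\<^sub>R (2 * h t - 1) \<noteq> 0"
        using neq [of t] Im [of t] st(2) ends
        by (intro segment_nonzero [OF st(1)]; cases "t = 0"; cases "t = 2") (auto simp: h)
      ultimately show ?thesis
        by simp
    qed
  qed
qed auto

lemma braid_closure_commute_front:
  assumes v: "set v \<subseteq> {1..<n}" and ij: "1 \<le> i" "i + 2 \<le> j" "j < n"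
  shows "ambient_isotopic (braid_closure n ([i, j] @ v)) (braid_closure n ([j, i] @ v))"
proof -
  define K where "K = {1..n} - {i, i + 1, j, j + 1}"
  define R :: "complex set" where "R = of_nat ` K"
  have gen: "generator_motion n i x
      = insert (of_nat j) (insert (of_nat j + 1) R) \<union> {of_nat i + swing x, of_nat i + 1 - swing x}"
    and gen': "generator_motion n j x
      = insert (of_nat i) (insert (of_nat i + 1) R) \<union> {of_nat j + swing x, of_nat j + 1 - swing x}"
    if "0 \<le> x" "x \<le> 1" for x
  proof -
    have "{1..n} - {i, i + 1} = insert j (insert (j + 1) K)"
      "{1..n} - {j, j + 1} = insert i (insert (i + 1) K)"
      using ij by (auto simp: K_def)
    then have "of_nat ` ({1..n} - {i, i + 1}) = insert (of_nat j) (insert (of_nat (j + 1)) R)"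
      "of_nat ` ({1..n} - {j, j + 1}) = insert (of_nat i) (insert (of_nat (i + 1)) R)"
      unfolding R_def by (metis image_insert)+
    then show "generator_motion n i x
        = insert (of_nat j) (insert (of_nat j + 1) R) \<union> {of_nat i + swing x, of_nat i + 1 - swing x}"
      "generator_motion n j x
        = insert (of_nat i) (insert (of_nat i + 1) R) \<union> {of_nat j + swing x, of_nat j + 1 - swing x}"
      unfolding generator_motion_swing [OF that] by (simp_all only:) (simp_all add: add_ac)
  qed
  have "{1..n} = insert i (insert (i + 1) (insert j (insert (j + 1) K)))"
    using ij by (auto simp: K_def)
  then have all: "of_nat ` {1..n} = insert (of_nat i) (insert (of_nat i + 1) (insert (of_nat j) (insert (of_nat j + 1) R)))"
    unfolding R_def by (metis image_insert of_nat_add of_nat_1)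
  let ?W = "window_closure n v 2 K {0, 1, 2, 3}"
  let ?s = "\<lambda>t. swing (t - 1)"
  have "braid_closure n ([i, j] @ v)
      = window_closure n v (real (length [i, j])) K {0, 1, 2, 3} (pair_exchange i j swing ?s)"
  proof (rule braid_closure_window [OF _ v])
    show "word_motion n [i, j] t = of_nat ` K \<union> (\<lambda>a. pair_exchange i j swing ?s a t) ` {0, 1, 2, 3}"
      if "0 \<le> t" "t < real (length [i, j])" for t
      using that unfolding R_def [symmetric]
      by (cases "t < 1"; simp add: word_motion_Cons gen gen' pair_exchange_def)
         (simp_all add: insert_commute add_ac)
    show "of_nat ` {1..n} = of_nat ` K \<union> (\<lambda>a. pair_exchange i j swing ?s a (real (length [i, j]))) ` {0, 1, 2, 3}"
      unfolding all R_def [symmetric] by (simp add: pair_exchange_def insert_commute add_ac)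
  qed simp
  moreover have "braid_closure n ([j, i] @ v)
      = window_closure n v (real (length [j, i])) K {0, 1, 2, 3} (pair_exchange i j ?s swing)"
  proof (rule braid_closure_window [OF _ v])
    show "word_motion n [j, i] t = of_nat ` K \<union> (\<lambda>a. pair_exchange i j ?s swing a t) ` {0, 1, 2, 3}"
      if "0 \<le> t" "t < real (length [j, i])" for t
      using that unfolding R_def [symmetric]
      by (cases "t < 1"; simp add: word_motion_Cons gen gen' pair_exchange_def)
         (simp_all add: insert_commute add_ac)
    show "of_nat ` {1..n} = of_nat ` K \<union> (\<lambda>a. pair_exchange i j ?s swing a (real (length [j, i]))) ` {0, 1, 2, 3}"
      unfolding all R_def [symmetric] by (simp add: pair_exchange_def insert_commute add_ac)
  qed simp
  moreover have "ambient_isotopic (?W (pair_exchange i j swing ?s)) (?W (pair_exchange i j ?s swing))"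
  proof -
    let ?h = "\<lambda>t. Complex (t / 2) (t * (2 - t))"
    have "ambient_isotopic (?W (pair_exchange i j swing ?s)) (?W (pair_exchange i j ?h ?h))"
      "ambient_isotopic (?W (pair_exchange i j ?s swing)) (?W (pair_exchange i j ?h ?h))"
      unfolding K_def using swing_neq_half
      by (intro pair_exchange_isotopy [OF v ij]; auto intro!: continuous_intros swing_Im simp: swing_Re)+
    then show ?thesis
      using ambient_isotopic_sym ambient_isotopic_trans by blast
  qed
  ultimately show ?thesis
    by simp
qed

text \<open>Equality in the monoid of positive braids.\<close>

inductive braid_word_eq :: "nat list \<Rightarrow> nat list \<Rightarrow> bool" where
  refl: "braid_word_eq w w"
| sym: "braid_word_eq w w' \<Longrightarrow> braid_word_eq w' w"
| trans: "braid_word_eq w w' \<Longrightarrow> braid_word_eq w' w'' \<Longrightarrow> braid_word_eq w w''"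
| commute: "i + 2 \<le> j \<Longrightarrow> braid_word_eq (u @ [i, j] @ v) (u @ [j, i] @ v)"
| braid: "braid_word_eq (u @ [i, i + 1, i] @ v) (u @ [i + 1, i, i + 1] @ v)"

lemma braid_word_eq_set: "braid_word_eq w w' \<Longrightarrow> set w = set w'"
  by (induction rule: braid_word_eq.induct) auto

text \<open>Cyclic rotation brings the place where a relation is applied to the front.\<close>

lemma braid_closure_word_eq:
  assumes "braid_word_eq w w'" "set w \<subseteq> {1..<n}"
  shows "ambient_isotopic (braid_closure n w) (braid_closure n w')"
  using assms
proof (induction rule: braid_word_eq.induct)
  case (refl w)
  show ?case
    by (rule ambient_isotopic_refl)
next
  case (sym w w')
  then show ?case
    using braid_word_eq_set ambient_isotopic_sym by blast
next
  case (trans w w' w'')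
  then show ?case
    using braid_word_eq_set ambient_isotopic_trans by blast
next
  case (commute i j u v)
  have rot: "ambient_isotopic (braid_closure n (u @ x @ v)) (braid_closure n (x @ v @ u))"
    if "set x \<subseteq> {1..<n}" for x
    using braid_closure_rotate [of u "x @ v" n] commute that by auto
  have "ambient_isotopic (braid_closure n ([i, j] @ v @ u)) (braid_closure n ([j, i] @ v @ u))"
    using commute by (intro braid_closure_commute_front) auto
  moreover have "set [i, j] \<subseteq> {1..<n}" "set [j, i] \<subseteq> {1..<n}"
    using commute by auto
  ultimately show ?case
    using rot ambient_isotopic_sym ambient_isotopic_trans by meson
next
  case (braid u i v)
  have rot: "ambient_isotopic (braid_closure n (u @ x @ v)) (braid_closure n (x @ v @ u))"
    if "set x \<subseteq> {1..<n}" for x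
    using braid_closure_rotate [of u "x @ v" n] braid that by auto
  have "ambient_isotopic (braid_closure n ([i, i + 1, i] @ v @ u)) (braid_closure n ([i + 1, i, i + 1] @ v @ u))"
    using braid by (intro braid_closure_braid_relation_front) auto
  moreover have "set [i, i + 1, i] \<subseteq> {1..<n}" "set [i + 1, i, i + 1] \<subseteq> {1..<n}"
    using braid by auto
  ultimately show ?case
    using rot ambient_isotopic_sym ambient_isotopic_trans by meson
qed

section \<open>Pauses in a closed braid word\<close>

lemma swing_Im_pos: "0 < t \<Longrightarrow> t < 1 \<Longrightarrow> 0 < Im (swing t)"
  by (auto simp: swing_def intro!: sin_gt_zero)

text \<open>
  The pause cannot be contracted by a change of time, which is bijective. So the pause and the first
  generator are replaced by the same generator at half speed, whose time is then compressed.
\<close>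

lemma braid_closure_pause:
  assumes v: "set v \<subseteq> {1..<n}"
  shows "ambient_isotopic
    (loop_closure (1 + real (length v)) (\<lambda>t. if t \<le> 1 then of_nat ` {1..n} else word_motion n v (t - 1)))
    (braid_closure n v)"
proof (cases v)
  case Nil
  have "loop_closure 1 (\<lambda>t. if t \<le> 1 then of_nat ` {1..n} else word_motion n v (t - 1)) = braid_closure n v"
    unfolding Nil braid_closure_Nil [OF zero_less_one] by (rule loop_closure_cong) auto
  then show ?thesis
    using ambient_isotopic_refl by (simp add: Nil)
next
  case (Cons i v')
  have i: "1 \<le> i" "i < n" and v': "set v' \<subseteq> {1..<n}"
    using v Cons by auto
  define K where "K = {1..n} - {i, i + 1}"
  define f where "f g a t = (if a = (0::nat) then of_nat i + swing (g t) else of_nat i + 1 - swing (g t))"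
    for g :: "real \<Rightarrow> real" and a t
  have gen: "generator_motion n i t = of_nat ` K \<union> {of_nat i + swing t, of_nat i + 1 - swing t}"
    if "0 \<le> t" "t \<le> 1" for t
    using generator_motion_swing [OF that] by (simp add: K_def)
  have all: "of_nat ` {1..n} = of_nat ` K \<union> {of_nat i, of_nat i + 1 :: complex}"
  proof -
    have "{1..n} = insert i (insert (i + 1) K)"
      using i by (auto simp: K_def)
    then have "of_nat ` {1..n} = insert (of_nat i) (insert (of_nat (i + 1)) (of_nat ` K :: complex set))"
      by (metis image_insert)
    then show ?thesis
      by (simp add: add.commute)
  qed
  have "loop_closure (1 + real (length v)) (\<lambda>t. if t \<le> 1 then of_nat ` {1..n} else word_motion n v (t - 1))
      = window_closure n v' 2 K {0, 1} (f (\<lambda>t. t - 1))"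
  proof -
    have "1 + real (length v) = 2 + real (length v')"
      by (simp add: Cons)
    moreover have "(if t \<le> 1 then of_nat ` {1..n} else word_motion n v (t - 1))
      = (if t \<le> 2 then of_nat ` K else word_motion n v' (t - 2)) \<union>
        (if t \<in> {0..2} then (\<lambda>a. f (\<lambda>t. t - 1) a t) ` {0, 1} else {})"
      if t: "0 \<le> t" for t
    proof -
      consider "t \<le> 1" | "1 < t" "t < 2" | "t = 2" | "2 < t"
        by linarith
      then show ?thesis
      proof cases
        case 1
        then show ?thesis
          using t unfolding all by (simp add: f_def insert_commute)
      next
        case 2
        then show ?thesis
          using t gen [of "t - 1"] by (simp add: Cons word_motion_Cons f_def insert_commute)
      next
        case 3
        then show ?thesis
          using word_motion_0 [OF v'] unfolding all by (simp add: Cons word_motion_Cons f_def insert_commute)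
      next
        case 4
        then show ?thesis
          by (simp add: Cons word_motion_Cons)
      qed
    qed
    ultimately show ?thesis
      unfolding window_closure_def by (auto intro!: loop_closure_cong)
  qed
  moreover have "ambient_isotopic (window_closure n v' 2 K {0, 1} (f (\<lambda>t. t - 1)))
      (window_closure n v' 2 K {0, 1} (f (\<lambda>t. t / 2)))"
  proof (rule window_isotopy [OF _ v'])
    show "continuous_on {0..2} (f (\<lambda>t. t - 1) a)" "continuous_on {0..2} (f (\<lambda>t. t / 2) a)" for a
      unfolding f_def [abs_def] by (cases "a = 0"; auto intro!: continuous_intros)+
    have bd: "real i \<le> Re (f g a t) \<and> Re (f g a t) \<le> real i + 1" for g a t
      using swing_Re [of "g t"] by (auto simp: f_def)
    have "1 \<le> Re (f g a t)" for g a t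
      using bd [of g a t] i by linarith
    then show "1 \<le> Re (f (\<lambda>t. t - 1) a t)" "1 \<le> Re (f (\<lambda>t. t / 2) a t)" for a t
      by auto
    show "real k + 1 \<le> Re (f (\<lambda>t. t - 1) a t) \<and> real k + 1 \<le> Re (f (\<lambda>t. t / 2) a t) \<or>
        Re (f (\<lambda>t. t - 1) a t) + 1 \<le> real k \<and> Re (f (\<lambda>t. t / 2) a t) + 1 \<le> real k" if "k \<in> K" for a t k
    proof -
      have "k + 1 \<le> i \<or> i + 2 \<le> k"
        using that by (auto simp: K_def)
      then have "real k + 1 \<le> real i \<or> real i + 2 \<le> real k"
        by linarith
      then show ?thesis
        using bd [of "\<lambda>t. t - 1" a t] bd [of "\<lambda>t. t / 2" a t] by linarith
    qed
    show "(1 - s) *\<^sub>R (f (\<lambda>t. t - 1) a t - f (\<lambda>t. t - 1) b t)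
        + s *\<^sub>R (f (\<lambda>t. t / 2) a t - f (\<lambda>t. t / 2) b t) \<noteq> 0"
      if "a \<in> {0, 1}" "b \<in> {0, 1}" "a < b" and st: "s \<in> {0..1}" "t \<in> {0..2}" for a b s t
    proof -
      have "f g a t - f g b t = 2 * swing (g t) - 1" for g
        using that by (auto simp: f_def)
      moreover have "(1 - s) *\<^sub>R (2 * swing (t - 1) - 1) + s *\<^sub>R (2 * swing (t / 2) - 1) \<noteq> 0"
        using swing_neq_half [of "t - 1"] swing_Im [of "t - 1"] swing_Im_pos [of "t / 2"] st(2)
        by (intro segment_nonzero [OF st(1)]; cases "t = 0"; cases "t = 2") auto
      ultimately show ?thesis
        by simp
    qed
  qed (auto simp: f_def)
  moreover have "ambient_isotopic (window_closure n v' 2 K {0, 1} (f (\<lambda>t. t / 2))) (braid_closure n v)"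
  proof -
    define \<psi> :: "real \<Rightarrow> real" where "\<psi> t = max (t / 2) (t - 1)" for t
    have "ambient_isotopic (window_closure n v' 2 K {0, 1} (f (\<lambda>t. t / 2)))
      (loop_closure (real (length v)) (word_motion n v))"
      unfolding window_closure_def
    proof (rule loop_reparametrise [where \<psi> = \<psi>])
      show "continuous_on {0..2 + real (length v')} \<psi>"
        unfolding \<psi>_def by (intro continuous_intros) auto
      show "strict_mono_on {0..2 + real (length v')} \<psi>"
        unfolding \<psi>_def max_def by (auto simp: strict_mono_on_def)
      show "(if t \<le> 2 then of_nat ` K else word_motion n v' (t - 2)) \<union>
          (if t \<in> {0..2} then (\<lambda>a. f (\<lambda>t. t / 2) a t) ` {0, 1} else {}) = word_motion n v (\<psi> t)"
        if t: "0 \<le> t" for t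
      proof -
        consider "t < 2" | "t = 2" | "2 < t"
          by linarith
        then show ?thesis
        proof cases
          case 1
          then have "\<psi> t = t / 2"
            by (simp add: \<psi>_def)
          show ?thesis
            unfolding \<open>\<psi> t = t / 2\<close> using t 1 gen [of "t / 2"] by (simp add: Cons word_motion_Cons f_def insert_commute)
        next
          case 2
          then show ?thesis
            using word_motion_0 [OF v'] unfolding all
            by (simp add: Cons word_motion_Cons f_def \<psi>_def insert_commute)
        next
          case 3
          then have "\<psi> t = t - 1"
            by (simp add: \<psi>_def)
          then show ?thesis
            using 3 by (simp add: Cons word_motion_Cons)
        qed
      qed
      then show "0 \<le> Re z" if "t \<in> {0..<2 + real (length v')}"
          "z \<in> (if t \<le> 2 then of_nat ` K else word_motion n v' (t - 2)) \<union>
          (if t \<in> {0..2} then (\<lambda>a. f (\<lambda>t. t / 2) a t) ` {0, 1} else {})" for t z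
        using that word_motion_Re [of z n v "\<psi> t", OF _ v] by (auto simp: \<psi>_def le_max_iff_disj)
    qed (auto simp: \<psi>_def Cons)
    then show ?thesis
      by (subst braid_closure_eq_loop_closure) (auto simp: Cons)
  qed
  ultimately show ?thesis
    by (simp only:) (rule ambient_isotopic_trans)
qed

section \<open>Moving a strand that is transverse to the horizontal planes\<close>

definition level_point :: "complex \<Rightarrow> real \<Rightarrow> real ^ 3" where
  "level_point p z = vector [Re p, Im p, z]"

lemma level_point_nth [simp]:
  "level_point p z $ 1 = Re p" "level_point p z $ 2 = Im p" "level_point p z $ 3 = z"
  by (simp_all add: level_point_def)

definition plane_part :: "real ^ 3 \<Rightarrow> complex" where
  "plane_part x = Complex (x $ 1) (x $ 2)"

lemma plane_part_level_point [simp]: "plane_part (level_point p z) = p"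
  by (simp add: plane_part_def)

lemma level_point_plane_part [simp]: "level_point (plane_part x) (x $ 3) = x"
  by (simp add: plane_part_def vec3_eq_iff)

lemma page_point_eq_level_point: "page_point t z = level_point (of_real (Re z) * cis (2 * pi * t)) (Im z)"
  by (simp add: vec3_eq_iff)

lemma norm_plane_part_page_point: "norm (plane_part (page_point t z)) = \<bar>Re z\<bar>"
  by (simp add: page_point_eq_level_point norm_mult)

text \<open>
  In every horizontal plane, the centre of the disc of radius \<open>R\<close> is dragged to \<open>q z\<close> and the disc is
  stretched linearly along its radii.
\<close>

definition cone_map :: "real \<Rightarrow> (real \<Rightarrow> complex) \<Rightarrow> real ^ 3 \<Rightarrow> real ^ 3" where
  "cone_map R q x =
     level_point (plane_part x + of_real (max 0 (1 - norm (plane_part x) / R)) * q (x $ 3)) (x $ 3)"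

lemma cone_map_bij:
  assumes R: "R > 0" and q: "\<And>z. norm (q z) < R"
  shows "bij (cone_map R q)"
proof -
  define g where "g z p = of_real (max 0 (1 - norm p / R)) * q z" for z and p :: complex
  have bij: "bij (\<lambda>p. p + g z p)" for z :: real
  proof (rule bij_add_contraction [where c = "norm (q z) / R"])
    fix p p' :: complex
    have "\<bar>max 0 (1 - norm p / R) - max 0 (1 - norm p' / R)\<bar> \<le> \<bar>norm p / R - norm p' / R\<bar>"
      by linarith
    also have "\<dots> = \<bar>norm p - norm p'\<bar> / R"
      using R by (simp add: diff_divide_distrib [symmetric] abs_divide)
    also have "\<dots> \<le> norm (p - p') / R"
      using R by (intro divide_right_mono norm_triangle_ineq3) auto
    finally have *: "\<bar>max 0 (1 - norm p / R) - max 0 (1 - norm p' / R)\<bar> \<le> norm (p - p') / R" .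
    have "norm (g z p - g z p') = norm (of_real (max 0 (1 - norm p / R) - max 0 (1 - norm p' / R)) * q z)"
      by (simp add: g_def algebra_simps)
    also have "\<dots> = \<bar>max 0 (1 - norm p / R) - max 0 (1 - norm p' / R)\<bar> * norm (q z)"
      by (simp only: norm_mult norm_of_real)
    also have "\<dots> \<le> norm (p - p') / R * norm (q z)"
      using * by (rule mult_right_mono) auto
    finally show "norm (g z p - g z p') \<le> norm (q z) / R * norm (p - p')"
      by (simp add: mult.commute)
  qed (use R q in auto)
  have eq: "cone_map R q x = level_point (plane_part x + g (x $ 3) (plane_part x)) (x $ 3)" for x
    by (simp add: cone_map_def g_def)
  show ?thesis
  proof (rule bijI)
    show "inj (cone_map R q)"
    proof (rule injI)
      fix x y assume xy: "cone_map R q x = cone_map R q y"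
      then have "x $ 3 = y $ 3"
        by (metis eq level_point_nth(3))
      moreover have "plane_part x + g (x $ 3) (plane_part x) = plane_part y + g (y $ 3) (plane_part y)"
        using xy by (metis eq plane_part_level_point)
      ultimately have "plane_part x = plane_part y"
        using injD [OF bij_is_inj [OF bij [of "x $ 3"]], of "plane_part x" "plane_part y"] by simp
      then show "x = y"
        using \<open>x $ 3 = y $ 3\<close> by (metis level_point_plane_part)
    qed
    show "surj (cone_map R q)"
    proof (rule surjI)
      fix x :: "real ^ 3"
      show "cone_map R q (level_point (inv (\<lambda>p. p + g (x $ 3) p) (plane_part x)) (x $ 3)) = x"
        using surj_f_inv_f [OF bij_is_surj [OF bij [of "x $ 3"]], of "plane_part x"]
        by (simp add: eq)
    qed
  qed
qed

lemma cone_map_isotopy: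
  assumes R: "R > 0" and q: "\<And>z. norm (q z) < R" and cont: "continuous_on UNIV q"
  shows "ambient_isotopic L (cone_map R q ` L)"
proof -
  have "ambient_isotopic L (cone_map R (\<lambda>z. of_real 1 * q z) ` L)"
  proof (rule ambient_isotopicI [where H = "\<lambda>s. cone_map R (\<lambda>z. of_real s * q z)"])
    have 1: "continuous_on ({0..1::real} \<times> (UNIV :: (real ^ 3) set)) (\<lambda>x. plane_part (snd x))"
      unfolding plane_part_def Complex_eq by (intro continuous_intros)
    have 2: "continuous_on ({0..1::real} \<times> (UNIV :: (real ^ 3) set)) (\<lambda>x. q (snd x $ 3))"
      by (intro continuous_on_compose2 [OF cont] continuous_intros) auto
    define G where "G x = plane_part (snd x) +
      of_real (max 0 (1 - norm (plane_part (snd x)) / R)) * (of_real (fst x) * q (snd x $ 3))"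
      for x :: "real \<times> (real ^ 3)"
    have G: "continuous_on ({0..1} \<times> UNIV) G"
      unfolding G_def by (intro continuous_intros 1 2) (use R in auto)
    have "continuous_on ({0..1} \<times> UNIV) (\<lambda>x. page_point 0 (Complex (Re (G x)) 0)
        + page_point (1/4) (Complex (Im (G x)) (snd x $ 3)))"
      unfolding Complex_eq by (intro continuous_intros G)
    moreover have "level_point p z = page_point 0 (Complex (Re p) 0) + page_point (1/4) (Complex (Im p) z)" for p z
      by (simp add: vec3_eq_iff)
    ultimately have "continuous_on ({0..1} \<times> UNIV) (\<lambda>x. level_point (G x) (snd x $ 3))"
      by simp
    then show "continuous_on ({0..1} \<times> UNIV) (\<lambda>(s, x). cone_map R (\<lambda>z. of_real s * q z) x)"
      by (simp add: cone_map_def G_def split_def)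
    show "bij (cone_map R (\<lambda>z. of_real s * q z))" if "s \<in> {0..1}" for s
    proof (rule cone_map_bij [OF R])
      fix z
      have "norm (of_real s * q z) \<le> norm (q z)"
        using that by (auto simp: norm_mult intro!: mult_left_le_one_le)
      then show "norm (of_real s * q z) < R"
        using q [of z] by linarith
    qed
    show "cone_map R (\<lambda>z. of_real 0 * q z) x = x" for x
      by (simp add: cone_map_def)
  qed
  then show ?thesis
    by simp
qed

text \<open>
  Both strands \<open>q\<close> and \<open>q'\<close> are images of the same vertical segment, so one can be replaced by the
  other if the rest of the link avoids the region in which the disc is distorted differently.
\<close>

lemma vertical_strand_isotopy:
  fixes q q' :: "real \<Rightarrow> complex"
  assumes R: "R > 0" and q: "\<And>z. norm (q z) < R" "\<And>z. norm (q' z) < R"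
    and cont: "continuous_on UNIV q" "continuous_on UNIV q'"
    and ends: "\<And>z. 1 \<le> \<bar>z\<bar> \<Longrightarrow> q' z = q z"
    and L: "\<And>x. x \<in> L \<Longrightarrow> 1 \<le> \<bar>x $ 3\<bar> \<or> R \<le> norm (plane_part x)"
  shows "ambient_isotopic (L \<union> (\<lambda>z. level_point (q z) z) ` Z) (L \<union> (\<lambda>z. level_point (q' z) z) ` Z)"
proof -
  define \<Psi> where "\<Psi> x = cone_map R q' (inv (cone_map R q) x)" for x
  have b: "bij (cone_map R q)"
    by (rule cone_map_bij [OF R q(1)])
  have inv: "inv (cone_map R q) (cone_map R q x) = x" "cone_map R q (inv (cone_map R q) x) = x" for x
    using b by (simp_all add: bij_is_inj bij_is_surj surj_f_inv_f)
  have \<Psi>: "ambient_isotopic M (\<Psi> ` M)" for M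
  proof -
    have "ambient_isotopic (inv (cone_map R q) ` M) (cone_map R q ` inv (cone_map R q) ` M)"
      "ambient_isotopic (inv (cone_map R q) ` M) (cone_map R q' ` inv (cone_map R q) ` M)"
      by (intro cone_map_isotopy R q cont)+
    moreover have "cone_map R q ` inv (cone_map R q) ` M = M"
      by (simp add: image_image inv)
    moreover have "cone_map R q' ` inv (cone_map R q) ` M = \<Psi> ` M"
      by (simp add: image_image \<Psi>_def)
    ultimately show ?thesis
      using ambient_isotopic_sym ambient_isotopic_trans by metis
  qed
  have "\<Psi> x = x" if "x \<in> L" for x
  proof (cases "1 \<le> \<bar>x $ 3\<bar>")
    case True
    define y where "y = inv (cone_map R q) x"
    have y: "cone_map R q y = x"
      by (simp add: y_def inv)
    then have "y $ 3 = x $ 3"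
      by (auto simp: cone_map_def)
    then have "cone_map R q' y = cone_map R q y"
      using ends True by (simp add: cone_map_def)
    then show ?thesis
      using y by (simp add: \<Psi>_def y_def)
  next
    case False
    then have "1 - norm (plane_part x) / R \<le> 0"
      using L [OF that] R by simp
    then have "cone_map R q x = x" "cone_map R q' x = x"
      by (simp_all add: cone_map_def max_absorb1)
    then show ?thesis
      using inv(1) [of x] by (simp add: \<Psi>_def)
  qed
  moreover have "\<Psi> (level_point (q z) z) = level_point (q' z) z" for z
  proof -
    have "cone_map R q (level_point 0 z) = level_point (q z) z"
      "cone_map R q' (level_point 0 z) = level_point (q' z) z"
      by (simp_all add: cone_map_def)
    then show ?thesis
      using inv(1) [of "level_point 0 z"] by (simp add: \<Psi>_def)
  qed
  ultimately have "\<Psi> ` (L \<union> (\<lambda>z. level_point (q z) z) ` Z) = L \<union> (\<lambda>z. level_point (q' z) z) ` Z"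
    by (simp add: image_Un image_image)
  then show ?thesis
    using \<Psi> by metis
qed

section \<open>Removing a kink around the axis\<close>

definition ramp :: "real \<Rightarrow> real" where
  "ramp x = max 0 (min 1 x)"

lemma continuous_on_ramp [continuous_intros]:
  assumes "continuous_on S f"
  shows "continuous_on S (\<lambda>x. ramp (f x))"
  unfolding ramp_def by (intro continuous_intros assms)

lemma ramp_bounds: "0 \<le> ramp x" "ramp x \<le> 1"
  by (simp_all add: ramp_def)

text \<open>
  In the closure of \<open>1 # map Suc v\<close> a single strand comes to the position 1. It arrives there from 2 in
  the first letter, runs around the axis once, and returns to 2 during the same letter, crossing itself.
  This kink is spread out in height. On \<open>under_leg\<close> the strand sinks from height 0 to \<open>- 1\<close> at position 2
  (until \<open>t = 1 / 6\<close>), moves inwards to position 1 (until \<open>t = 1 / 3\<close>) and climbs. Having encircled the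
  axis it continues on \<open>over_leg\<close>, where it climbs from height 0 to 1 (until \<open>t = 1 / 2\<close>), moves outwards
  (until \<open>t = 2 / 3\<close>) and sinks to height 0. As \<open>1 / 3 < 1 / 2\<close>, the turn around the axis can be replaced
  by climbing from height \<open>- 1\<close> to 1 within the interval between these times: this is \<open>direct_leg\<close>.
\<close>

definition over_leg :: "real \<Rightarrow> complex" where
  "over_leg t = Complex (1 + ramp (6 * t - 3)) (ramp (2 * t) - ramp (3 * t - 2))"

definition under_leg :: "real \<Rightarrow> complex" where
  "under_leg t = Complex (2 - ramp (6 * t - 1)) (ramp ((3 * t - 1) / 2) - ramp (6 * t))"

definition direct_leg :: "real \<Rightarrow> complex" where
  "direct_leg t = Complex (2 - ramp (6 * t - 1) + ramp (6 * t - 3))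
     (2 * ramp (6 * t - 2) - ramp (6 * t) - ramp (3 * t - 2))"

lemma continuous_on_legs:
  "continuous_on S over_leg" "continuous_on S under_leg" "continuous_on S direct_leg"
  unfolding over_leg_def [abs_def] under_leg_def [abs_def] direct_leg_def [abs_def] Complex_eq
  by (intro continuous_intros; simp)+

lemma of_nat_image_Suc: "of_nat ` Suc ` S = (\<lambda>z. z + 1) ` (of_nat ` S :: complex set)"
  by (simp add: image_image add.commute)

lemma generator_motion_Suc:
  assumes i: "1 \<le> i" and t: "0 \<le> t" "t \<le> 1"
  shows "generator_motion (n + 1) (Suc i) t = insert 1 ((\<lambda>z. z + 1) ` generator_motion n i t)"
proof -
  have "{1..n + 1} - {Suc i, Suc i + 1} = insert 1 (Suc ` ({1..n} - {i, i + 1}))" (is "?L = ?R")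
  proof (intro equalityI subsetI)
    fix k assume k: "k \<in> ?L"
    show "k \<in> ?R"
    proof (cases "k = 1")
      case False
      then have "k = Suc (k - 1)" "k - 1 \<in> {1..n} - {i, i + 1}"
        using k by auto
      then show ?thesis
        by blast
    qed simp
  qed (use i in auto)
  then have "of_nat ` ({1..n + 1} - {Suc i, Suc i + 1})
      = insert (1 :: complex) ((\<lambda>z. z + 1) ` of_nat ` ({1..n} - {i, i + 1}))"
    by (simp only: image_insert of_nat_image_Suc of_nat_1)
  then show ?thesis
    unfolding generator_motion_swing [OF t] by (simp add: image_Un insert_commute algebra_simps)
qed

lemma word_motion_map_Suc:
  assumes v: "set v \<subseteq> {1..<n}" and t: "0 \<le> t"
  shows "word_motion (n + 1) (map Suc v) t = insert 1 ((\<lambda>z. z + 1) ` word_motion n v t)"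
proof (cases "t < real (length v)")
  case True
  then have *: "nat \<lfloor>t\<rfloor> < length v"
    using t by linarith
  then have "v ! nat \<lfloor>t\<rfloor> \<in> {1..<n}"
    using v nth_mem by blast
  then show ?thesis
    using True * generator_motion_Suc [of "v ! nat \<lfloor>t\<rfloor>" "frac t" n] frac_lt_1 [of t]
    by (simp add: word_motion_def less_imp_le)
next
  case False
  have "{1..n + 1} = insert 1 (Suc ` {1..n})"
    by (auto simp: image_Suc_atLeastAtMost)
  then have "of_nat ` {1..n + 1} = insert (1 :: complex) ((\<lambda>z. z + 1) ` of_nat ` {1..n})"
    by (simp only: image_insert of_nat_image_Suc of_nat_1)
  then show ?thesis
    using False by (simp add: word_motion_def)
qed

context
  fixes n :: nat and v :: "nat list"
  assumes n: "1 \<le> n" and v: "set v \<subseteq> {1..<n}"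
begin

private definition m :: real where "m = 1 + real (length v)"

private definition rest :: "complex set" where "rest = of_nat ` {3..n + 1}"

text \<open>All of the link except the strand with the kink, as long as this strand is near the axis.\<close>

private definition outer :: "real \<Rightarrow> complex set" where
  "outer t = (if t \<le> 1 then rest else (\<lambda>z. z + 1) ` word_motion n v (t - 1))"

private lemma m: "1 \<le> m"
  by (simp add: m_def)

private lemma rest_Re: "z \<in> rest \<Longrightarrow> 3 \<le> Re z"
  by (auto simp: rest_def)

private lemma outer_Re: "z \<in> outer t \<Longrightarrow> 2 \<le> Re z"
  using word_motion_Re [OF _ v, of _ "t - 1"] by (force simp: outer_def rest_def split: if_splits)

private lemma shift_start: "(\<lambda>z. z + 1) ` word_motion n v 0 = insert 2 rest"
proof -
  have "Suc ` {1..n} = insert 2 {3..n + 1}"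
    using n by (auto simp: image_Suc_atLeastAtMost)
  then have "(\<lambda>z. z + 1) ` of_nat ` {1..n} = insert (2 :: complex) (of_nat ` {3..n + 1})"
    unfolding of_nat_image_Suc [symmetric] by (metis image_insert of_nat_numeral)
  then show ?thesis
    by (simp only: word_motion_0 [OF v] rest_def)
qed

text \<open>
  During the first letter the outgoing passage of the strand never lies below the incoming one, neither
  before the isotopy nor after it, so they do not meet.
\<close>

private lemma kink_spread:
  "ambient_isotopic (braid_closure (n + 1) (1 # map Suc v))
    (loop_closure m (\<lambda>t. outer t \<union> (if t \<le> 1 then {over_leg t, under_leg t} else {1})))"
proof -
  define p where "p a t = (if a = (0::nat) then 1 + swing t else 2 - swing t)" for a t
  define q where "q a t = (if a = (0::nat) then over_leg t else under_leg t)" for a t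
  define F where "F t = (if t \<le> 1 then rest else insert 1 (outer t))" for t
  have "braid_closure (n + 1) (1 # map Suc v) = loop_closure m (word_motion (n + 1) (1 # map Suc v))"
    by (simp add: braid_closure_eq_loop_closure m_def add.commute)
  also have "\<dots> = loop_closure m (\<lambda>t. F t \<union> (if t \<in> {0..1} then (\<lambda>a. p a t) ` {0, 1} else {}))"
  proof (rule loop_closure_cong)
    fix t :: real assume t: "0 \<le> t"
    consider "t < 1" | "t = 1" | "1 < t"
      by linarith
    then show "word_motion (n + 1) (1 # map Suc v) t = F t \<union> (if t \<in> {0..1} then (\<lambda>a. p a t) ` {0, 1} else {})"
    proof cases
      case 1
      have "{1..n + 1} - {1, 1 + 1} = {3..n + 1}"
        by auto
      then show ?thesis
        using 1 t unfolding word_motion_Cons [OF t]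
        by (simp add: generator_motion_swing F_def p_def rest_def insert_commute)
    next
      case 2
      then show ?thesis
        using word_motion_map_Suc [OF v, of 0] shift_start
        by (simp add: word_motion_Cons F_def p_def)
    next
      case 3
      then show ?thesis
        using word_motion_map_Suc [OF v, of "t - 1"] by (simp add: word_motion_Cons F_def outer_def)
    qed
  qed
  also have "ambient_isotopic \<dots> (loop_closure m (\<lambda>t. F t \<union> (if t \<in> {0..1} then (\<lambda>a. q a t) ` {0, 1} else {})))"
  proof (rule straight_isotopy [where \<rho>\<^sub>0 = 1])
    show "continuous_on {0..1} (p a)" "continuous_on {0..1} (q a)" for a
      unfolding p_def [abs_def] q_def [abs_def]
      by (cases "a = 0"; auto intro!: continuous_intros continuous_on_legs)+
    show "q a 0 = p a 0" "q a 1 = p a 1" for a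
      by (auto simp: p_def q_def over_leg_def under_leg_def ramp_def complex_eq_iff)
    have Re: "1 \<le> Re (p a t) \<and> Re (p a t) \<le> 2 \<and> 1 \<le> Re (q a t) \<and> Re (q a t) \<le> 2" for a t
      using swing_Re [of t] by (auto simp: p_def q_def over_leg_def under_leg_def ramp_def)
    then show "1 \<le> Re (p a t)" "1 \<le> Re (q a t)" for a t
      by auto
    have *: "(1 - s) *\<^sub>R (p 0 t - p 1 t) + s *\<^sub>R (q 0 t - q 1 t) \<noteq> 0"
      if st: "s \<in> {0..1}" "t \<in> {0..1}" for s t
    proof (rule segment_nonzero [OF st(1)])
      have p: "p 0 t - p 1 t = 2 * swing t - 1"
        by (simp add: p_def)
      then show "p 0 t - p 1 t \<noteq> 0"
        using swing_neq_half [of t] by simp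
      have "0 < Im (q 0 t - q 1 t)" if "0 < t" "t < 1"
      proof (cases "t \<le> 1 / 3")
        case True
        then show ?thesis
          using that by (simp add: q_def over_leg_def under_leg_def ramp_def)
      next
        case False
        then have "ramp (6 * t) = 1" "ramp ((3 * t - 1) / 2) < 1"
          using that by (simp_all add: ramp_def)
        moreover have "ramp (3 * t - 2) \<le> ramp (2 * t)"
          using that unfolding ramp_def by linarith
        ultimately show ?thesis
          by (simp add: q_def over_leg_def under_leg_def)
      qed
      moreover have "t = 0 \<or> t = 1 \<or> 0 < t \<and> t < 1"
        using st by auto
      ultimately consider "t = 0" | "t = 1" | "0 < Im (q 0 t - q 1 t)"
        by blast
      then show "0 \<le> Im (p 0 t - p 1 t) \<and> 0 < Im (q 0 t - q 1 t) \<or>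
          0 < Re (p 0 t - p 1 t) \<and> 0 < Re (q 0 t - q 1 t) \<or>
          Re (p 0 t - p 1 t) < 0 \<and> Re (q 0 t - q 1 t) < 0"
      proof cases
        case 3
        then show ?thesis
          using swing_Im [of t] unfolding p by simp
      qed (simp_all add: p_def q_def over_leg_def under_leg_def ramp_def)
    qed
    show "(1 - s) *\<^sub>R p a t + s *\<^sub>R q a t \<noteq> (1 - s) *\<^sub>R p b t + s *\<^sub>R q b t"
      if "a \<in> {0, 1}" "b \<in> {0, 1}" "a \<noteq> b" "s \<in> {0..1}" "t \<in> {0..1}" for a b s t
    proof -
      have "(1 - s) *\<^sub>R p 0 t + s *\<^sub>R q 0 t \<noteq> (1 - s) *\<^sub>R p 1 t + s *\<^sub>R q 1 t"
        using * [OF that(4,5)] by (simp add: algebra_simps)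
      then show ?thesis
        using that(1-3) by auto
    qed
    show "1 \<le> norm (f - ((1 - s) *\<^sub>R p a t + s *\<^sub>R q a t))"
      if "s \<in> {0..1}" "t \<in> {0..1}" "f \<in> F t" for a f s t
    proof -
      have "(1 - s) * Re (p a t) + s * Re (q a t) \<le> (1 - s) * 2 + s * 2"
        using that(1) Re by (intro add_mono mult_left_mono) auto
      moreover have "3 \<le> Re f"
        using that rest_Re by (simp add: F_def)
      ultimately have "1 \<le> Re (f - ((1 - s) *\<^sub>R p a t + s *\<^sub>R q a t))"
        by simp
      then show ?thesis
        using complex_Re_le_cmod order_trans by blast
    qed
    show "0 \<le> Re f" if "f \<in> F t" for t f
      using that rest_Re outer_Re by (force simp: F_def split: if_splits)
  qed (use m in auto)
  also have "loop_closure m (\<lambda>t. F t \<union> (if t \<in> {0..1} then (\<lambda>a. q a t) ` {0, 1} else {}))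
      = loop_closure m (\<lambda>t. outer t \<union> (if t \<le> 1 then {over_leg t, under_leg t} else {1}))"
    by (rule loop_closure_cong) (auto simp: F_def q_def outer_def)
  finally show ?thesis .
qed

text \<open>The incoming passage, rising at constant speed all the way around the axis.\<close>

private definition climb :: "real \<Rightarrow> complex" where
  "climb t = (if t < 1 / 3 then under_leg t else Complex 1 ((t - 1 / 3) / (m - 1 / 3) - 1))"

private lemma kink_helix:
  "ambient_isotopic
    (loop_closure m (\<lambda>t. outer t \<union> (if t \<le> 1 then {over_leg t, under_leg t} else {1})))
    (loop_closure m (\<lambda>t. outer t \<union> (if t \<le> 1 then {over_leg t} else {}) \<union> {climb t}))"
proof -
  define p where "p t = Complex 1 (min 1 ((3 * t - 1) / 2) - 1)" for t :: real
  define q where "q t = Complex 1 ((t - 1 / 3) / (m - 1 / 3) - 1)" for t :: real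
  define F where "F t = outer t \<union> (if t \<le> 1 then {over_leg t} else {}) \<union> (if t < 1 / 3 then {under_leg t} else {})"
    for t
  have "loop_closure m (\<lambda>t. outer t \<union> (if t \<le> 1 then {over_leg t, under_leg t} else {1}))
      = loop_closure m (\<lambda>t. F t \<union> (if t \<in> {1 / 3..m} then (\<lambda>a. p t) ` {()} else {}))"
  proof (rule loop_closure_cong)
    fix t assume t: "t < m"
    have "under_leg t = p t" if "1 / 3 \<le> t" "t \<le> 1"
      using that by (auto simp: under_leg_def p_def ramp_def complex_eq_iff)
    moreover have "p t = 1" if "1 < t"
      using that by (auto simp: p_def complex_eq_iff)
    ultimately show "outer t \<union> (if t \<le> 1 then {over_leg t, under_leg t} else {1})
        = F t \<union> (if t \<in> {1 / 3..m} then (\<lambda>a. p t) ` {()} else {})"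
      using t by (auto simp: F_def)
  qed
  also have "ambient_isotopic \<dots> (loop_closure m (\<lambda>t. F t \<union> (if t \<in> {1 / 3..m} then (\<lambda>a. q t) ` {()} else {})))"
    (* From t = 1 / 3 on, the height of over_leg is at least 2 / 3 until it has moved out to 2. *)
  proof (rule straight_isotopy [where \<rho>\<^sub>0 = "2 / 3"])
    show "continuous_on {1 / 3..m} p"
      unfolding p_def [abs_def] Complex_eq by (intro continuous_intros) auto
    show "continuous_on {1 / 3..m} q"
      unfolding q_def [abs_def] Complex_eq by (intro continuous_intros) (use m in auto)
    show "q (1 / 3) = p (1 / 3)" "q m = p m"
      using m by (auto simp: p_def q_def)
    show "2 / 3 \<le> norm (f - ((1 - s) *\<^sub>R p t + s *\<^sub>R q t))"
      if s: "s \<in> {0..1}" and t: "t \<in> {1 / 3..m}" and f: "f \<in> F t" for f s t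
    proof -
      define z where "z = (1 - s) *\<^sub>R p t + s *\<^sub>R q t"
      have "Re z = 1"
        by (simp add: z_def p_def q_def)
      have "Im (q t) \<le> 0" "Im (p t) \<le> 0"
        using t m by (auto simp: p_def q_def)
      then have "Im z \<le> 0"
        using s by (auto simp: z_def intro!: add_nonpos_nonpos mult_nonneg_nonpos)
      have "2 \<le> Re f \<or> 2 / 3 \<le> Im f"
      proof -
        have "f \<in> outer t \<or> f = over_leg t"
          using f t by (auto simp: F_def split: if_splits)
        then show ?thesis
          using outer_Re t by (auto simp: over_leg_def ramp_def)
      qed
      then have "2 / 3 \<le> Re (f - z) \<or> 2 / 3 \<le> Im (f - z)"
        using \<open>Re z = 1\<close> \<open>Im z \<le> 0\<close> by auto
      then show ?thesis
        using complex_Re_le_cmod [of "f - z"] abs_Im_le_cmod [of "f - z"] by (auto simp: z_def)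
    qed
    show "0 \<le> Re f" if "f \<in> F t" for t f
    proof -
      have "f \<in> outer t \<or> f = over_leg t \<or> f = under_leg t"
        using that by (auto simp: F_def split: if_splits)
      then show ?thesis
        using outer_Re [of f t] ramp_bounds [of "6 * t - 3"] ramp_bounds [of "6 * t - 1"]
        by (auto simp: over_leg_def under_leg_def)
    qed
  qed (use m in \<open>auto simp: p_def q_def\<close>)
  also have "loop_closure m (\<lambda>t. F t \<union> (if t \<in> {1 / 3..m} then (\<lambda>a. q t) ` {()} else {}))
      = loop_closure m (\<lambda>t. outer t \<union> (if t \<le> 1 then {over_leg t} else {}) \<union> {climb t})"
    by (rule loop_closure_cong) (auto simp: F_def climb_def q_def)
  finally show ?thesis .
qed

text \<open>
  The helix meets each horizontal plane between the heights \<open>- 1\<close> and 1 once, at distance 1 from the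
  axis, and nothing else there is closer than 3/2. So its points may move freely inside these discs,
  and the turn around the axis can be undone across the axis.
\<close>

private lemma kink_unwind:
  "ambient_isotopic
    (loop_closure m (\<lambda>t. outer t \<union> (if t \<le> 1 then {over_leg t} else {}) \<union> {climb t}))
    (loop_closure m (\<lambda>t. outer t \<union> (if t \<le> 1 then {direct_leg t} else {})))"
proof -
  define P where "P t = outer t \<union> (if 1 / 2 \<le> t \<and> t \<le> 1 then {over_leg t} else {}) \<union>
      (if t < 1 / 3 then {under_leg t} else {})" for t
  define L where "L = loop_closure m P"
  (* The times at which the helix and its replacement reach the height z; the helix is counted through
     its second passage, so its times exceed m for positive z. *)
  define T where "T z = 1 / 3 + (min z 0 + 1) * (m - 1 / 3) + max z 0 / 2" for z
  define T' where "T' z = (5 + z) / 12" for z :: real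
  define c where "c z = max (- 1) (min 1 z)" for z :: real
  define q where "q z = cis (2 * pi * (T (c z) / m))" for z
  define q' where "q' z = cis (2 * pi * (T' (c z) / m))" for z
  define H where "H t = (if t < 1 / 2 then {over_leg t} else {}) \<union> (if 1 / 3 \<le> t then {climb t} else {})" for t
  define H' where "H' t = (if 1 / 3 \<le> t \<and> t < 1 / 2 then {direct_leg t} else {})" for t
  have Un: "loop_closure m (\<lambda>t. X t \<union> Y t) = loop_closure m X \<union> loop_closure m Y" for X Y
    by (auto simp: loop_closure_def)
  have lp: "level_point (cis (2 * pi * (t / m))) z = page_point (t / m) (Complex 1 z)" for t z
    by (simp add: page_point_eq_level_point)
  have full_turn: "cis (2 * pi * ((m + t) / m)) = cis (2 * pi * (t / m))" for t
  proof -
    have "2 * pi * ((m + t) / m) = 2 * pi * (t / m) + 2 * pi"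
      using m by (simp add: field_simps)
    then show ?thesis
      by (simp add: complex_eq_iff)
  qed
  have over: "over_leg t = Complex 1 (2 * t)" if "0 \<le> t" "t \<le> 1 / 2" for t
    using that by (simp add: over_leg_def ramp_def)
  have climb: "climb t = Complex 1 ((t - 1 / 3) / (m - 1 / 3) - 1)" if "1 / 3 \<le> t" for t
    using that by (simp add: climb_def)
  have direct: "direct_leg t = Complex 1 (12 * (t - 1 / 3) - 1)" if "1 / 3 \<le> t" "t \<le> 1 / 2" for t
    using that by (simp add: direct_leg_def ramp_def)
  have helix: "(\<lambda>z. level_point (q z) z) ` {- 1..<1} = loop_closure m H"
  proof (intro equalityI subsetI)
    fix x assume "x \<in> (\<lambda>z. level_point (q z) z) ` {- 1..<1}"
    then obtain z where z: "- 1 \<le> z" "z < 1" "x = level_point (cis (2 * pi * (T z / m))) z"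
      by (auto simp: q_def c_def)
    show "x \<in> loop_closure m H"
    proof (cases "z < 0")
      case True
      define t where "t = 1 / 3 + (z + 1) * (m - 1 / 3)"
      have "T z = t"
        using True by (simp add: T_def t_def)
      have "(z + 1) * (m - 1 / 3) < 1 * (m - 1 / 3)" "0 \<le> (z + 1) * (m - 1 / 3)"
        using True z m by (intro mult_strict_right_mono mult_nonneg_nonneg; simp)+
      then have t: "1 / 3 \<le> t" "t < m"
        by (simp_all add: t_def)
      have "climb t = Complex 1 z"
        using m unfolding climb [OF t(1)] by (simp add: t_def)
      then have "x = page_point (t / m) (climb t)" "climb t \<in> H t"
        using z lp t \<open>T z = t\<close> by (auto simp: H_def)
      then show ?thesis
        using t by (auto simp: loop_closure_def intro!: bexI [of _ t])
    next
      case False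
      then have "T z = m + z / 2"
        by (simp add: T_def)
      moreover have "over_leg (z / 2) = Complex 1 z"
        using over [of "z / 2"] False z by simp
      ultimately have "x = page_point (z / 2 / m) (over_leg (z / 2))" "over_leg (z / 2) \<in> H (z / 2)"
        using z lp [of "z / 2" z] full_turn [of "z / 2"] by (auto simp: H_def)
      then show ?thesis
        unfolding loop_closure_def using False z m by (intro UN_I [of "z / 2"] image_eqI) auto
    qed
  next
    fix x assume "x \<in> loop_closure m H"
    then obtain t \<zeta> where t: "0 \<le> t" "t < m" and x: "x = page_point (t / m) \<zeta>" and "\<zeta> \<in> H t"
      by (auto simp: loop_closure_def)
    then consider "t < 1 / 2" "\<zeta> = over_leg t" | "1 / 3 \<le> t" "\<zeta> = climb t"
      by (auto simp: H_def split: if_splits)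
    then show "x \<in> (\<lambda>z. level_point (q z) z) ` {- 1..<1}"
    proof cases
      case 1
      then have "x = level_point (cis (2 * pi * (t / m))) (2 * t)"
        using over [of t] t lp x by simp
      also have "\<dots> = level_point (q (2 * t)) (2 * t)"
        using t 1 full_turn [of t] by (simp add: q_def c_def T_def)
      finally show ?thesis
        using t 1 by auto
    next
      case 2
      define z where "z = (t - 1 / 3) / (m - 1 / 3) - 1"
      have z: "- 1 \<le> z" "z < 0"
        using t 2 m by (auto simp: z_def field_simps)
      have "T z = t"
        using z m by (simp add: T_def z_def)
      then have "x = level_point (q z) z"
        using z 2 climb [of t] lp x by (simp add: q_def c_def z_def [symmetric])
      then show ?thesis
        using z by auto
    qed
  qed
  have straight: "(\<lambda>z. level_point (q' z) z) ` {- 1..<1} = loop_closure m H'"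
  proof (intro equalityI subsetI)
    fix x assume "x \<in> (\<lambda>z. level_point (q' z) z) ` {- 1..<1}"
    then obtain z where z: "- 1 \<le> z" "z < 1" "x = level_point (cis (2 * pi * (T' z / m))) z"
      by (auto simp: q'_def c_def)
    then have t: "1 / 3 \<le> T' z" "T' z < 1 / 2"
      by (simp_all add: T'_def)
    have "12 * (T' z - 1 / 3) - 1 = z"
      by (simp add: T'_def field_simps)
    then have "direct_leg (T' z) = Complex 1 z"
      using direct [of "T' z"] t by simp
    then have "x = page_point (T' z / m) (direct_leg (T' z))" "direct_leg (T' z) \<in> H' (T' z)"
      using z lp t by (auto simp: H'_def)
    then show "x \<in> loop_closure m H'"
      unfolding loop_closure_def using t m by (intro UN_I [of "T' z"] image_eqI) auto
  next
    fix x assume "x \<in> loop_closure m H'"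
    then obtain t where t: "1 / 3 \<le> t" "t < 1 / 2" and x: "x = page_point (t / m) (direct_leg t)"
      by (auto simp: loop_closure_def H'_def split: if_splits)
    define z where "z = 12 * (t - 1 / 3) - 1"
    have z: "- 1 \<le> z" "z < 1" "T' z = t"
      using t by (auto simp: z_def T'_def)
    have "direct_leg t = Complex 1 z"
      unfolding z_def using t by (intro direct) auto
    then have "x = level_point (q' z) z"
      using z x lp by (simp add: q'_def c_def)
    then show "x \<in> (\<lambda>z. level_point (q' z) z) ` {- 1..<1}"
      using z by auto
  qed
  have "ambient_isotopic (L \<union> (\<lambda>z. level_point (q z) z) ` {- 1..<1}) (L \<union> (\<lambda>z. level_point (q' z) z) ` {- 1..<1})"
  proof (rule vertical_strand_isotopy [where R = "3 / 2"])
    have "continuous_on UNIV c"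
      unfolding c_def by (intro continuous_intros)
    then show "continuous_on UNIV q" "continuous_on UNIV q'"
      unfolding q_def q'_def T_def T'_def using m by (auto intro!: continuous_intros)
    show "q' z = q z" if "1 \<le> \<bar>z\<bar>" for z
    proof -
      have "c z = - 1 \<or> c z = 1"
        using that by (auto simp: c_def)
      then show ?thesis
        using full_turn [of "1 / 2"] by (auto simp: q_def q'_def T_def T'_def)
    qed
    show "1 \<le> \<bar>x $ 3\<bar> \<or> 3 / 2 \<le> norm (plane_part x)" if x: "x \<in> L" for x
    proof -
      obtain t \<zeta> where t: "0 \<le> t" "t < m" and x': "x = page_point (t / m) \<zeta>" and \<zeta>: "\<zeta> \<in> P t"
        using x by (auto simp: L_def loop_closure_def)
      have "3 / 2 \<le> Re \<zeta> \<or> 1 \<le> \<bar>Im \<zeta>\<bar>"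
      proof -
        have "2 \<le> Re \<zeta>" if "\<zeta> \<in> outer t"
          using outer_Re that by blast
        moreover have "1 \<le> Im (over_leg t) \<or> 2 \<le> Re (over_leg t)" if "1 / 2 \<le> t"
          using that by (cases "t \<le> 2 / 3") (simp_all add: over_leg_def ramp_def)
        moreover have "Im (under_leg t) \<le> - 1 \<or> 2 \<le> Re (under_leg t)" if "t < 1 / 3"
          using that t by (cases "t \<le> 1 / 6") (simp_all add: under_leg_def ramp_def)
        ultimately show ?thesis
          using \<zeta> by (auto simp: P_def split: if_splits)
      qed
      then show ?thesis
        using x' norm_plane_part_page_point [of "t / m" \<zeta>] by auto
    qed
  qed (auto simp: q_def q'_def)
  also have "L \<union> (\<lambda>z. level_point (q z) z) ` {- 1..<1}
      = loop_closure m (\<lambda>t. outer t \<union> (if t \<le> 1 then {over_leg t} else {}) \<union> {climb t})"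
    unfolding helix L_def Un [symmetric]
    by (rule loop_closure_cong) (auto simp: P_def H_def climb_def)
  also have "L \<union> (\<lambda>z. level_point (q' z) z) ` {- 1..<1}
      = loop_closure m (\<lambda>t. outer t \<union> (if t \<le> 1 then {direct_leg t} else {}))"
    unfolding straight L_def Un [symmetric]
  proof (rule loop_closure_cong)
    fix t :: real
    have "direct_leg t = under_leg t" if "t < 1 / 3"
      using that by (simp add: direct_leg_def under_leg_def ramp_def)
    moreover have "direct_leg t = over_leg t" if "1 / 2 \<le> t"
      using that by (simp add: direct_leg_def over_leg_def ramp_def)
    ultimately show "P t \<union> H' t = outer t \<union> (if t \<le> 1 then {direct_leg t} else {})"
      by (auto simp: P_def H'_def)
  qed
  finally show ?thesis .
qed

text \<open>Without the turn around the axis, the strand stays between the axis and the strands of \<open>rest\<close>.\<close>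

private lemma kink_straighten:
  "ambient_isotopic
    (loop_closure m (\<lambda>t. outer t \<union> (if t \<le> 1 then {direct_leg t} else {})))
    (loop_closure m (\<lambda>t. (\<lambda>z. z + 1) ` (if t \<le> 1 then of_nat ` {1..n} else word_motion n v (t - 1))))"
proof -
  have "ambient_isotopic
      (loop_closure m (\<lambda>t. outer t \<union> (if t \<in> {0..1} then (\<lambda>a. direct_leg t) ` {()} else {})))
      (loop_closure m (\<lambda>t. outer t \<union> (if t \<in> {0..1} then (\<lambda>a. 2) ` {()} else {})))"
  proof (rule straight_isotopy [where \<rho>\<^sub>0 = 1])
    show "continuous_on {0..1} direct_leg" "continuous_on {0..1} (\<lambda>t. 2)"
      by (intro continuous_on_legs continuous_on_const)+
    show "2 = direct_leg 0" "2 = direct_leg 1"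
      by (auto simp: direct_leg_def ramp_def complex_eq_iff)
    have Re: "1 \<le> Re (direct_leg t) \<and> Re (direct_leg t) \<le> 2" for t
      by (auto simp: direct_leg_def ramp_def)
    then show "1 \<le> Re (direct_leg t)" for t
      by blast
    show "1 \<le> norm (f - ((1 - s) *\<^sub>R direct_leg t + s *\<^sub>R 2))"
      if "s \<in> {0..1}" "t \<in> {0..1}" "f \<in> outer t" for f s t
    proof -
      have "(1 - s) * Re (direct_leg t) + s * 2 \<le> (1 - s) * 2 + s * 2"
        using that(1) Re by (intro add_mono mult_left_mono) auto
      moreover have "3 \<le> Re f"
        using that rest_Re by (simp add: outer_def)
      ultimately have "1 \<le> Re (f - ((1 - s) *\<^sub>R direct_leg t + s *\<^sub>R 2))"
        by simp
      then show ?thesis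
        using complex_Re_le_cmod order_trans by blast
    qed
    show "0 \<le> Re f" if "f \<in> outer t" for t f
      using outer_Re [OF that] by simp
  qed (use m in auto)
  moreover have "loop_closure m (\<lambda>t. outer t \<union> (if t \<in> {0..1} then (\<lambda>a. direct_leg t) ` {()} else {}))
      = loop_closure m (\<lambda>t. outer t \<union> (if t \<le> 1 then {direct_leg t} else {}))"
    by (rule loop_closure_cong) auto
  moreover have "loop_closure m (\<lambda>t. outer t \<union> (if t \<in> {0..1} then (\<lambda>a. 2) ` {()} else {}))
      = loop_closure m (\<lambda>t. (\<lambda>z. z + 1) ` (if t \<le> 1 then of_nat ` {1..n} else word_motion n v (t - 1)))"
    using shift_start word_motion_0 [OF v] by (intro loop_closure_cong) (auto simp: outer_def)
  ultimately show ?thesis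
    by simp
qed

text \<open>The first unit interval of the distance from the axis is stretched to length 2.\<close>

private lemma shift_outwards:
  "ambient_isotopic
    (loop_closure m (\<lambda>t. if t \<le> 1 then of_nat ` {1..n} else word_motion n v (t - 1)))
    (loop_closure m (\<lambda>t. (\<lambda>z. z + 1) ` (if t \<le> 1 then of_nat ` {1..n} else word_motion n v (t - 1))))"
proof -
  define P where "P t = (if t \<le> 1 then of_nat ` {1..n} else word_motion n v (t - 1))" for t
  define h where "h s t z = z + of_real (s * max 0 (min 1 (Re z)))" for s t :: real and z
  have P: "1 \<le> Re z" if "z \<in> P t" for z t
    using that word_motion_Re [OF _ v, of z "t - 1"] by (auto simp: P_def split: if_splits)
  have "ambient_isotopic (loop_closure m P) (loop_closure m (\<lambda>t. h 1 t ` P t))"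
  proof (rule loop_page_isotopy)
    show "continuous_on ({0..1} \<times> {0..m} \<times> {z. 0 \<le> Re z}) (\<lambda>(s, t, z). h s t z)"
      unfolding h_def split_def by (intro continuous_intros)
    show "bij_betw (h s t) {z. 0 \<le> Re z} {z. 0 \<le> Re z}" if s: "s \<in> {0..1}" for s t
    proof (rule bij_betw_half_plane)
      define g where "g x = (if x \<le> 0 then x else if x \<le> 1 + s then x / (1 + s) else x - s)" for x
      have "Complex (g (Re z)) (Im z) = w" if "z = h s t w" for z w
      proof -
        consider "Re w \<le> 0" | "0 < Re w" "Re w \<le> 1" | "1 < Re w"
          by linarith
        then show ?thesis
        proof cases
          case 2
          then have "Re z = Re w * (1 + s)"
            by (simp add: that h_def algebra_simps)
          moreover have "Re w * (1 + s) \<le> 1 * (1 + s)"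
            using s 2 by (intro mult_right_mono) auto
          moreover have "0 < Re w * (1 + s)"
            using s 2 by (intro mult_pos_pos) auto
          ultimately have "g (Re z) = Re w"
            using s by (simp add: g_def)
          then show ?thesis
            by (simp add: that h_def complex_eq_iff)
        qed (use s in \<open>auto simp: that h_def g_def complex_eq_iff\<close>)
      qed
      moreover have "h s t (Complex (g (Re z)) (Im z)) = z" for z
      proof -
        consider "Re z \<le> 0" | "0 < Re z" "Re z \<le> 1 + s" | "1 + s < Re z"
          by linarith
        then show ?thesis
        proof cases
          case 2
          define x where "x = Re z / (1 + s)"
          have "x * (1 + s) = Re z"
            using s by (simp add: x_def)
          then have "x + s * x = Re z"
            by (simp add: algebra_simps)
          moreover have "0 < x" "x \<le> 1"
            using s 2 by (auto simp: x_def)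
          moreover have "g (Re z) = x"
            using 2 by (simp add: g_def x_def)
          ultimately show ?thesis
            by (simp add: h_def complex_eq_iff)
        qed (use s in \<open>auto simp: h_def g_def complex_eq_iff\<close>)
      qed
      ultimately show "bij (h s t)"
        by (intro o_bij [of "\<lambda>z. Complex (g (Re z)) (Im z)"]) (auto simp: fun_eq_iff)
    qed (simp add: h_def)
    show "0 \<le> Re z" if "z \<in> P t" for t z
      using P [OF that] by simp
  qed (use m in \<open>auto simp: h_def\<close>)
  also have "loop_closure m (\<lambda>t. h 1 t ` P t) = loop_closure m (\<lambda>t. (\<lambda>z. z + 1) ` P t)"
    using P by (intro loop_closure_cong image_cong refl) (auto simp: h_def)
  finally show ?thesis
    by (simp only: P_def)
qed

text \<open>The free position 1 is closed up, and the pause that remains of the letter 1 is removed.\<close>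

lemma braid_closure_destabilise:
  "ambient_isotopic (braid_closure (n + 1) (1 # map Suc v)) (braid_closure n v)"
  using kink_spread kink_helix kink_unwind kink_straighten shift_outwards
    braid_closure_pause [OF v, folded m_def]
  by (meson ambient_isotopic_sym ambient_isotopic_trans)

end

section \<open>Braid words of Young diagrams\<close>

lemma braid_word_eq_context: "braid_word_eq w w' \<Longrightarrow> braid_word_eq (a @ w @ b) (a @ w' @ b)"
proof (induction rule: braid_word_eq.induct)
  case (commute i j u v)
  then show ?case
    using braid_word_eq.commute [of i j "a @ u" "v @ b"] by simp
next
  case (braid u i v)
  show ?case
    using braid_word_eq.braid [of "a @ u" i "v @ b"] by simp
qed (blast intro: braid_word_eq.intros)+

lemma braid_word_eq_append:
  assumes "braid_word_eq u u'" "braid_word_eq v v'"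
  shows "braid_word_eq (u @ v) (u' @ v')"
  using braid_word_eq_context [OF assms(1), of "[]" v] braid_word_eq_context [OF assms(2), of u' "[]"]
  by (auto intro: braid_word_eq.trans)

lemma braid_word_eq_commute_letter:
  assumes "\<And>x. x \<in> set w \<Longrightarrow> i + 2 \<le> x \<or> x + 2 \<le> i"
  shows "braid_word_eq (i # w) (w @ [i])"
  using assms
proof (induction w)
  case Nil
  show ?case
    by (simp add: braid_word_eq.refl)
next
  case (Cons x w)
  have "braid_word_eq ([] @ [i, x] @ w) ([] @ [x, i] @ w)"
    using Cons.prems [of x] braid_word_eq.commute [of i x "[]" w]
      braid_word_eq.sym [OF braid_word_eq.commute [of x i "[]" w]]
    by auto
  moreover have "braid_word_eq ([x] @ (i # w) @ []) ([x] @ (w @ [i]) @ [])"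
    using Cons by (intro braid_word_eq_context) auto
  ultimately show ?case
    by (auto intro: braid_word_eq.trans)
qed

text \<open>
  The letter passes the end of the row freely, turns into its successor by a braid relation, and passes
  the beginning of the row freely.
\<close>

lemma slide_letter:
  assumes "a \<le> i" "i + 1 < b"
  shows "braid_word_eq ([a..<b] @ [i]) ((i + 1) # [a..<b])"
proof -
  have split: "[a..<b] = [a..<i] @ [i, i + 1] @ [i + 2..<b]"
  proof -
    have "[a..<b] = [a..<i] @ [i..<b]"
      using assms upt_add_eq_append [of a i "b - i"] by simp
    also have "[i..<b] = i # (i + 1) # [i + 2..<b]"
      using assms by (simp add: upt_conv_Cons)
    finally show ?thesis
      by simp
  qed
  have "braid_word_eq (([a..<i] @ [i, i + 1]) @ ([i + 2..<b] @ [i]) @ []) (([a..<i] @ [i, i + 1]) @ (i # [i + 2..<b]) @ [])"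
    by (intro braid_word_eq_context braid_word_eq.sym [OF braid_word_eq_commute_letter]) auto
  moreover have "braid_word_eq ([a..<i] @ [i, i + 1, i] @ [i + 2..<b]) ([a..<i] @ [i + 1, i, i + 1] @ [i + 2..<b])"
    by (rule braid_word_eq.braid)
  moreover have "braid_word_eq ([] @ ([a..<i] @ [i + 1]) @ ([i, i + 1] @ [i + 2..<b])) ([] @ ((i + 1) # [a..<i]) @ ([i, i + 1] @ [i + 2..<b]))"
    by (intro braid_word_eq_context braid_word_eq.sym [OF braid_word_eq_commute_letter]) auto
  ultimately show ?thesis
    unfolding split by (auto intro: braid_word_eq.trans)
qed

lemma slide_word:
  assumes "\<And>x. x \<in> set w \<Longrightarrow> a \<le> x \<and> x + 1 < b"
  shows "braid_word_eq ([a..<b] @ w) (map Suc w @ [a..<b])"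
  using assms
proof (induction w)
  case Nil
  show ?case
    by (simp add: braid_word_eq.refl)
next
  case (Cons x w)
  have "braid_word_eq ([] @ ([a..<b] @ [x]) @ w) ([] @ ((x + 1) # [a..<b]) @ w)"
    using Cons.prems [of x] by (intro braid_word_eq_context slide_letter) auto
  moreover have "braid_word_eq ([Suc x] @ ([a..<b] @ w) @ []) ([Suc x] @ (map Suc w @ [a..<b]) @ [])"
    using Cons by (intro braid_word_eq_context) auto
  ultimately show ?case
    by (auto intro: braid_word_eq.trans)
qed

text \<open>The braid word of the T-link whose diagram has the given row lengths.\<close>

definition rows :: "nat list \<Rightarrow> nat list" where
  "rows ds = concat (map (\<lambda>d. [1..<d]) ds)"

text \<open>
  The Lorenz braid: the strands at \<open>k\<close>, \<open>k + 1\<close>, \<dots> pass to the right, each above as many strands as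
  its row has boxes. The strand of the last row moves first, to make way for the others.
\<close>

fun lorenz :: "nat \<Rightarrow> nat list \<Rightarrow> nat list" where
  "lorenz k [] = []"
| "lorenz k (d # ds) = lorenz (Suc k) ds @ [k..<k + d]"

lemma map_Suc_lorenz: "map Suc (lorenz k ds) = lorenz (Suc k) ds"
  by (induction ds arbitrary: k) (simp_all add: map_Suc_upt)

lemma lorenz_append: "lorenz k (ds @ es) = lorenz (k + length ds) es @ lorenz k ds"
  by (induction ds arbitrary: k) simp_all

lemma lorenz_letters:
  assumes "x \<in> set (lorenz k ds)" "\<And>d. d \<in> set ds \<Longrightarrow> d \<le> n"
  shows "k \<le> x \<and> x + 1 < k + length ds + n"
  using assms
proof (induction ds arbitrary: k)
  case (Cons d ds)
  show ?case
  proof (cases "x \<in> set (lorenz (Suc k) ds)")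
    case True
    then show ?thesis
      using Cons.IH [OF True] Cons.prems(2) by auto
  next
    case False
    then show ?thesis
      using Cons.prems by fastforce
  qed
qed simp

text \<open>
  In the Lorenz braid the letter 1 occurs only once, at the start of the first row \<open>[1..<1 + d]\<close>.
  Destabilisation removes it and leaves \<open>[1..<d]\<close>, after the indices are lowered by one, which is a row
  of the T-link. The rows \<open>es\<close> that have been transformed before contain the letter 1, too; but they are
  not longer than \<open>d\<close>, so sliding them past \<open>[1..<1 + d]\<close> raises all their letters by one.
\<close>

lemma lorenz_destabilise:
  assumes "sorted ds" "\<And>d. d \<in> set ds \<Longrightarrow> 1 \<le> d" "\<And>d e. d \<in> set ds \<Longrightarrow> e \<in> set es \<Longrightarrow> e \<le> d"
    and "\<And>d. d \<in> set (es @ ds) \<Longrightarrow> d \<le> n" and n: "1 \<le> n"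
  shows "ambient_isotopic (braid_closure (n + length ds) (lorenz 1 ds @ rows es)) (braid_closure n (rows (es @ ds)))"
  using assms
proof (induction ds arbitrary: es)
  case Nil
  show ?case
    by (simp add: ambient_isotopic_refl)
next
  case (Cons d ds)
  define N where "N = n + length ds"
  define w where "w = lorenz 1 ds @ rows es"
  have rows_letters: "1 \<le> x \<and> x < d \<and> x < n" if "x \<in> set (rows es)" for x
    using that Cons.prems(3) [of d] Cons.prems(4) by (fastforce simp: rows_def)
  have d: "1 \<le> d" "d \<le> n"
    using Cons.prems(2,4) by auto
  have w: "set w \<subseteq> {1..<N}"
  proof
    fix x assume "x \<in> set w"
    then show "x \<in> {1..<N}"
      using lorenz_letters [of x 1 ds n] rows_letters [of x] Cons.prems(4) by (auto simp: w_def N_def)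
  qed
  have row: "[1..<1 + d] = 1 # map Suc [1..<d]"
    using d by (simp add: upt_conv_Cons map_Suc_upt)
  have lo: "lorenz 2 ds @ map Suc (rows es) = map Suc w"
    by (simp add: w_def map_Suc_lorenz numeral_2_eq_2)
  have "braid_word_eq (lorenz 2 ds @ ([1..<1 + d] @ rows es) @ []) (lorenz 2 ds @ (map Suc (rows es) @ [1..<1 + d]) @ [])"
    by (intro braid_word_eq_context slide_word) (use rows_letters in force)
  moreover have "lorenz 1 (d # ds) @ rows es = lorenz 2 ds @ ([1..<1 + d] @ rows es) @ []"
    by (simp add: numeral_2_eq_2)
  moreover have "lorenz 2 ds @ (map Suc (rows es) @ [1..<1 + d]) @ [] = map Suc w @ 1 # map Suc [1..<d]"
    by (simp only: row lo [symmetric] append_assoc append_Nil2)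
  ultimately have eq: "braid_word_eq (lorenz 1 (d # ds) @ rows es) (map Suc w @ 1 # map Suc [1..<d])"
    by simp
  have letters: "set (map Suc w @ 1 # map Suc [1..<d]) \<subseteq> {1..<N + 1}"
    using w d n by (auto simp: N_def)
  have "ambient_isotopic (braid_closure (N + 1) (lorenz 1 (d # ds) @ rows es))
      (braid_closure (N + 1) (map Suc w @ 1 # map Suc [1..<d]))"
    using letters braid_word_eq_set [OF eq] by (intro braid_closure_word_eq [OF eq]) simp
  moreover have "ambient_isotopic \<dots> (braid_closure (N + 1) (1 # map Suc ([1..<d] @ w)))"
    using braid_closure_rotate [OF letters] by simp
  moreover have "ambient_isotopic \<dots> (braid_closure N ([1..<d] @ w))"
    using w d n by (intro braid_closure_destabilise) (auto simp: N_def)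
  moreover have "ambient_isotopic \<dots> (braid_closure N (w @ [1..<d]))"
    using w d by (intro braid_closure_rotate) (auto simp: N_def)
  moreover have "w @ [1..<d] = lorenz 1 ds @ rows (es @ [d])"
    by (simp add: w_def rows_def)
  moreover have "ambient_isotopic (braid_closure (n + length ds) (lorenz 1 ds @ rows (es @ [d])))
      (braid_closure n (rows ((es @ [d]) @ ds)))"
    using Cons.prems by (intro Cons.IH) auto
  ultimately show ?case
    unfolding N_def by (simp del: lorenz.simps) (meson ambient_isotopic_trans)
qed

section \<open>Conjugate partitions\<close>

text \<open>
  The columns of the diagram with rows \<open>ds\<close> are listed from the last one back to the first one, so that
  their lengths increase like those of the rows.
\<close>

definition columns :: "nat list \<Rightarrow> nat \<Rightarrow> nat list" where
  "columns ds q = map (\<lambda>c. length (filter (\<lambda>d. c \<le> d) ds)) (rev [1..<q + 1])"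

lemma length_columns [simp]: "length (columns ds q) = q"
  by (simp add: columns_def)

lemma columns_Suc:
  "columns ds (Suc q) = columns (map (\<lambda>d. d - 1) ds) q @ [length (filter (\<lambda>d. 1 \<le> d) ds)]"
proof -
  have "[1..<Suc q + 1] = 1 # map Suc [1..<q + 1]"
    by (simp add: map_Suc_upt upt_conv_Cons del: upt_Suc)
  then have "rev [1..<Suc q + 1] = map Suc (rev [1..<q + 1]) @ [1]"
    by (simp only: rev.simps rev_map)
  moreover have "length (filter (\<lambda>d. Suc c \<le> d) ds) = length (filter (\<lambda>d. c \<le> d) (map (\<lambda>d. d - 1) ds))" if "1 \<le> c" for c
    using that by (induction ds) auto
  ultimately show ?thesis
    unfolding columns_def by (simp only: map_append map_map o_def list.map) (auto intro!: map_cong)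
qed

text \<open>
  In the word, the later rows stand before the earlier ones. The first letter of a row commutes with all
  letters of later rows but the first ones, so the first column can be read before the rest.
\<close>

lemma lorenz_first_column:
  assumes "sorted ds"
  shows "braid_word_eq (lorenz k ds)
    (rev [k + length ds - length (filter (\<lambda>d. 1 \<le> d) ds)..<k + length ds] @ lorenz (Suc k) (map (\<lambda>d. d - 1) ds))"
  using assms
proof (induction ds arbitrary: k)
  case Nil
  show ?case
    by (simp add: braid_word_eq.refl)
next
  case (Cons d ds)
  define h where "h = length (filter (\<lambda>d. 1 \<le> d) ds)"
  define R where "R = rev [Suc k + length ds - h..<Suc k + length ds]"
  define L where "L = lorenz (Suc (Suc k)) (map (\<lambda>d. d - 1) ds)"
  have IH: "braid_word_eq (lorenz (Suc k) ds) (R @ L)"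
    using Cons.IH [of "Suc k"] Cons.prems by (simp add: R_def L_def h_def del: upt_Suc)
  show ?case
  proof (cases "d = 0")
    case True
    then show ?thesis
      using IH by (simp add: R_def L_def h_def del: upt_Suc)
  next
    case False
    have "filter (\<lambda>d. 1 \<le> d) ds = ds"
      using Cons.prems False by (intro filter_True) auto
    then have h: "h = length ds"
      by (simp add: h_def)
    have "[k..<k + d] = k # [Suc k..<Suc k + (d - 1)]"
      using False by (simp add: upt_conv_Cons)
    then have "braid_word_eq (lorenz k (d # ds)) ((R @ L) @ k # [Suc k..<Suc k + (d - 1)])"
      using IH by (simp only: lorenz.simps) (intro braid_word_eq_append braid_word_eq.refl)
    moreover have "(R @ L) @ k # [Suc k..<Suc k + (d - 1)] = R @ (L @ [k]) @ [Suc k..<Suc k + (d - 1)]"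
      by simp
    moreover have "braid_word_eq (R @ (L @ [k]) @ [Suc k..<Suc k + (d - 1)]) (R @ (k # L) @ [Suc k..<Suc k + (d - 1)])"
    proof (intro braid_word_eq_context braid_word_eq.sym [OF braid_word_eq_commute_letter])
      fix x assume "x \<in> set L"
      then show "k + 2 \<le> x \<or> x + 2 \<le> k"
        using lorenz_letters [of x "Suc (Suc k)" "map (\<lambda>d. d - 1) ds" "Max (set (map (\<lambda>d. d - 1) ds))"]
        by (auto simp: L_def)
    qed
    moreover have "R @ (k # L) @ [Suc k..<Suc k + (d - 1)]
        = rev [k + length (d # ds) - length (filter (\<lambda>d. 1 \<le> d) (d # ds))..<k + length (d # ds)] @
          lorenz (Suc k) (map (\<lambda>d. d - 1) (d # ds))"
    proof -
      have "[k..<k + length (d # ds)] = k # [Suc k..<Suc k + length ds]"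
        by (simp add: upt_conv_Cons del: upt_Suc)
      then show ?thesis
        using False h by (simp add: R_def L_def h_def del: upt_Suc)
    qed
    ultimately show ?thesis
      by (simp only:) (rule braid_word_eq.trans)
  qed
qed

lemma braid_word_eq_flip:
  assumes "braid_word_eq w w'" "\<And>i. i \<in> set w \<Longrightarrow> i \<le> N"
  shows "braid_word_eq (map (\<lambda>i. N - i) w) (map (\<lambda>i. N - i) w')"
  using assms
proof (induction rule: braid_word_eq.induct)
  case (sym w w')
  then show ?case
    using braid_word_eq_set braid_word_eq.sym by blast
next
  case (trans w w' w'')
  then show ?case
    using braid_word_eq_set braid_word_eq.trans by blast
next
  case (commute i j u v)
  have "j \<le> N"
    by (rule commute.prems) simp
  then have "N - j + 2 \<le> N - i"
    using commute.hyps by linarith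
  then show ?case
    using braid_word_eq.sym [OF braid_word_eq.commute
        [of "N - j" "N - i" "map (\<lambda>i. N - i) u" "map (\<lambda>i. N - i) v"]]
    by simp
next
  case (braid u i v)
  have "i + 1 \<le> N"
    by (rule braid.prems) simp
  then have *: "N - i = (N - (i + 1)) + 1"
    by linarith
  show ?case
    using braid_word_eq.sym [OF braid_word_eq.braid [of "map (\<lambda>i. N - i) u" "N - (i + 1)" "map (\<lambda>i. N - i) v"]]
    unfolding * [symmetric] by (simp only: map_append list.map)
qed (simp add: braid_word_eq.refl)

text \<open>
  A half turn of the Lorenz braid transposes its diagram: the letter of a box depends only on the
  sum of its coordinates, and reading the diagram by columns instead of rows only exchanges distant letters.
\<close>

lemma lorenz_flip:
  assumes "sorted ds" "\<And>d. d \<in> set ds \<Longrightarrow> d \<le> q" "N + 2 = k + k' + length ds + q" "1 \<le> k" "1 \<le> k'"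
  shows "braid_word_eq (map (\<lambda>i. N - i) (lorenz k ds)) (lorenz k' (columns ds q))"
  using assms
proof (induction q arbitrary: ds k)
  case 0
  then have "lorenz k ds = []"
    by (induction ds arbitrary: k k') auto
  then show ?case
    by (simp add: columns_def braid_word_eq.refl)
next
  case (Suc q)
  define h where "h = length (filter (\<lambda>d. 1 \<le> d) ds)"
  define ds' where "ds' = map (\<lambda>d. d - 1) ds"
  have h: "h \<le> length ds"
    by (simp add: h_def)
  have "braid_word_eq (map (\<lambda>i. N - i) (lorenz k ds))
      (map (\<lambda>i. N - i) (rev [k + length ds - h..<k + length ds] @ lorenz (Suc k) ds'))"
    unfolding h_def ds'_def
  proof (intro braid_word_eq_flip lorenz_first_column Suc)
    show "i \<le> N" if "i \<in> set (lorenz k ds)" for i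
      using lorenz_letters [OF that Suc.prems(2)] Suc.prems(3,5) by simp
  qed
  moreover have "map (\<lambda>i. N - i) (rev [k + length ds - h..<k + length ds]) = [k' + q..<k' + q + h]"
  proof (rule nth_equalityI)
    show "map (\<lambda>i. N - i) (rev [k + length ds - h..<k + length ds]) ! i = [k' + q..<k' + q + h] ! i"
      if "i < length (map (\<lambda>i. N - i) (rev [k + length ds - h..<k + length ds]))" for i
      using that h Suc.prems(3) by (simp add: rev_nth)
  qed (use h in simp)
  moreover have "braid_word_eq (map (\<lambda>i. N - i) (lorenz (Suc k) ds')) (lorenz k' (columns ds' q))"
  proof (rule Suc.IH)
    show "sorted ds'"
      using Suc.prems(1) unfolding ds'_def by (simp add: sorted_wrt_map sorted_wrt_mono_rel [of _ "(\<le>)"])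
    show "d \<le> q" if "d \<in> set ds'" for d
      using that Suc.prems(2) by (force simp: ds'_def)
  qed (use Suc.prems in \<open>auto simp: ds'_def\<close>)
  moreover have "lorenz k' (columns ds (Suc q)) = [k' + q..<k' + q + h] @ lorenz k' (columns ds' q)"
    by (simp add: columns_Suc lorenz_append h_def ds'_def)
  ultimately show ?case
    by (auto intro: braid_word_eq.trans braid_word_eq_append [OF braid_word_eq.refl])
qed

text \<open>
  The Lorenz braid of a diagram with \<open>q\<close> columns has \<open>q + length ds\<close> strands. Destabilising it at its
  rows leaves \<open>q\<close> strands, and destabilising it at its columns after a half turn leaves \<open>length ds\<close>.
\<close>

theorem diagram_duality:
  assumes ds: "sorted ds" "\<And>d. d \<in> set ds \<Longrightarrow> 1 \<le> d \<and> d \<le> q" and q: "q \<in> set ds"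
  shows "ambient_isotopic (braid_closure q (rows ds)) (braid_closure (length ds) (rows (columns ds q)))"
proof -
  define N where "N = q + length ds"
  have p: "1 \<le> length ds" and "1 \<le> q"
    using q ds by (auto simp: Suc_le_eq)
  have letters: "set (lorenz 1 ds) \<subseteq> {1..<N}"
  proof
    fix x assume "x \<in> set (lorenz 1 ds)"
    then show "x \<in> {1..<N}"
      using lorenz_letters [of x 1 ds q] ds by (auto simp: N_def)
  qed
  have "ambient_isotopic (braid_closure N (lorenz 1 ds)) (braid_closure q (rows ds))"
    using lorenz_destabilise [of ds "[]" q] ds \<open>1 \<le> q\<close> by (simp add: N_def rows_def)
  moreover have "ambient_isotopic (braid_closure N (lorenz 1 ds)) (braid_closure N (map (\<lambda>i. N - i) (lorenz 1 ds)))"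
    by (rule braid_closure_flip [OF letters])
  moreover have "set (map (\<lambda>i. N - i) (lorenz 1 ds)) \<subseteq> {1..<N}"
    using letters by force
  then have "ambient_isotopic (braid_closure N (map (\<lambda>i. N - i) (lorenz 1 ds)))
      (braid_closure N (lorenz 1 (columns ds q)))"
    using ds by (intro braid_closure_word_eq lorenz_flip) (auto simp: N_def)
  moreover have "ambient_isotopic (braid_closure N (lorenz 1 (columns ds q)))
      (braid_closure (length ds) (rows (columns ds q)))"
  proof -
    have "sorted (columns ds q)"
    proof -
      have "length (filter (\<lambda>d. c' \<le> d) ds) \<le> length (filter (\<lambda>d. c \<le> d) ds)" if "c \<le> c'" for c c'
        using that by (induction ds) auto
      then show ?thesis
        unfolding columns_def sorted_map sorted_wrt_rev
        by (intro sorted_wrt_mono_rel [OF _ sorted_upt]) auto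
    qed
    moreover have "1 \<le> e \<and> e \<le> length ds" if e: "e \<in> set (columns ds q)" for e
    proof -
      obtain c where "c \<in> set (rev [1..<q + 1])" and e: "e = length (filter (\<lambda>d. c \<le> d) ds)"
        using e unfolding columns_def set_map by blast
      then have "c \<le> q"
        by auto
      then have "filter (\<lambda>d. c \<le> d) ds \<noteq> []"
        using q by (auto simp: filter_empty_conv)
      then show ?thesis
        by (simp add: e Suc_le_eq)
    qed
    ultimately show ?thesis
      using lorenz_destabilise [of "columns ds q" "[]" "length ds"] p by (simp add: N_def rows_def add.commute)
  qed
  ultimately show ?thesis
    using ambient_isotopic_sym ambient_isotopic_trans by meson
qed

theorem corollary4:
  fixes k :: nat and r s r' s' :: "nat \<Rightarrow> nat"
  assumes "1 \<le> k"
    and "2 \<le> r 1"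
    and "\<And>i. 1 \<le> i \<Longrightarrow> i < k \<Longrightarrow> r i < r (i + 1)"
    and "\<And>i. 1 \<le> i \<Longrightarrow> i \<le> k \<Longrightarrow> 1 \<le> s i"
    and "2 \<le> s k"
    and "\<And>j. 1 \<le> j \<Longrightarrow> j \<le> k \<Longrightarrow> r' j = (\<Sum>i = k + 1 - j..k. s i)"
    and "\<And>j. 1 \<le> j \<Longrightarrow> j < k \<Longrightarrow> s' j = r (k + 1 - j) - r (k - j)"
    and "s' k = r 1"
  shows "ambient_isotopic (T_link k r s) (T_link k r' s')"
proof -
  (* The rows of the diagram; the dual parameters turn out to list its columns. *)
  define ds where "ds = concat (map (\<lambda>i. replicate (s i) (r i)) [1..<k + 1])"
  have T_word: "T_word k \<rho> \<sigma> = rows (concat (map (\<lambda>i. replicate (\<sigma> i) (\<rho> i)) [1..<k + 1]))" for \<rho> \<sigma>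
  proof -
    have "concat (replicate a [1..<b]) = rows (replicate a b)" for a b
      by (simp add: rows_def)
    moreover have "rows (concat xss) = concat (map rows xss)" for xss
      by (induction xss) (simp_all add: rows_def)
    ultimately show ?thesis
      by (simp add: T_word_def o_def)
  qed
  have mono: "r i \<le> r j" if "1 \<le> i" "i \<le> j" "j \<le> k" for i j
    using that(2,3)
  proof (induction j rule: dec_induct)
    case (step j)
    then show ?case
      using assms(3) [of j] that(1) by simp
  qed simp
  have sorted: "sorted (concat (map (\<lambda>i. replicate (s i) (r i)) [1..<j + 1]))" if "j \<le> k" for j
    using that
  proof (induction j)
    case (Suc j)
    have "sorted (concat (map (\<lambda>i. replicate (s i) (r i)) [1..<j + 1]) @ replicate (s (Suc j)) (r (Suc j)))"
      unfolding sorted_append using Suc mono by (auto simp: sorted_replicate)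
    then show ?case
      by simp
  qed simp
  have bounds: "1 \<le> d \<and> d \<le> r k" if d: "d \<in> set ds" for d
  proof -
    obtain i where "1 \<le> i" "i \<le> k" "d = r i"
      using d by (auto simp: ds_def split: if_splits)
    then show ?thesis
      using mono [of 1 i] mono [of i k] assms(2) by auto
  qed
  have "r k \<in> set ds"
    using assms(1) assms(4) [of k] by (auto simp: ds_def intro!: bexI [of _ k])
  have len: "length (filter P ds) = (\<Sum>i\<in>{1..k}. if P (r i) then s i else 0)" for P
  proof -
    have "length (filter P ds) = sum_list (map (\<lambda>i. if P (r i) then s i else 0) [1..<k + 1])"
      by (auto simp: ds_def filter_concat length_concat o_def intro!: arg_cong [of _ _ sum_list] map_cong)
    also have "\<dots> = (\<Sum>i\<in>{1..k}. if P (r i) then s i else 0)"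
      by (subst interv_sum_list_conv_sum_set_nat) (auto intro!: sum.cong)
    finally show ?thesis .
  qed
  (* The columns from R i + 1 to R (i + 1) meet exactly the rows of length at least r (i + 1). *)
  define R where "R i = (if i = 0 then 0 else r i)" for i
  have "columns ds (r k) = concat (map (\<lambda>j. replicate (s' j) (r' j)) [1..<k + 1])"
  proof -
    have "map (\<lambda>c. length (filter (\<lambda>d. c \<le> d) ds)) (rev [1..<R i + 1])
        = concat (map (\<lambda>j. replicate (s' j) (r' j)) [k + 1 - i..<k + 1])" if "i \<le> k" for i
      using that
    proof (induction i)
      case 0
      show ?case
        by (simp add: R_def)
    next
      case (Suc i)
      define j where "j = k - i"
      have j: "1 \<le> j" "j \<le> k" "k + 1 - j = i + 1"
        using Suc.prems by (auto simp: j_def)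
      have "R i \<le> R (Suc i)"
        using Suc.prems mono [of i "Suc i"] by (auto simp: R_def)
      then have "[1..<R (Suc i) + 1] = [1..<R i + 1] @ [R i + 1..<R (Suc i) + 1]"
        using upt_add_eq_append [of 1 "R i + 1" "R (Suc i) - R i"] by simp
      moreover have "length (filter (\<lambda>d. c \<le> d) ds) = r' j" if c: "R i < c" "c \<le> R (Suc i)" for c
      proof -
        have "c \<le> r l \<longleftrightarrow> i + 1 \<le> l" if "l \<in> {1..k}" for l
          using that c mono [of "Suc i" l] mono [of l i] Suc.prems by (cases "i + 1 \<le> l") (auto simp: R_def split: if_splits)
        then have "length (filter (\<lambda>d. c \<le> d) ds) = (\<Sum>l\<in>{1..k}. if i + 1 \<le> l then s l else 0)"
          unfolding len by (intro sum.cong) auto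
        also have "\<dots> = (\<Sum>l\<in>{i + 1..k}. s l)"
          by (intro sum.mono_neutral_cong_right) auto
        finally show ?thesis
          using assms(6) [of j] j by simp
      qed
      then have "map (\<lambda>c. length (filter (\<lambda>d. c \<le> d) ds)) (rev [R i + 1..<R (Suc i) + 1])
          = replicate (R (Suc i) - R i) (r' j)"
        by (intro replicate_eqI) auto
      moreover have "s' j = R (Suc i) - R i"
        using assms(7) [of j] assms(8) Suc.prems j by (cases "i = 0") (auto simp: R_def j_def)
      moreover have "[k + 1 - Suc i..<k + 1] = j # [k + 1 - i..<k + 1]"
        using Suc.prems by (simp add: j_def upt_conv_Cons Suc_diff_Suc Suc_diff_le del: upt_Suc)
      ultimately show ?case
        using Suc by (simp del: upt_Suc)
    qed
    from this [of k] show ?thesis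
      using assms(1) by (simp add: columns_def R_def del: upt_Suc)
  qed
  moreover have "length ds = r' k"
    using len [of "\<lambda>_. True"] assms(1) assms(6) [of k] by simp
  moreover have "ambient_isotopic (braid_closure (r k) (rows ds)) (braid_closure (length ds) (rows (columns ds (r k))))"
    by (rule diagram_duality [OF sorted [OF order_refl, folded ds_def] bounds \<open>r k \<in> set ds\<close>])
  ultimately show ?thesis
    unfolding T_link_def T_word ds_def [symmetric] by (simp only:)
qed

end
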